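(* A local ring $(R,\mathfrak m,k)$ is strongly homologically of minimal multiplicity if and only if there exist a local ring homomorphism $\varphi\colon(R,\mathfrak m,k)\to (S,\mathfrak n,l)$ and a finitely generated $S$-module $N\neq 0$ such that (1) the ring $S$ has a canonical module $\omega_{S}$, (2) the map $\varphi$ is flat with Gorenstein closed fibre $S/\mathfrak m S$, (3) one has $N\in\mathcal B(S)$, and (4) one has $\mathfrak n^2N=0$.
   Context: All local rings are commutative and noetherian; $(R,\mathfrak m,k)$ denotes a local ring with maximal ideal $\mathfrak m$ and residue field $k$. A local ring homomorphism is a ring homomorphism of local rings mapping the maximal ideal into the maximal ideal. For a finitely generated $R$-module $N$, $\beta_i^R(N)=\dim_k\operatorname{Tor}_i^R(N,k)$. A finitely generated $R$-module $\omega_R$ is a canonical module for $R$ if $\operatorname{Ext}^i_R(k,\omega_R)\cong k$ for $i=\dim(R)$ and $\operatorname{Ext}^i_R(k,\omega_R)=0$ for $i\neq\dim(R)$. Let $S$ be a Cohen-Macaulay local ring with canonical module $\omega_S$. The Auslander class $\mathcal A(S)$ consists of all $S$-modules $M$ such that (i) the natural map $M\to\operatorname{Hom}_S(\omega_S,\omega_S\otimes_SM)$, $x\mapsto(w\mapsto w\otimes x)$, is an isomorphism, and (ii) $\operatorname{Tor}^S_i(\omega_S,M)=0=\operatorname{Ext}^i_S(\omega_S,\omega_S\otimes_SM)$ for all $i\geq 1$. The Bass class $\mathcal B(S)$ consists of all $S$-modules $M$ such that (i) the natural map $\omega_S\otimes_S\operatorname{Hom}_S(\omega_S,M)\to M$,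 $x\otimes\psi\mapsto\psi(x)$, is an isomorphism, and (ii) $\operatorname{Ext}_S^i(\omega_S,M)=0=\operatorname{Tor}^S_i(\omega_S,\operatorname{Hom}_S(\omega_S,M))$ for all $i\geq 1$. The ring $R$ is strongly homologically of minimal multiplicity of type $(m,n)$ (integers, $m\geq 1$, $n\geq 0$) if there exist a local ring homomorphism $\varphi\colon(R,\mathfrak m,k)\to(S,\mathfrak n,l)$ and a finitely generated $S$-module $M\neq 0$ such that: $S$ has a canonical module $\omega_S$; $\varphi$ is flat with Gorenstein closed fibre $S/\mathfrak mS$; $M\in\mathcal A(S)$; and $\mathfrak n^2M=0$, $m=\beta^S_0(M)$ and $n=\beta^S_0(\mathfrak nM)$. It is strongly homologically of minimal multiplicity if it is so of some type $(m,n)$. *)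

theory Defs
  imports "HOL-Algebra.Algebra" "HOL-Library.Extended_Nat"
begin

text \<open>
  Rings and modules are the records of HOL-Algebra; the fields \<open>mult\<close> and \<open>one\<close> of a module record
  are irrelevant and left undefined.

  HOL cannot quantify over types, so wherever a definition quantifies over modules, they live in
  one fixed carrier type.  The type \<open>(nat \<Rightarrow> 'a) set\<close> used below loses nothing where it is used:
  a finitely generated module over a ring on the type \<open>'a\<close> is isomorphic to a set of cosets of a
  submodule of a free module of finite rank, whose elements are functions \<open>nat \<Rightarrow> 'a\<close>.
\<close>

type_synonym 'a coset_module = "('a, (nat \<Rightarrow> 'a) set) module"


section \<open>Local rings\<close>

definition local_ring :: "'a ring \<Rightarrow> bool" where
  "local_ring R \<longleftrightarrow> cring R \<and> noetherian_ring R \<and> (\<exists>!\<mm>. maximalideal \<mm> R)"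

definition max_ideal :: "'a ring \<Rightarrow> 'a set" where
  "max_ideal R = (THE \<mm>. maximalideal \<mm> R)"

definition local_ring_hom :: "'a ring \<Rightarrow> 'b ring \<Rightarrow> ('a \<Rightarrow> 'b) \<Rightarrow> bool" where
  "local_ring_hom R S \<phi> \<longleftrightarrow>
     local_ring R \<and> local_ring S \<and> \<phi> \<in> ring_hom R S \<and> \<phi> ` max_ideal R \<subseteq> max_ideal S"

definition krull_dim :: "'a ring \<Rightarrow> enat" where
  "krull_dim R = Sup (enat ` {n. \<exists>p. (\<forall>i\<le>n. primeideal (p i) R) \<and> (\<forall>i<n. p i \<subset> p (Suc i))})"

text \<open>For elements of the maximal ideal of a local ring, the requirement that a regular sequence
  generate a proper ideal is automatic.\<close>

definition regular_seq :: "'a ring \<Rightarrow> nat \<Rightarrow> (nat \<Rightarrow> 'a) \<Rightarrow> bool" where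
  "regular_seq R n x \<longleftrightarrow>
     (\<forall>i<n. x i \<in> max_ideal R \<and>
        (\<forall>a\<in>carrier R. x i \<otimes>\<^bsub>R\<^esub> a \<in> Idl\<^bsub>R\<^esub> (x ` {..<i}) \<longrightarrow> a \<in> Idl\<^bsub>R\<^esub> (x ` {..<i})))"

definition depth :: "'a ring \<Rightarrow> enat" where
  "depth R = Sup (enat ` {n. \<exists>x. regular_seq R n x})"

definition cohen_macaulay :: "'a ring \<Rightarrow> bool" where
  "cohen_macaulay R \<longleftrightarrow> local_ring R \<and> depth R = krull_dim R"


section \<open>Modules\<close>

definition submod_span :: "'a ring \<Rightarrow> ('a, 'm) module \<Rightarrow> 'm set \<Rightarrow> 'm set" where
  "submod_span R M U = \<Inter>{H. submodule H R M \<and> U \<subseteq> H}"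

definition fin_gen :: "'a ring \<Rightarrow> ('a, 'm) module \<Rightarrow> bool" where
  "fin_gen R M \<longleftrightarrow> module R M \<and> (\<exists>U. finite U \<and> U \<subseteq> carrier M \<and> submod_span R M U = carrier M)"

definition zero_module :: "('a, 'm) module \<Rightarrow> bool" where
  "zero_module M \<longleftrightarrow> carrier M = {\<zero>\<^bsub>M\<^esub>}"

definition mod_hom :: "'a ring \<Rightarrow> ('a, 'm) module \<Rightarrow> ('a, 'n) module \<Rightarrow> ('m \<Rightarrow> 'n) set" where
  "mod_hom R M N = {f \<in> carrier M \<rightarrow> carrier N.
     (\<forall>x\<in>carrier M. \<forall>y\<in>carrier M. f (x \<oplus>\<^bsub>M\<^esub> y) = f x \<oplus>\<^bsub>N\<^esub> f y) \<and>
     (\<forall>a\<in>carrier R. \<forall>x\<in>carrier M. f (a \<odot>\<^bsub>M\<^esub> x) = a \<odot>\<^bsub>N\<^esub> f x)}"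

definition mod_iso :: "'a ring \<Rightarrow> ('a, 'm) module \<Rightarrow> ('a, 'n) module \<Rightarrow> ('m \<Rightarrow> 'n) set" where
  "mod_iso R M N = {f \<in> mod_hom R M N. bij_betw f (carrier M) (carrier N)}"

definition mod_isomorphic :: "'a ring \<Rightarrow> ('a, 'm) module \<Rightarrow> ('a, 'n) module \<Rightarrow> bool" where
  "mod_isomorphic R M N \<longleftrightarrow> mod_iso R M N \<noteq> {}"

definition self_module :: "'a ring \<Rightarrow> ('a, 'a) module" where
  "self_module R = \<lparr>carrier = carrier R, monoid.mult = undefined, one = undefined,
     ring.zero = \<zero>\<^bsub>R\<^esub>, ring.add = (\<oplus>\<^bsub>R\<^esub>), smult = (\<otimes>\<^bsub>R\<^esub>)\<rparr>"

definition restrict_scalars :: "'a ring \<Rightarrow> 'b ring \<Rightarrow> ('a \<Rightarrow> 'b) \<Rightarrow> ('a, 'b) module" where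
  "restrict_scalars R S \<phi> = \<lparr>carrier = carrier S, monoid.mult = undefined, one = undefined,
     ring.zero = \<zero>\<^bsub>S\<^esub>, ring.add = (\<oplus>\<^bsub>S\<^esub>), smult = (\<lambda>r s. \<phi> r \<otimes>\<^bsub>S\<^esub> s)\<rparr>"

definition quot_module :: "('a, 'm) module \<Rightarrow> 'm set \<Rightarrow> ('a, 'm set) module" where
  "quot_module M H = \<lparr>carrier = a_rcosets\<^bsub>M\<^esub> H, monoid.mult = undefined, one = undefined,
     ring.zero = H, ring.add = set_add M, smult = (\<lambda>a U. \<Union>x\<in>U. H +>\<^bsub>M\<^esub> (a \<odot>\<^bsub>M\<^esub> x))\<rparr>"

definition residue_field_module :: "'a ring \<Rightarrow> ('a, 'a set) module" where
  "residue_field_module R = quot_module (self_module R) (max_ideal R)"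

definition hom_module ::
    "'a ring \<Rightarrow> ('a, 'm) module \<Rightarrow> ('a, 'n) module \<Rightarrow> ('a, 'm \<Rightarrow> 'n) module" where
  "hom_module R M N = \<lparr>carrier = mod_hom R M N \<inter> extensional (carrier M),
     monoid.mult = undefined, one = undefined,
     ring.zero = (\<lambda>x\<in>carrier M. \<zero>\<^bsub>N\<^esub>),
     ring.add = (\<lambda>f g. \<lambda>x\<in>carrier M. f x \<oplus>\<^bsub>N\<^esub> g x),
     smult = (\<lambda>a f. \<lambda>x\<in>carrier M. a \<odot>\<^bsub>N\<^esub> f x)\<rparr>"

definition free_module :: "'a ring \<Rightarrow> 'i set \<Rightarrow> ('a, 'i \<Rightarrow> 'a) module" where
  "free_module R I = \<lparr>carrier = {f \<in> I \<rightarrow>\<^sub>E carrier R. finite {i \<in> I. f i \<noteq> \<zero>\<^bsub>R\<^esub>}},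
     monoid.mult = undefined, one = undefined,
     ring.zero = (\<lambda>i\<in>I. \<zero>\<^bsub>R\<^esub>),
     ring.add = (\<lambda>f g. \<lambda>i\<in>I. f i \<oplus>\<^bsub>R\<^esub> g i),
     smult = (\<lambda>a f. \<lambda>i\<in>I. a \<otimes>\<^bsub>R\<^esub> f i)\<rparr>"

definition free_gen :: "'a ring \<Rightarrow> 'i set \<Rightarrow> 'i \<Rightarrow> 'i \<Rightarrow> 'a" where
  "free_gen R I j = (\<lambda>i\<in>I. if i = j then \<one>\<^bsub>R\<^esub> else \<zero>\<^bsub>R\<^esub>)"


subsection \<open>Tensor products\<close>

definition tensor_rels ::
    "'a ring \<Rightarrow> ('a, 'm) module \<Rightarrow> ('a, 'n) module \<Rightarrow> ('m \<times> 'n \<Rightarrow> 'a) set" where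
  "tensor_rels R M N =
     (let F = free_module R (carrier M \<times> carrier N);
          e = (\<lambda>x y. free_gen R (carrier M \<times> carrier N) (x, y))
      in submod_span R F
       ({e (x \<oplus>\<^bsub>M\<^esub> x') y \<ominus>\<^bsub>F\<^esub> (e x y \<oplus>\<^bsub>F\<^esub> e x' y) | x x' y.
            x \<in> carrier M \<and> x' \<in> carrier M \<and> y \<in> carrier N} \<union>
        {e x (y \<oplus>\<^bsub>N\<^esub> y') \<ominus>\<^bsub>F\<^esub> (e x y \<oplus>\<^bsub>F\<^esub> e x y') | x y y'.
            x \<in> carrier M \<and> y \<in> carrier N \<and> y' \<in> carrier N} \<union>
        {e (a \<odot>\<^bsub>M\<^esub> x) y \<ominus>\<^bsub>F\<^esub> a \<odot>\<^bsub>F\<^esub> e x y | a x y.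
            a \<in> carrier R \<and> x \<in> carrier M \<and> y \<in> carrier N} \<union>
        {e x (a \<odot>\<^bsub>N\<^esub> y) \<ominus>\<^bsub>F\<^esub> a \<odot>\<^bsub>F\<^esub> e x y | a x y.
            a \<in> carrier R \<and> x \<in> carrier M \<and> y \<in> carrier N}))"

definition tensor ::
    "'a ring \<Rightarrow> ('a, 'm) module \<Rightarrow> ('a, 'n) module \<Rightarrow> ('a, ('m \<times> 'n \<Rightarrow> 'a) set) module" where
  "tensor R M N = quot_module (free_module R (carrier M \<times> carrier N)) (tensor_rels R M N)"

definition pure_tensor ::
    "'a ring \<Rightarrow> ('a, 'm) module \<Rightarrow> ('a, 'n) module \<Rightarrow> 'm \<Rightarrow> 'n \<Rightarrow> ('m \<times> 'n \<Rightarrow> 'a) set" where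
  "pure_tensor R M N x y =
     tensor_rels R M N +>\<^bsub>free_module R (carrier M \<times> carrier N)\<^esub>
       free_gen R (carrier M \<times> carrier N) (x, y)"

text \<open>The linear map out of the tensor product that corresponds to a bilinear map \<open>b\<close>.\<close>

definition tensor_lift ::
    "'a ring \<Rightarrow> ('a, 'm) module \<Rightarrow> ('a, 'n) module \<Rightarrow> ('a, 'p) module \<Rightarrow> ('m \<Rightarrow> 'n \<Rightarrow> 'p) \<Rightarrow>
      ('m \<times> 'n \<Rightarrow> 'a) set \<Rightarrow> 'p" where
  "tensor_lift R M N P b = (THE h. h \<in> carrier (hom_module R (tensor R M N) P) \<and>
     (\<forall>x\<in>carrier M. \<forall>y\<in>carrier N. h (pure_tensor R M N x y) = b x y))"

definition tensor_map_left ::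
    "'a ring \<Rightarrow> ('a, 'm) module \<Rightarrow> ('a, 'm') module \<Rightarrow> ('a, 'n) module \<Rightarrow> ('m \<Rightarrow> 'm') \<Rightarrow>
      ('m \<times> 'n \<Rightarrow> 'a) set \<Rightarrow> ('m' \<times> 'n \<Rightarrow> 'a) set" where
  "tensor_map_left R M M' N f =
     tensor_lift R M N (tensor R M' N) (\<lambda>x y. pure_tensor R M' N (f x) y)"

text \<open>The injectivity test over all finitely generated modules suffices for flatness.\<close>

definition flat_module :: "'a ring \<Rightarrow> ('a, 'm) module \<Rightarrow> bool" where
  "flat_module R M \<longleftrightarrow> module R M \<and>
     (\<forall>(U :: 'a coset_module) (V :: 'a coset_module) f.
        module R U \<and> module R V \<and> f \<in> mod_hom R U V \<and> inj_on f (carrier U) \<longrightarrow>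
        inj_on (tensor_map_left R U V M f) (carrier (tensor R U M)))"

definition flat_hom :: "'a ring \<Rightarrow> 'b ring \<Rightarrow> ('a \<Rightarrow> 'b) \<Rightarrow> bool" where
  "flat_hom R S \<phi> \<longleftrightarrow> flat_module R (restrict_scalars R S \<phi>)"


section \<open>Tor and Ext\<close>

text \<open>
  Tor and Ext are only needed for a finitely generated first argument over a noetherian ring,
  so they are computed from a resolution by free modules of finite rank.
  In \<open>\<cdots> \<rightarrow> R\<^bsup>b 1\<^esup> \<rightarrow> R\<^bsup>b 0\<^esup> \<rightarrow> N \<rightarrow> 0\<close>, the map \<open>d i\<close> goes from \<open>R\<^bsup>b (i + 1)\<^esup>\<close> to \<open>R\<^bsup>b i\<^esup>\<close>.
\<close>

definition free_resolution :: "'a ring \<Rightarrow> ('a, 'n) module \<Rightarrow> (nat \<Rightarrow> nat) \<Rightarrow>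
    (nat \<Rightarrow> (nat \<Rightarrow> 'a) \<Rightarrow> (nat \<Rightarrow> 'a)) \<Rightarrow> ((nat \<Rightarrow> 'a) \<Rightarrow> 'n) \<Rightarrow> bool" where
  "free_resolution R N b d \<epsilon> \<longleftrightarrow>
     (let F = (\<lambda>i. free_module R {..<b i}) in
       \<epsilon> \<in> mod_hom R (F 0) N \<and> \<epsilon> ` carrier (F 0) = carrier N \<and>
       (\<forall>i. d i \<in> mod_hom R (F (Suc i)) (F i)) \<and>
       d 0 ` carrier (F (Suc 0)) = a_kernel (F 0) N \<epsilon> \<and>
       (\<forall>i. d (Suc i) ` carrier (F (Suc (Suc i))) = a_kernel (F (Suc i)) (F i) (d i)))"

definition some_resolution :: "'a ring \<Rightarrow> ('a, 'n) module \<Rightarrow>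
    (nat \<Rightarrow> nat) \<times> (nat \<Rightarrow> (nat \<Rightarrow> 'a) \<Rightarrow> (nat \<Rightarrow> 'a))" where
  "some_resolution R N = (SOME (b, d). \<exists>\<epsilon>. free_resolution R N b d \<epsilon>)"

definition tor :: "'a ring \<Rightarrow> nat \<Rightarrow> ('a, 'n) module \<Rightarrow> ('a, 'm) module \<Rightarrow>
    ('a, ((nat \<Rightarrow> 'a) \<times> 'm \<Rightarrow> 'a) set set) module" where
  "tor R i N M =
     (case some_resolution R N of (b, d) \<Rightarrow>
       let F = (\<lambda>j. free_module R {..<b j});
           C = (\<lambda>j. tensor R (F j) M);
           D = (\<lambda>j. tensor_map_left R (F (Suc j)) (F j) M (d j));
           Z = (case i of 0 \<Rightarrow> carrier (C 0) | Suc j \<Rightarrow> a_kernel (C (Suc j)) (C j) (D j))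
       in quot_module ((C i)\<lparr>carrier := Z\<rparr>) (D i ` carrier (C (Suc i))))"

definition ext :: "'a ring \<Rightarrow> nat \<Rightarrow> ('a, 'n) module \<Rightarrow> ('a, 'm) module \<Rightarrow>
    ('a, ((nat \<Rightarrow> 'a) \<Rightarrow> 'm) set) module" where
  "ext R i N M =
     (case some_resolution R N of (b, d) \<Rightarrow>
       let F = (\<lambda>j. free_module R {..<b j});
           C = (\<lambda>j. hom_module R (F j) M);
           \<delta> = (\<lambda>j f. \<lambda>u\<in>carrier (F (Suc j)). f (d j u));
           B = (case i of 0 \<Rightarrow> {\<zero>\<^bsub>C 0\<^esub>} | Suc j \<Rightarrow> \<delta> j ` carrier (C j))
       in quot_module ((C i)\<lparr>carrier := a_kernel (C i) (C (Suc i)) (\<delta> i)\<rparr>) B)"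


section \<open>Betti numbers\<close>

text \<open>A module annihilated by the maximal ideal, viewed as a vector space over the residue field
  (whose elements are the cosets \<open>A\<close> of the maximal ideal).\<close>

definition residue_space :: "'a ring \<Rightarrow> ('a, 'v) module \<Rightarrow> ('a set, 'v) module" where
  "residue_space R V = \<lparr>carrier = carrier V, monoid.mult = undefined, one = undefined,
     ring.zero = \<zero>\<^bsub>V\<^esub>, ring.add = (\<oplus>\<^bsub>V\<^esub>), smult = (\<lambda>A v. THE w. \<exists>a\<in>A. w = a \<odot>\<^bsub>V\<^esub> v)\<rparr>"

definition finite_basis :: "'k ring \<Rightarrow> ('k, 'v) module \<Rightarrow> 'v set \<Rightarrow> bool" where
  "finite_basis K V B \<longleftrightarrow> finite B \<and> B \<subseteq> carrier V \<and> submod_span K V B = carrier V \<and>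
     (\<forall>c \<in> B \<rightarrow> carrier K. (\<Oplus>\<^bsub>V\<^esub>v\<in>B. c v \<odot>\<^bsub>V\<^esub> v) = \<zero>\<^bsub>V\<^esub> \<longrightarrow> (\<forall>v\<in>B. c v = \<zero>\<^bsub>K\<^esub>))"

definition vs_dim :: "'k ring \<Rightarrow> ('k, 'v) module \<Rightarrow> nat" where
  "vs_dim K V = card (SOME B. finite_basis K V B)"

definition betti :: "'a ring \<Rightarrow> nat \<Rightarrow> ('a, 'n) module \<Rightarrow> nat" where
  "betti R i N =
     vs_dim (R Quot max_ideal R) (residue_space R (tor R i N (residue_field_module R)))"


section \<open>Gorenstein rings\<close>

text \<open>By Baer's criterion, extension along monomorphisms of finitely generated modules suffices.\<close>

definition injective_module :: "'a ring \<Rightarrow> ('a, 'm) module \<Rightarrow> bool" where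
  "injective_module R E \<longleftrightarrow> module R E \<and>
     (\<forall>(U :: 'a coset_module) (V :: 'a coset_module) f g.
        module R U \<and> module R V \<and> f \<in> mod_hom R U V \<and> inj_on f (carrier U) \<and> g \<in> mod_hom R U E \<longrightarrow>
        (\<exists>h \<in> mod_hom R V E. \<forall>x\<in>carrier U. h (f x) = g x))"

text \<open>
  There is an injective resolution \<open>0 \<rightarrow> M \<rightarrow> E 0 \<rightarrow> E 1 \<rightarrow> \<cdots>\<close> with \<open>E j = 0\<close> for \<open>j > n\<close>.
  For \<open>M\<close> finitely generated over a noetherian ring, each term of the minimal injective resolution is
  a finite direct sum of injective hulls \<open>E(R/p)\<close>, all of which have at most \<open>max |R| \<aleph>\<^sub>0\<close> elements,
  so the carrier type of the \<open>E j\<close> is large enough.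
\<close>

definition inj_dim_le :: "'a ring \<Rightarrow> ('a, 'm) module \<Rightarrow> nat \<Rightarrow> bool" where
  "inj_dim_le R M n \<longleftrightarrow>
     (\<exists>(E :: nat \<Rightarrow> 'a coset_module) \<eta> d.
        (\<forall>j. injective_module R (E j)) \<and> (\<forall>j>n. zero_module (E j)) \<and>
        \<eta> \<in> mod_hom R M (E 0) \<and> inj_on \<eta> (carrier M) \<and>
        (\<forall>j. d j \<in> mod_hom R (E j) (E (Suc j))) \<and>
        \<eta> ` carrier M = a_kernel (E 0) (E (Suc 0)) (d 0) \<and>
        (\<forall>j. d j ` carrier (E j) = a_kernel (E (Suc j)) (E (Suc (Suc j))) (d (Suc j))))"

definition gorenstein :: "'a ring \<Rightarrow> bool" where
  "gorenstein R \<longleftrightarrow> local_ring R \<and> (\<exists>n. inj_dim_le R (self_module R) n)"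

definition closed_fibre :: "'a ring \<Rightarrow> 'b ring \<Rightarrow> ('a \<Rightarrow> 'b) \<Rightarrow> 'b set ring" where
  "closed_fibre R S \<phi> = S Quot (Idl\<^bsub>S\<^esub> (\<phi> ` max_ideal R))"


section \<open>Canonical modules, Auslander and Bass classes\<close>

definition canonical_module :: "'a ring \<Rightarrow> ('a, 'w) module \<Rightarrow> bool" where
  "canonical_module R \<omega> \<longleftrightarrow> local_ring R \<and> fin_gen R \<omega> \<and>
     (\<forall>i. if enat i = krull_dim R
          then mod_isomorphic R (ext R i (residue_field_module R) \<omega>) (residue_field_module R)
          else zero_module (ext R i (residue_field_module R) \<omega>))"

text \<open>Canonical modules are unique up to isomorphism, so the two classes do not depend on the
  canonical module \<open>\<omega>\<close> with respect to which they are formed.  They are only defined over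
  Cohen-Macaulay rings.\<close>

definition auslander_class :: "'a ring \<Rightarrow> ('a, 'w) module \<Rightarrow> ('a, 'm) module \<Rightarrow> bool" where
  "auslander_class S \<omega> M \<longleftrightarrow>
     cohen_macaulay S \<and> canonical_module S \<omega> \<and> module S M \<and>
     (\<lambda>x. \<lambda>w\<in>carrier \<omega>. pure_tensor S \<omega> M w x) \<in> mod_iso S M (hom_module S \<omega> (tensor S \<omega> M)) \<and>
     (\<forall>i\<ge>1. zero_module (tor S i \<omega> M) \<and> zero_module (ext S i \<omega> (tensor S \<omega> M)))"

definition bass_class :: "'a ring \<Rightarrow> ('a, 'w) module \<Rightarrow> ('a, 'm) module \<Rightarrow> bool" where
  "bass_class S \<omega> M \<longleftrightarrow>
     cohen_macaulay S \<and> canonical_module S \<omega> \<and> module S M \<and>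
     tensor_lift S \<omega> (hom_module S \<omega> M) M (\<lambda>x \<psi>. \<psi> x)
       \<in> mod_iso S (tensor S \<omega> (hom_module S \<omega> M)) M \<and>
     (\<forall>i\<ge>1. zero_module (ext S i \<omega> M) \<and> zero_module (tor S i \<omega> (hom_module S \<omega> M)))"


section \<open>Strong homological minimal multiplicity\<close>

definition ideal_smult :: "'a ring \<Rightarrow> 'a set \<Rightarrow> ('a, 'm) module \<Rightarrow> 'm set" where
  "ideal_smult R I M = submod_span R M {a \<odot>\<^bsub>M\<^esub> x | a x. a \<in> I \<and> x \<in> carrier M}"

abbreviation max_ideal_square :: "'a ring \<Rightarrow> 'a set" where
  "max_ideal_square R \<equiv> ideal_prod R (max_ideal R) (max_ideal R)"

text \<open>The first argument fixes the carrier type in which the ring \<open>S\<close> is sought.\<close>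

definition strongly_hom_min_mult_of_type :: "'s itself \<Rightarrow> 'r ring \<Rightarrow> nat \<Rightarrow> nat \<Rightarrow> bool" where
  "strongly_hom_min_mult_of_type T R m n \<longleftrightarrow> m \<ge> 1 \<and>
     (\<exists>(S :: 's ring) \<phi> (\<omega> :: 's coset_module) (M :: 's coset_module).
        local_ring_hom R S \<phi> \<and>
        fin_gen S M \<and> \<not> zero_module M \<and>
        canonical_module S \<omega> \<and>
        flat_hom R S \<phi> \<and> gorenstein (closed_fibre R S \<phi>) \<and>
        auslander_class S \<omega> M \<and>
        ideal_smult S (max_ideal_square S) M = {\<zero>\<^bsub>M\<^esub>} \<and>
        m = betti S 0 M \<and>
        n = betti S 0 (M\<lparr>carrier := ideal_smult S (max_ideal S) M\<rparr>))"

definition strongly_hom_min_mult :: "'s itself \<Rightarrow> 'r ring \<Rightarrow> bool" where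
  "strongly_hom_min_mult T R \<longleftrightarrow> (\<exists>m n. strongly_hom_min_mult_of_type T R m n)"

end

theory Submission
  imports Defs
begin

text \<open>
  The theorem is an instance of Foxby equivalence: \<open>\<omega> \<otimes> -\<close> and \<open>Hom(\<omega>, -)\<close> restrict to mutually inverse
  equivalences between the Auslander class and the Bass class of \<open>S\<close>. Both functors preserve finitely
  generated modules and annihilation by \<open>\<nn>\<^sup>2\<close>, and neither sends a nonzero module of the respective class
  to zero. So the homomorphism \<open>\<phi>\<close> is kept, \<open>N\<close> is taken to be \<open>\<omega> \<otimes> M\<close> in one direction, and \<open>M\<close> to be \<open>Hom(\<omega>, N)\<close>
  in the other. The equivalence itself rests on the triangle identities: evaluation composed with
  \<open>\<omega> \<otimes> \<mu>\<close>, where \<open>\<mu>\<close> is the natural map of \<open>M\<close>, is the identity of \<open>\<omega> \<otimes> M\<close>, and the natural map of \<open>Hom(\<omega>, N)\<close>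
  followed by \<open>Hom(\<omega>, -)\<close> of evaluation is the identity of \<open>Hom(\<omega>, N)\<close>. If one factor is an isomorphism, so is the
  other. These are \<open>bass_class_of_auslander_class\<close> and \<open>auslander_class_of_bass_class\<close>.

  The vanishing conditions only change by isomorphisms in the second argument of Tor and Ext, and
  \<open>tor_zero_cong\<close> and \<open>ext_zero_cong\<close> show that vanishing does not notice these. Both functors are
  computed from a chosen resolution of \<open>\<omega>\<close> by finite free modules, so it must be known that there is
  one (\<open>free_resolution_exists\<close>). This and the finite generation of \<open>Hom(\<omega>, N)\<close> are where the
  noetherian hypothesis enters, both times through \<open>jointly_injective_fin_gen\<close>. As \<open>\<omega> \<otimes> M\<close> and \<open>Hom(\<omega>, N)\<close>
  live in large carrier types, they are replaced by isomorphic copies (\<open>coset_copy\<close>).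

  Finally, a type \<open>(m, n)\<close> requires \<open>m \<ge> 1\<close>, that is, \<open>M \<otimes> k \<noteq> 0\<close> for the residue field \<open>k\<close> of \<open>S\<close>
  (\<open>betti_zero_pos\<close>). This holds because \<open>\<nn>M = M\<close> would imply \<open>M = \<nn>\<^sup>2M = 0\<close>.
\<close>

section \<open>Submodules\<close>

text \<open>
  Closure under negation is automatic, because negation is multiplication by \<open>\<ominus> \<one>\<close>.
\<close>

lemma submodule_criterion:
  assumes "module R M" "H \<subseteq> carrier M" "\<zero>\<^bsub>M\<^esub> \<in> H"
    "\<And>x y. x \<in> H \<Longrightarrow> y \<in> H \<Longrightarrow> x \<oplus>\<^bsub>M\<^esub> y \<in> H"
    "\<And>a x. a \<in> carrier R \<Longrightarrow> x \<in> H \<Longrightarrow> a \<odot>\<^bsub>M\<^esub> x \<in> H"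
  shows "submodule H R M"
proof -
  interpret module R M by fact
  show ?thesis
  proof (rule submoduleI)
    fix x assume x: "x \<in> H"
    have "(\<ominus>\<^bsub>R\<^esub> \<one>\<^bsub>R\<^esub>) \<odot>\<^bsub>M\<^esub> x = \<ominus>\<^bsub>M\<^esub> x"
      using x assms(2) by (subst smult_l_minus) auto
    with x show "\<ominus>\<^bsub>M\<^esub> x \<in> H"
      using assms(5)[of "\<ominus>\<^bsub>R\<^esub> \<one>\<^bsub>R\<^esub>" x] by simp
  qed (use assms in auto)
qed

lemma submodule_facts:
  assumes "submodule H R M"
  shows submodule_subset: "H \<subseteq> carrier M"
    and submodule_zero: "\<zero>\<^bsub>M\<^esub> \<in> H"
    and submodule_add: "\<And>x y. x \<in> H \<Longrightarrow> y \<in> H \<Longrightarrow> x \<oplus>\<^bsub>M\<^esub> y \<in> H"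
    and submodule_smult: "\<And>a x. a \<in> carrier R \<Longrightarrow> x \<in> H \<Longrightarrow> a \<odot>\<^bsub>M\<^esub> x \<in> H"
    and submodule_minus: "\<And>x y. x \<in> H \<Longrightarrow> y \<in> H \<Longrightarrow> x \<ominus>\<^bsub>M\<^esub> y \<in> H"
proof -
  interpret submodule H R M by fact
  show "H \<subseteq> carrier M" using subset by simp
  show "\<zero>\<^bsub>M\<^esub> \<in> H" using one_closed by simp
  show *: "x \<oplus>\<^bsub>M\<^esub> y \<in> H" if "x \<in> H" "y \<in> H" for x y using m_closed[OF that] by simp
  show "a \<odot>\<^bsub>M\<^esub> x \<in> H" if "a \<in> carrier R" "x \<in> H" for a x using smult_closed[OF that] .
  show "x \<ominus>\<^bsub>M\<^esub> y \<in> H" if "x \<in> H" "y \<in> H" for x y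
    using *[of x "\<ominus>\<^bsub>M\<^esub> y"] that m_inv_closed[of y] by (simp add: a_minus_def a_inv_def)
qed

lemma submodule_finsum:
  assumes "module R M" "submodule H R M" "finite A" "\<And>i. i \<in> A \<Longrightarrow> f i \<in> H"
  shows "(\<Oplus>\<^bsub>M\<^esub>i\<in>A. f i) \<in> H"
proof -
  interpret module R M by fact
  show ?thesis using assms(3,4)
  proof (induction A)
    case empty
    then show ?case using submodule_zero[OF assms(2)] by simp
  next
    case (insert x F)
    then show ?case
      using submodule_subset[OF assms(2)] submodule_add[OF assms(2)]
      by (subst M.finsum_insert) (auto simp: Pi_def subset_iff)
  qed
qed

lemma submod_span_submodule:
  assumes "module R M" "U \<subseteq> carrier M"
  shows "submodule (submod_span R M U) R M"
proof -
  interpret module R M by fact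
  show ?thesis unfolding submod_span_def
    apply (rule submodule_criterion[OF assms(1)])
    using carrier_is_submodule assms(2)
    by (auto intro: submodule_zero submodule_add submodule_smult dest: submodule_subset)
qed

lemma submod_span_superset: "U \<subseteq> submod_span R M U"
  unfolding submod_span_def by auto

lemma submod_span_minimal: "submodule H R M \<Longrightarrow> U \<subseteq> H \<Longrightarrow> submod_span R M U \<subseteq> H"
  unfolding submod_span_def by auto

lemma a_kernel_eq: "a_kernel M N f = {x \<in> carrier M. f x = \<zero>\<^bsub>N\<^esub>}"
  by (simp add: a_kernel_def kernel_def)

section \<open>Linear maps\<close>

lemma mod_homI:
  assumes "\<And>x. x \<in> carrier M \<Longrightarrow> f x \<in> carrier N"
    "\<And>x y. x \<in> carrier M \<Longrightarrow> y \<in> carrier M \<Longrightarrow> f (x \<oplus>\<^bsub>M\<^esub> y) = f x \<oplus>\<^bsub>N\<^esub> f y"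
    "\<And>a x. a \<in> carrier R \<Longrightarrow> x \<in> carrier M \<Longrightarrow> f (a \<odot>\<^bsub>M\<^esub> x) = a \<odot>\<^bsub>N\<^esub> f x"
  shows "f \<in> mod_hom R M N"
  using assms by (auto simp: mod_hom_def)

lemma mod_hom_facts:
  assumes "f \<in> mod_hom R M N"
  shows mod_hom_closed: "\<And>x. x \<in> carrier M \<Longrightarrow> f x \<in> carrier N"
    and mod_hom_add: "\<And>x y. x \<in> carrier M \<Longrightarrow> y \<in> carrier M \<Longrightarrow> f (x \<oplus>\<^bsub>M\<^esub> y) = f x \<oplus>\<^bsub>N\<^esub> f y"
    and mod_hom_smult: "\<And>a x. a \<in> carrier R \<Longrightarrow> x \<in> carrier M \<Longrightarrow> f (a \<odot>\<^bsub>M\<^esub> x) = a \<odot>\<^bsub>N\<^esub> f x"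
  using assms by (auto simp: mod_hom_def)

lemma mod_hom_zero:
  assumes "module R M" "module R N" "f \<in> mod_hom R M N"
  shows "f \<zero>\<^bsub>M\<^esub> = \<zero>\<^bsub>N\<^esub>"
proof -
  interpret M: module R M by fact
  interpret N: module R N by fact
  have "f \<zero>\<^bsub>M\<^esub> = f (\<zero>\<^bsub>R\<^esub> \<odot>\<^bsub>M\<^esub> \<zero>\<^bsub>M\<^esub>)" by simp
  also have "\<dots> = \<zero>\<^bsub>R\<^esub> \<odot>\<^bsub>N\<^esub> f \<zero>\<^bsub>M\<^esub>" by (rule mod_hom_smult[OF assms(3)]) auto
  also have "\<dots> = \<zero>\<^bsub>N\<^esub>" using mod_hom_closed[OF assms(3), of "\<zero>\<^bsub>M\<^esub>"] by simp
  finally show ?thesis .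
qed

lemma mod_hom_minus:
  assumes "module R M" "module R N" "f \<in> mod_hom R M N" "x \<in> carrier M" "y \<in> carrier M"
  shows "f (x \<ominus>\<^bsub>M\<^esub> y) = f x \<ominus>\<^bsub>N\<^esub> f y"
proof -
  interpret M: module R M by fact
  interpret N: module R N by fact
  have "f (x \<ominus>\<^bsub>M\<^esub> y) \<oplus>\<^bsub>N\<^esub> f y = f ((x \<ominus>\<^bsub>M\<^esub> y) \<oplus>\<^bsub>M\<^esub> y)"
    using assms by (subst mod_hom_add[OF assms(3)]) auto
  also have "(x \<ominus>\<^bsub>M\<^esub> y) \<oplus>\<^bsub>M\<^esub> y = x"
    using assms by (simp add: a_minus_def M.M.a_assoc M.M.l_neg)
  finally have eq: "f (x \<ominus>\<^bsub>M\<^esub> y) \<oplus>\<^bsub>N\<^esub> f y = f x" .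
  have cl: "f (x \<ominus>\<^bsub>M\<^esub> y) \<in> carrier N" "f y \<in> carrier N"
    using assms by (auto intro: mod_hom_closed)
  show ?thesis unfolding eq[symmetric] using cl
    by (simp add: a_minus_def N.M.a_assoc N.M.r_neg)
qed

lemma minus_eq_zero_iff:
  assumes "module R M" "x \<in> carrier M" "y \<in> carrier M"
  shows "x \<ominus>\<^bsub>M\<^esub> y = \<zero>\<^bsub>M\<^esub> \<longleftrightarrow> x = y"
proof -
  interpret M: module R M by fact
  show ?thesis using assms(2,3) by (metis M.M.minus_equality M.M.minus_minus M.M.r_neg a_minus_def M.M.a_inv_closed)
qed

lemma inj_on_mod_hom_iff:
  assumes "module R M" "module R N" "f \<in> mod_hom R M N"
  shows "inj_on f (carrier M) \<longleftrightarrow> (\<forall>x\<in>carrier M. f x = \<zero>\<^bsub>N\<^esub> \<longrightarrow> x = \<zero>\<^bsub>M\<^esub>)"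
proof -
  interpret M: module R M by fact
  interpret N: module R N by fact
  show ?thesis
  proof
    assume "inj_on f (carrier M)"
    then show "\<forall>x\<in>carrier M. f x = \<zero>\<^bsub>N\<^esub> \<longrightarrow> x = \<zero>\<^bsub>M\<^esub>"
      using mod_hom_zero[OF assms] by (metis M.M.zero_closed inj_onD)
  next
    assume *: "\<forall>x\<in>carrier M. f x = \<zero>\<^bsub>N\<^esub> \<longrightarrow> x = \<zero>\<^bsub>M\<^esub>"
    show "inj_on f (carrier M)"
    proof (rule inj_onI)
      fix x y assume xy: "x \<in> carrier M" "y \<in> carrier M" "f x = f y"
      then have "f (x \<ominus>\<^bsub>M\<^esub> y) = \<zero>\<^bsub>N\<^esub>"
        using mod_hom_minus[OF assms] minus_eq_zero_iff[OF assms(2)] mod_hom_closed[OF assms(3)] by simp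
      with * xy show "x = y" using minus_eq_zero_iff[OF assms(1)] by auto
    qed
  qed
qed

lemma mod_hom_compose:
  assumes "f \<in> mod_hom R M N" "g \<in> mod_hom R N P"
  shows "(\<lambda>x. g (f x)) \<in> mod_hom R M P"
  using assms by (auto simp: mod_hom_def Pi_iff)

lemma mod_hom_id: "(\<lambda>x. x) \<in> mod_hom R M M"
  by (auto simp: mod_hom_def)

lemma mod_hom_cong:
  assumes "module R M" "f \<in> mod_hom R M N" "\<And>x. x \<in> carrier M \<Longrightarrow> f x = g x"
  shows "g \<in> mod_hom R M N"
proof -
  interpret module R M by fact
  show ?thesis
    by (rule mod_homI) (simp_all add: assms(3)[symmetric] mod_hom_facts[OF assms(2)])
qed

section \<open>Isomorphisms, images and kernels\<close>

lemma mod_iso_inverse: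
  assumes "module R M" "f \<in> mod_iso R M N"
  obtains g where "g \<in> mod_iso R N M" "\<And>x. x \<in> carrier M \<Longrightarrow> g (f x) = x"
    "\<And>y. y \<in> carrier N \<Longrightarrow> f (g y) = y"
proof -
  interpret M: module R M by fact
  from assms have f: "f \<in> mod_hom R M N" and b: "bij_betw f (carrier M) (carrier N)"
    by (auto simp: mod_iso_def)
  let ?g = "the_inv_into (carrier M) f"
  have inj: "inj_on f (carrier M)" using b by (auto simp: bij_betw_def)
  have gb: "bij_betw ?g (carrier N) (carrier M)" using b by (rule bij_betw_the_inv_into)
  have fg: "f (?g y) = y" if "y \<in> carrier N" for y
    using f_the_inv_into_f_bij_betw[OF b] that by blast
  have gf: "?g (f x) = x" if "x \<in> carrier M" for x
    using the_inv_into_f_f[OF inj that] .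
  have gc: "?g y \<in> carrier M" if "y \<in> carrier N" for y using gb that by (auto simp: bij_betw_def)
  have "?g \<in> mod_hom R N M"
  proof (rule mod_homI)
    fix x y assume "x \<in> carrier N" "y \<in> carrier N"
    then have "f (?g x \<oplus>\<^bsub>M\<^esub> ?g y) = x \<oplus>\<^bsub>N\<^esub> y" by (simp add: mod_hom_add[OF f] gc fg)
    then show "?g (x \<oplus>\<^bsub>N\<^esub> y) = ?g x \<oplus>\<^bsub>M\<^esub> ?g y" 
      using gf[of "?g x \<oplus>\<^bsub>M\<^esub> ?g y"] gc \<open>x \<in> carrier N\<close> \<open>y \<in> carrier N\<close> by simp
  next
    fix a y assume "a \<in> carrier R" "y \<in> carrier N"
    then have "f (a \<odot>\<^bsub>M\<^esub> ?g y) = a \<odot>\<^bsub>N\<^esub> y" by (simp add: mod_hom_smult[OF f] gc fg)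
    then show "?g (a \<odot>\<^bsub>N\<^esub> y) = a \<odot>\<^bsub>M\<^esub> ?g y"
      using gf[of "a \<odot>\<^bsub>M\<^esub> ?g y"] gc \<open>a \<in> carrier R\<close> \<open>y \<in> carrier N\<close> by simp
  qed (rule gc)
  with gb have "?g \<in> mod_iso R N M" by (simp add: mod_iso_def)
  then show thesis using gf fg by (rule that)
qed

lemma mod_iso_compose:
  assumes "f \<in> mod_iso R M N" "g \<in> mod_iso R N P"
  shows "(\<lambda>x. g (f x)) \<in> mod_iso R M P"
  using assms mod_hom_compose[of f R M N g P] bij_betw_trans[of f "carrier M" "carrier N" g "carrier P"]
  by (auto simp: mod_iso_def comp_def)

lemma submodule_vimage:
  assumes "module R M" "module R N" "f \<in> mod_hom R M N" "submodule K R N"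
  shows "submodule {x \<in> carrier M. f x \<in> K} R M"
proof -
  interpret M: module R M by fact
  show ?thesis
    apply (rule submodule_criterion[OF assms(1)])
    using submodule_facts[OF assms(4)] mod_hom_zero[OF assms(1-3)] mod_hom_facts[OF assms(3)]
    by auto
qed

lemma submodule_image:
  assumes "module R M" "module R N" "f \<in> mod_hom R M N" "submodule K R M"
  shows "submodule (f ` K) R N"
proof -
  note K = submodule_facts[OF assms(4)] and f = mod_hom_facts[OF assms(3)]
  show ?thesis
  proof (rule submodule_criterion[OF assms(2)])
    show "f ` K \<subseteq> carrier N" using K f by auto
    show "\<zero>\<^bsub>N\<^esub> \<in> f ` K" using K(2) mod_hom_zero[OF assms(1-3)] by force
    fix x y assume "x \<in> f ` K" "y \<in> f ` K"
    then obtain u v where "u \<in> K" "v \<in> K" "x = f u" "y = f v" by auto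
    then show "x \<oplus>\<^bsub>N\<^esub> y \<in> f ` K" using f(2)[of u v] K(3)[of u v] K(1) by (metis image_eqI subsetD)
  next
    fix a x assume "a \<in> carrier R" "x \<in> f ` K"
    then obtain u where "u \<in> K" "x = f u" by auto
    then show "a \<odot>\<^bsub>N\<^esub> x \<in> f ` K" using f(3)[of a u] K(4)[of a u] K(1) \<open>a \<in> carrier R\<close> by (metis image_eqI subsetD)
  qed
qed

lemma submodule_kernel:
  assumes "module R M" "module R N" "f \<in> mod_hom R M N"
  shows "submodule (a_kernel M N f) R M"
proof -
  interpret M: module R M by fact
  interpret N: module R N by fact
  have "submodule {\<zero>\<^bsub>N\<^esub>} R N" by (rule submodule_criterion[OF assms(2)]) auto
  from submodule_vimage[OF assms this] show ?thesis by (simp add: a_kernel_eq)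
qed

section \<open>Quotients\<close>

text \<open>
  Every module axiom passes along a surjection that respects the operations. Applied to the
  projection onto cosets, this makes quotients modules.
\<close>

lemma module_of_surjection:
  assumes "module R M" "\<pi> ` carrier M = carrier Q" "\<pi> \<zero>\<^bsub>M\<^esub> = \<zero>\<^bsub>Q\<^esub>"
    and add: "\<And>x y. x \<in> carrier M \<Longrightarrow> y \<in> carrier M \<Longrightarrow> \<pi> (x \<oplus>\<^bsub>M\<^esub> y) = \<pi> x \<oplus>\<^bsub>Q\<^esub> \<pi> y"
    and smult: "\<And>a x. a \<in> carrier R \<Longrightarrow> x \<in> carrier M \<Longrightarrow> \<pi> (a \<odot>\<^bsub>M\<^esub> x) = a \<odot>\<^bsub>Q\<^esub> \<pi> x"
  shows "module R Q"
proof -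
  interpret M: module R M by fact
  have ex: "\<exists>x\<in>carrier M. q = \<pi> x" if "q \<in> carrier Q" for q
    using that assms(2) by auto
  have cl: "\<pi> x \<in> carrier Q" if "x \<in> carrier M" for x
    using that assms(2) by auto
  show ?thesis
  proof (rule moduleI)
    show "cring R" by (rule M.R.is_cring)
    show "abelian_group Q"
    proof (rule abelian_groupI)
      fix x y assume "x \<in> carrier Q" "y \<in> carrier Q"
      then obtain u v where uv: "u \<in> carrier M" "v \<in> carrier M" "x = \<pi> u" "y = \<pi> v" using ex by metis
      then show "x \<oplus>\<^bsub>Q\<^esub> y \<in> carrier Q" using cl[of "u \<oplus>\<^bsub>M\<^esub> v"] by (simp add: add)
      show "x \<oplus>\<^bsub>Q\<^esub> y = y \<oplus>\<^bsub>Q\<^esub> x" using uv by (simp add: add[symmetric] M.M.a_comm)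
      fix z assume "z \<in> carrier Q"
      then obtain w where "w \<in> carrier M" "z = \<pi> w" using ex by metis
      then show "x \<oplus>\<^bsub>Q\<^esub> y \<oplus>\<^bsub>Q\<^esub> z = x \<oplus>\<^bsub>Q\<^esub> (y \<oplus>\<^bsub>Q\<^esub> z)"
        using uv by (simp add: add[symmetric] M.M.a_assoc)
    next
      show "\<zero>\<^bsub>Q\<^esub> \<in> carrier Q" using cl[of "\<zero>\<^bsub>M\<^esub>"] assms(3) by simp
      fix x assume "x \<in> carrier Q"
      then obtain u where u: "u \<in> carrier M" "x = \<pi> u" using ex by metis
      then show "\<zero>\<^bsub>Q\<^esub> \<oplus>\<^bsub>Q\<^esub> x = x" by (simp add: assms(3)[symmetric] add[symmetric])
      show "\<exists>y\<in>carrier Q. y \<oplus>\<^bsub>Q\<^esub> x = \<zero>\<^bsub>Q\<^esub>"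
      proof
        show "\<pi> (\<ominus>\<^bsub>M\<^esub> u) \<in> carrier Q" using u cl by simp
        show "\<pi> (\<ominus>\<^bsub>M\<^esub> u) \<oplus>\<^bsub>Q\<^esub> x = \<zero>\<^bsub>Q\<^esub>"
          using u by (simp add: assms(3)[symmetric] add[symmetric] M.M.l_neg)
      qed
    qed
  next
    fix a x assume a: "a \<in> carrier R" and "x \<in> carrier Q"
    then obtain u where u: "u \<in> carrier M" "x = \<pi> u" using ex by metis
    show "a \<odot>\<^bsub>Q\<^esub> x \<in> carrier Q" using u a cl[of "a \<odot>\<^bsub>M\<^esub> u"] by (simp add: smult)
    fix b assume b: "b \<in> carrier R"
    show "(a \<oplus>\<^bsub>R\<^esub> b) \<odot>\<^bsub>Q\<^esub> x = a \<odot>\<^bsub>Q\<^esub> x \<oplus>\<^bsub>Q\<^esub> b \<odot>\<^bsub>Q\<^esub> x"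
      using u a b by (simp add: add[symmetric] smult[symmetric] M.smult_l_distr)
    show "(a \<otimes>\<^bsub>R\<^esub> b) \<odot>\<^bsub>Q\<^esub> x = a \<odot>\<^bsub>Q\<^esub> (b \<odot>\<^bsub>Q\<^esub> x)"
      using u a b by (simp add: add[symmetric] smult[symmetric] M.smult_assoc1)
  next
    fix a x y assume a: "a \<in> carrier R" and "x \<in> carrier Q" "y \<in> carrier Q"
    then obtain u v where uv: "u \<in> carrier M" "v \<in> carrier M" "x = \<pi> u" "y = \<pi> v" using ex by metis
    show "a \<odot>\<^bsub>Q\<^esub> (x \<oplus>\<^bsub>Q\<^esub> y) = a \<odot>\<^bsub>Q\<^esub> x \<oplus>\<^bsub>Q\<^esub> a \<odot>\<^bsub>Q\<^esub> y"
      using uv a by (simp add: add[symmetric] smult[symmetric] M.smult_r_distr)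
  next
    fix x assume "x \<in> carrier Q"
    then obtain u where u: "u \<in> carrier M" "x = \<pi> u" using ex by metis
    then show "\<one>\<^bsub>R\<^esub> \<odot>\<^bsub>Q\<^esub> x = x" by (simp add: smult[symmetric])
  qed
qed

lemma submodule_abelian_subgroup:
  assumes "module R M" "submodule H R M"
  shows "abelian_subgroup H M"
  using assms by (metis abelian_subgroupI3 additive_subgroupI module.axioms(2) submodule.axioms(1))

lemma quot_module_carrier: "carrier (quot_module M H) = (\<lambda>x. H +>\<^bsub>M\<^esub> x) ` carrier M"
  by (auto simp: quot_module_def A_RCOSETS_def RCOSETS_def a_r_coset_def)

lemma quot_module_zero: "\<zero>\<^bsub>quot_module M H\<^esub> = H"
  by (simp add: quot_module_def)

lemma coset_eq_iff:
  assumes "module R M" "submodule H R M" "x \<in> carrier M" "y \<in> carrier M"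
  shows "H +>\<^bsub>M\<^esub> x = H +>\<^bsub>M\<^esub> y \<longleftrightarrow> x \<ominus>\<^bsub>M\<^esub> y \<in> H"
proof -
  interpret abelian_subgroup H M by (rule submodule_abelian_subgroup[OF assms(1,2)])
  have "H +>\<^bsub>M\<^esub> x = H +>\<^bsub>M\<^esub> y \<longleftrightarrow> x \<in> H +>\<^bsub>M\<^esub> y"
    using a_rcos_self[of x] a_repr_independence'[of x y] assms by auto
  also have "\<dots> \<longleftrightarrow> x \<ominus>\<^bsub>M\<^esub> y \<in> H" using a_rcos_module[of y x] assms by (simp add: a_minus_def)
  finally show ?thesis .
qed

lemma coset_eq_submodule_iff:
  assumes "module R M" "submodule H R M" "x \<in> carrier M"
  shows "H +>\<^bsub>M\<^esub> x = H \<longleftrightarrow> x \<in> H"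
proof -
  interpret abelian_subgroup H M by (rule submodule_abelian_subgroup[OF assms(1,2)])
  show ?thesis using a_rcos_self[of x] a_rcos_const[of x] assms(3) by auto
qed

lemma quot_module_ops:
  assumes "module R M" "submodule H R M"
  shows "\<And>x y. x \<in> carrier M \<Longrightarrow> y \<in> carrier M \<Longrightarrow>
      H +>\<^bsub>M\<^esub> (x \<oplus>\<^bsub>M\<^esub> y) = (H +>\<^bsub>M\<^esub> x) \<oplus>\<^bsub>quot_module M H\<^esub> (H +>\<^bsub>M\<^esub> y)"
    and "\<And>a x. a \<in> carrier R \<Longrightarrow> x \<in> carrier M \<Longrightarrow>
      H +>\<^bsub>M\<^esub> (a \<odot>\<^bsub>M\<^esub> x) = a \<odot>\<^bsub>quot_module M H\<^esub> (H +>\<^bsub>M\<^esub> x)"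
proof -
  interpret abelian_subgroup H M by (rule submodule_abelian_subgroup[OF assms])
  interpret M: module R M by fact
  show "H +>\<^bsub>M\<^esub> (x \<oplus>\<^bsub>M\<^esub> y) = (H +>\<^bsub>M\<^esub> x) \<oplus>\<^bsub>quot_module M H\<^esub> (H +>\<^bsub>M\<^esub> y)"
    if "x \<in> carrier M" "y \<in> carrier M" for x y
    using a_rcos_sum[OF that] by (simp add: quot_module_def)
  show "H +>\<^bsub>M\<^esub> (a \<odot>\<^bsub>M\<^esub> x) = a \<odot>\<^bsub>quot_module M H\<^esub> (H +>\<^bsub>M\<^esub> x)"
    if a: "a \<in> carrier R" and x: "x \<in> carrier M" for a x
  proof -
    have const: "H +>\<^bsub>M\<^esub> (a \<odot>\<^bsub>M\<^esub> y) = H +>\<^bsub>M\<^esub> (a \<odot>\<^bsub>M\<^esub> x)" if y: "y \<in> H +>\<^bsub>M\<^esub> x" for y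
    proof -
      have yc: "y \<in> carrier M" using a_elemrcos_carrier[OF x y] .
      have "y \<ominus>\<^bsub>M\<^esub> x \<in> H" using a_rcos_module[OF x yc] y by (simp add: a_minus_def)
      then have "a \<odot>\<^bsub>M\<^esub> (y \<ominus>\<^bsub>M\<^esub> x) \<in> H" using submodule_smult[OF assms(2) a] by simp
      then have "a \<odot>\<^bsub>M\<^esub> y \<ominus>\<^bsub>M\<^esub> a \<odot>\<^bsub>M\<^esub> x \<in> H"
        using a x yc by (simp add: a_minus_def M.smult_r_distr M.smult_r_minus)
      then show ?thesis using coset_eq_iff[OF assms, of "a \<odot>\<^bsub>M\<^esub> y" "a \<odot>\<^bsub>M\<^esub> x"] a x yc by simp
    qed
    have ne: "H +>\<^bsub>M\<^esub> x \<noteq> {}" using a_rcos_self[OF x] by blast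
    have "(\<Union>y\<in>H +>\<^bsub>M\<^esub> x. H +>\<^bsub>M\<^esub> (a \<odot>\<^bsub>M\<^esub> y)) = H +>\<^bsub>M\<^esub> (a \<odot>\<^bsub>M\<^esub> x)"
      by (rule SUP_eq_const[OF ne const])
    then show ?thesis by (simp only: quot_module_def module.select_convs)
  qed
qed

lemma quot_module_module:
  assumes "module R M" "submodule H R M"
  shows "module R (quot_module M H)"
proof (rule module_of_surjection[OF assms(1), where \<pi> = "\<lambda>x. H +>\<^bsub>M\<^esub> x"])
  interpret M: module R M by fact
  show "H +>\<^bsub>M\<^esub> \<zero>\<^bsub>M\<^esub> = \<zero>\<^bsub>quot_module M H\<^esub>"
    using coset_eq_submodule_iff[OF assms, of "\<zero>\<^bsub>M\<^esub>"] submodule_zero[OF assms(2)]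
    by (simp add: quot_module_zero)
qed (auto simp: quot_module_carrier quot_module_ops[OF assms])

lemma quot_map_hom:
  assumes "module R M" "submodule H R M"
  shows "(\<lambda>x. H +>\<^bsub>M\<^esub> x) \<in> mod_hom R M (quot_module M H)"
  by (rule mod_homI) (auto simp: quot_module_carrier quot_module_ops[OF assms])

text \<open>
  The value on a coset is that of any representative, as two representatives differ by an element
  of \<open>H\<close>, where \<open>f\<close> vanishes.
\<close>

lemma quot_module_lift:
  assumes "module R M" "submodule H R M" "module R P" "f \<in> mod_hom R M P"
    "\<And>x. x \<in> H \<Longrightarrow> f x = \<zero>\<^bsub>P\<^esub>"
  obtains g where "g \<in> mod_hom R (quot_module M H) P"
    "\<And>x. x \<in> carrier M \<Longrightarrow> g (H +>\<^bsub>M\<^esub> x) = f x"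
proof -
  interpret M: module R M by fact
  interpret P: module R P by fact
  define g where "g U = f (SOME x. x \<in> carrier M \<and> U = H +>\<^bsub>M\<^esub> x)" for U
  have g: "g (H +>\<^bsub>M\<^esub> x) = f x" if x: "x \<in> carrier M" for x
  proof -
    define y where "y = (SOME y. y \<in> carrier M \<and> H +>\<^bsub>M\<^esub> x = H +>\<^bsub>M\<^esub> y)"
    have y: "y \<in> carrier M \<and> H +>\<^bsub>M\<^esub> x = H +>\<^bsub>M\<^esub> y" unfolding y_def
      by (rule someI[of _ x]) (use x in auto)
    then have "f (x \<ominus>\<^bsub>M\<^esub> y) = \<zero>\<^bsub>P\<^esub>" using coset_eq_iff[OF assms(1,2) x, of y] assms(5) by auto
    then have "f x = f y"
      using mod_hom_minus[OF assms(1,3,4)] minus_eq_zero_iff[OF assms(3)] mod_hom_closed[OF assms(4)] x y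
      by auto
    then show ?thesis by (simp add: g_def y_def)
  qed
  have "g \<in> mod_hom R (quot_module M H) P"
    by (rule mod_homI)
      (auto simp: quot_module_carrier quot_module_ops[OF assms(1,2), symmetric] g mod_hom_facts[OF assms(4)])
  then show thesis using g by (rule that)
qed

lemma quot_module_zero_iff:
  assumes "module R M" "submodule H R M"
  shows "zero_module (quot_module M H) \<longleftrightarrow> H = carrier M"
proof -
  interpret M: module R M by fact
  have "zero_module (quot_module M H) \<longleftrightarrow> (\<forall>x\<in>carrier M. H +>\<^bsub>M\<^esub> x = H)"
    unfolding zero_module_def quot_module_carrier quot_module_zero using M.M.zero_closed by blast
  then show ?thesis using coset_eq_submodule_iff[OF assms] submodule_subset[OF assms(2)] by auto
qed

section \<open>Free modules\<close>

lemma free_module_sel [simp]: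
  "\<zero>\<^bsub>free_module R I\<^esub> = (\<lambda>i\<in>I. \<zero>\<^bsub>R\<^esub>)"
  "f \<oplus>\<^bsub>free_module R I\<^esub> g = (\<lambda>i\<in>I. f i \<oplus>\<^bsub>R\<^esub> g i)"
  "a \<odot>\<^bsub>free_module R I\<^esub> f = (\<lambda>i\<in>I. a \<otimes>\<^bsub>R\<^esub> f i)"
  by (simp_all add: free_module_def)

lemma free_module_carrier_iff:
  "f \<in> carrier (free_module R I) \<longleftrightarrow>
    f \<in> extensional I \<and> (\<forall>i\<in>I. f i \<in> carrier R) \<and> finite {i \<in> I. f i \<noteq> \<zero>\<^bsub>R\<^esub>}"
  by (auto simp: free_module_def PiE_iff)

lemma free_moduleI:
  assumes "\<And>i. i \<in> I \<Longrightarrow> f i \<in> carrier R" "finite T" "\<And>i. i \<in> I \<Longrightarrow> i \<notin> T \<Longrightarrow> f i = \<zero>\<^bsub>R\<^esub>"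
  shows "restrict f I \<in> carrier (free_module R I)"
proof -
  have "{i \<in> I. restrict f I i \<noteq> \<zero>\<^bsub>R\<^esub>} \<subseteq> T" using assms(3) by auto
  then have "finite {i \<in> I. restrict f I i \<noteq> \<zero>\<^bsub>R\<^esub>}" using assms(2) by (rule finite_subset)
  moreover have "\<forall>i\<in>I. restrict f I i \<in> carrier R" using assms(1) by simp
  ultimately show ?thesis using assms(1) by (simp add: free_module_carrier_iff del: restrict_apply)
qed

lemma free_module_module:
  assumes "cring R"
  shows "module R (free_module R I)"
proof -
  interpret R: cring R by fact
  let ?F = "free_module R I"
  have cl: "f i \<in> carrier R" if "f \<in> carrier ?F" "i \<in> I" for f i
    using that by (auto simp: free_module_carrier_iff)
  have ext: "(\<lambda>i\<in>I. f i) = f" if "f \<in> carrier ?F" for f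
    using that by (simp add: free_module_carrier_iff extensional_restrict)
  have fin: "finite {i \<in> I. f i \<noteq> \<zero>\<^bsub>R\<^esub>}" if "f \<in> carrier ?F" for f
    using that by (auto simp: free_module_carrier_iff)
  show ?thesis
  proof (rule moduleI)
    show "cring R" by fact
    show "abelian_group ?F"
    proof (rule abelian_groupI)
      fix f g assume fg: "f \<in> carrier ?F" "g \<in> carrier ?F"
      show "f \<oplus>\<^bsub>?F\<^esub> g \<in> carrier ?F" unfolding free_module_sel
        by (rule free_moduleI[where T = "{i \<in> I. f i \<noteq> \<zero>\<^bsub>R\<^esub>} \<union> {i \<in> I. g i \<noteq> \<zero>\<^bsub>R\<^esub>}"])
          (auto simp: fg cl fin)
      show "f \<oplus>\<^bsub>?F\<^esub> g = g \<oplus>\<^bsub>?F\<^esub> f"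
        by (auto intro!: restrict_ext R.a_comm simp: fg cl)
      fix h assume "h \<in> carrier ?F"
      with fg show "f \<oplus>\<^bsub>?F\<^esub> g \<oplus>\<^bsub>?F\<^esub> h = f \<oplus>\<^bsub>?F\<^esub> (g \<oplus>\<^bsub>?F\<^esub> h)"
        by (auto intro!: restrict_ext simp: cl R.a_assoc)
    next
      show "\<zero>\<^bsub>?F\<^esub> \<in> carrier ?F" unfolding free_module_sel by (rule free_moduleI[where T = "{}"]) auto
      fix f assume f: "f \<in> carrier ?F"
      have "\<zero>\<^bsub>?F\<^esub> \<oplus>\<^bsub>?F\<^esub> f = (\<lambda>i\<in>I. f i)" by (auto intro!: restrict_ext simp: cl f)
      then show "\<zero>\<^bsub>?F\<^esub> \<oplus>\<^bsub>?F\<^esub> f = f" using ext[OF f] by simp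
      show "\<exists>g\<in>carrier ?F. g \<oplus>\<^bsub>?F\<^esub> f = \<zero>\<^bsub>?F\<^esub>"
      proof
        show "(\<lambda>i\<in>I. \<ominus>\<^bsub>R\<^esub> f i) \<in> carrier ?F"
          by (rule free_moduleI[where T = "{i \<in> I. f i \<noteq> \<zero>\<^bsub>R\<^esub>}"]) (auto simp: f cl fin)
        show "(\<lambda>i\<in>I. \<ominus>\<^bsub>R\<^esub> f i) \<oplus>\<^bsub>?F\<^esub> f = \<zero>\<^bsub>?F\<^esub>"
          by (auto intro!: restrict_ext simp: f cl R.l_neg)
      qed
    qed
  next
    fix a f assume a: "a \<in> carrier R" and f: "f \<in> carrier ?F"
    show "a \<odot>\<^bsub>?F\<^esub> f \<in> carrier ?F" unfolding free_module_sel
      by (rule free_moduleI[where T = "{i \<in> I. f i \<noteq> \<zero>\<^bsub>R\<^esub>}"]) (auto simp: a f cl fin)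
    fix b assume b: "b \<in> carrier R"
    show "(a \<oplus>\<^bsub>R\<^esub> b) \<odot>\<^bsub>?F\<^esub> f = a \<odot>\<^bsub>?F\<^esub> f \<oplus>\<^bsub>?F\<^esub> b \<odot>\<^bsub>?F\<^esub> f"
      by (auto intro!: restrict_ext simp: a b f cl R.l_distr)
    show "(a \<otimes>\<^bsub>R\<^esub> b) \<odot>\<^bsub>?F\<^esub> f = a \<odot>\<^bsub>?F\<^esub> (b \<odot>\<^bsub>?F\<^esub> f)"
      by (auto intro!: restrict_ext simp: a b f cl R.m_assoc)
  next
    fix a f g assume "a \<in> carrier R" "f \<in> carrier ?F" "g \<in> carrier ?F"
    then show "a \<odot>\<^bsub>?F\<^esub> (f \<oplus>\<^bsub>?F\<^esub> g) = a \<odot>\<^bsub>?F\<^esub> f \<oplus>\<^bsub>?F\<^esub> a \<odot>\<^bsub>?F\<^esub> g"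
      by (auto intro!: restrict_ext simp: cl R.r_distr)
  next
    fix f assume f: "f \<in> carrier ?F"
    have "\<one>\<^bsub>R\<^esub> \<odot>\<^bsub>?F\<^esub> f = (\<lambda>i\<in>I. f i)" by (auto intro!: restrict_ext simp: cl f)
    then show "\<one>\<^bsub>R\<^esub> \<odot>\<^bsub>?F\<^esub> f = f" using ext[OF f] by simp
  qed
qed

lemma free_gen_closed:
  assumes "cring R"
  shows "free_gen R I i \<in> carrier (free_module R I)"
proof -
  interpret R: cring R by fact
  show ?thesis unfolding free_gen_def by (rule free_moduleI[where T = "{i}"]) auto
qed

text \<open>
  A finitely supported function is the sum of its values times the generators; the proof removes
  one point of the support at a time. This induction principle is behind every uniqueness
  statement for maps out of free modules and tensor products.
\<close>

lemma free_module_generation: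
  assumes "cring R" "submodule H R (free_module R I)" "\<And>i. i \<in> I \<Longrightarrow> free_gen R I i \<in> H"
  shows "H = carrier (free_module R I)"
proof
  interpret R: cring R by fact
  let ?F = "free_module R I"
  show "H \<subseteq> carrier ?F" by (rule submodule_subset[OF assms(2)])
  have "f \<in> H" if "finite T" "f \<in> carrier ?F" "{i \<in> I. f i \<noteq> \<zero>\<^bsub>R\<^esub>} \<subseteq> T" for f T
    using that
  proof (induction T arbitrary: f rule: finite_induct)
    case empty
    then have "f = \<zero>\<^bsub>?F\<^esub>" by (auto simp: free_module_carrier_iff extensional_def fun_eq_iff)
    then show ?case using submodule_zero[OF assms(2)] by (simp only:)
  next
    case (insert j T)
    have f: "f \<in> extensional I" "\<And>i. i \<in> I \<Longrightarrow> f i \<in> carrier R"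
      using insert.prems by (auto simp: free_module_carrier_iff)
    show ?case
    proof (cases "j \<in> I")
      case False
      then show ?thesis using insert by auto
    next
      case True
      define g where "g = (\<lambda>i\<in>I. if i = j then \<zero>\<^bsub>R\<^esub> else f i)"
      have "g \<in> carrier ?F" unfolding g_def
        by (rule free_moduleI[where T = T]) (use insert f in auto)
      moreover have "{i \<in> I. g i \<noteq> \<zero>\<^bsub>R\<^esub>} \<subseteq> T" using insert.prems by (auto simp: g_def)
      ultimately have g: "g \<in> H" using insert.IH by blast
      have "f = (\<lambda>i\<in>I. f i)" using f by (simp add: extensional_restrict)
      also have "\<dots> = g \<oplus>\<^bsub>?F\<^esub> (f j \<odot>\<^bsub>?F\<^esub> free_gen R I j)"
        by (auto intro!: restrict_ext simp: g_def free_gen_def f True)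
      also have "\<dots> \<in> H"
        by (intro submodule_add[OF assms(2)] submodule_smult[OF assms(2)] g f assms(3) True)
      finally show ?thesis .
    qed
  qed
  then show "carrier ?F \<subseteq> H" by (auto simp: free_module_carrier_iff)
qed

lemma finsum_singleton_support:
  assumes "abelian_monoid P" "\<And>i. i \<in> A \<Longrightarrow> g i \<in> carrier P" "finite A" "j \<in> A"
    "\<And>i. i \<in> A \<Longrightarrow> i \<noteq> j \<Longrightarrow> g i = \<zero>\<^bsub>P\<^esub>"
  shows "(\<Oplus>\<^bsub>P\<^esub>i\<in>A. g i) = g j"
proof -
  interpret abelian_monoid P by fact
  have "(\<Oplus>\<^bsub>P\<^esub>i\<in>A. g i) = (\<Oplus>\<^bsub>P\<^esub>i\<in>A. if j = i then g i else \<zero>\<^bsub>P\<^esub>)"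
    using assms by (intro finsum_cong') auto
  also have "\<dots> = g j"
    using finsum_singleton[of j A g] assms by auto
  finally show ?thesis .
qed

text \<open>
  The map is \<open>f \<mapsto> \<Sum>i. f i \<odot> b i\<close>. The sum runs over the support of \<open>f\<close>, which varies with \<open>f\<close>;
  to compare two supports, both sums are rewritten as sums over a common finite set.
\<close>

lemma free_module_lift:
  assumes "module R P" "\<And>i. i \<in> I \<Longrightarrow> b i \<in> carrier P"
  obtains h where "h \<in> mod_hom R (free_module R I) P" "\<And>i. i \<in> I \<Longrightarrow> h (free_gen R I i) = b i"
proof -
  interpret P: module R P by fact
  let ?F = "free_module R I"
  let ?s = "\<lambda>f. {i \<in> I. f i \<noteq> \<zero>\<^bsub>R\<^esub>}"
  define h where "h f = (\<Oplus>\<^bsub>P\<^esub>i\<in>?s f. f i \<odot>\<^bsub>P\<^esub> b i)" for f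
  have cl: "f i \<in> carrier R" if "f \<in> carrier ?F" "i \<in> I" for f i
    using that by (auto simp: free_module_carrier_iff)
  have fin: "finite (?s f)" if "f \<in> carrier ?F" for f
    using that by (auto simp: free_module_carrier_iff)
  have F: "module R ?F" by (rule free_module_module) (rule P.R.is_cring)
  interpret F: module R ?F by fact
  have h: "h f = (\<Oplus>\<^bsub>P\<^esub>i\<in>A. f i \<odot>\<^bsub>P\<^esub> b i)"
    if "finite A" "?s f \<subseteq> A" "A \<subseteq> I" "f \<in> carrier ?F" for f A
    unfolding h_def
  proof (rule P.add.finprod_mono_neutral_cong_left)
    show "f i \<odot>\<^bsub>P\<^esub> b i = \<zero>\<^bsub>P\<^esub>" if "i \<in> A - ?s f" for i
      using that \<open>A \<subseteq> I\<close> assms(2)[of i] by auto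
  qed (use that assms(2) cl in auto)
  have "h \<in> mod_hom R ?F P"
  proof (rule mod_homI)
    fix f assume f: "f \<in> carrier ?F"
    show "h f \<in> carrier P" unfolding h_def
      by (rule P.M.finsum_closed) (auto simp: cl f assms(2))
    fix a assume a: "a \<in> carrier R"
    have "h (a \<odot>\<^bsub>?F\<^esub> f) = (\<Oplus>\<^bsub>P\<^esub>i\<in>?s f. (a \<odot>\<^bsub>?F\<^esub> f) i \<odot>\<^bsub>P\<^esub> b i)"
      by (rule h) (use f a fin F.smult_closed[OF a f] in auto)
    also have "\<dots> = (\<Oplus>\<^bsub>P\<^esub>i\<in>?s f. a \<odot>\<^bsub>P\<^esub> (f i \<odot>\<^bsub>P\<^esub> b i))"
      by (rule P.M.finsum_cong') (auto simp: cl f a assms(2) P.smult_assoc1)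
    also have "\<dots> = a \<odot>\<^bsub>P\<^esub> h f" unfolding h_def
      by (rule P.finsum_smult_ldistr[symmetric]) (auto simp: fin cl f a assms(2))
    finally show "h (a \<odot>\<^bsub>?F\<^esub> f) = a \<odot>\<^bsub>P\<^esub> h f" .
  next
    fix f g assume fg: "f \<in> carrier ?F" "g \<in> carrier ?F"
    let ?A = "?s f \<union> ?s g"
    have A: "finite ?A" "?A \<subseteq> I" using fin fg by auto
    have "h (f \<oplus>\<^bsub>?F\<^esub> g) = (\<Oplus>\<^bsub>P\<^esub>i\<in>?A. (f \<oplus>\<^bsub>?F\<^esub> g) i \<odot>\<^bsub>P\<^esub> b i)"
      by (rule h) (use A fg F.M.a_closed[OF fg] in auto)
    also have "\<dots> = (\<Oplus>\<^bsub>P\<^esub>i\<in>?A. f i \<odot>\<^bsub>P\<^esub> b i \<oplus>\<^bsub>P\<^esub> g i \<odot>\<^bsub>P\<^esub> b i)"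
      by (rule P.M.finsum_cong') (auto simp: cl fg assms(2) P.smult_l_distr)
    also have "\<dots> = (\<Oplus>\<^bsub>P\<^esub>i\<in>?A. f i \<odot>\<^bsub>P\<^esub> b i) \<oplus>\<^bsub>P\<^esub> (\<Oplus>\<^bsub>P\<^esub>i\<in>?A. g i \<odot>\<^bsub>P\<^esub> b i)"
      by (rule P.M.finsum_addf) (auto simp: cl fg assms(2))
    also have "\<dots> = h f \<oplus>\<^bsub>P\<^esub> h g" using A fg by (subst (1 2) h) auto
    finally show "h (f \<oplus>\<^bsub>?F\<^esub> g) = h f \<oplus>\<^bsub>P\<^esub> h g" .
  qed
  moreover have "h (free_gen R I i) = b i" if i: "i \<in> I" for i
  proof -
    have "h (free_gen R I i) = (\<Oplus>\<^bsub>P\<^esub>j\<in>{i}. free_gen R I i j \<odot>\<^bsub>P\<^esub> b j)"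
      by (rule h) (use i free_gen_closed[OF P.R.is_cring, of I i] in \<open>auto simp: free_gen_def\<close>)
    also have "\<dots> = b i"
      by (subst finsum_singleton_support[where j = i])
        (use i assms(2) P.M.abelian_monoid_axioms in \<open>auto simp: free_gen_def\<close>)
    finally show ?thesis .
  qed
  ultimately show thesis by (rule that)
qed

lemma mod_hom_agree_submodule:
  assumes "module R M" "module R N" "f \<in> mod_hom R M N" "g \<in> mod_hom R M N"
  shows "submodule {x \<in> carrier M. f x = g x} R M"
proof -
  interpret M: module R M by fact
  interpret N: module R N by fact
  show ?thesis
    by (rule submodule_criterion[OF assms(1)])
      (auto simp: mod_hom_facts[OF assms(3)] mod_hom_facts[OF assms(4)]
        mod_hom_zero[OF assms(1,2,3)] mod_hom_zero[OF assms(1,2,4)])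
qed

section \<open>Tensor products\<close>

definition bilinear_map ::
    "'a ring \<Rightarrow> ('a, 'm) module \<Rightarrow> ('a, 'n) module \<Rightarrow> ('a, 'p) module \<Rightarrow> ('m \<Rightarrow> 'n \<Rightarrow> 'p) \<Rightarrow> bool" where
  "bilinear_map R M N P b \<longleftrightarrow>
     (\<forall>x\<in>carrier M. b x \<in> mod_hom R N P) \<and> (\<forall>y\<in>carrier N. (\<lambda>x. b x y) \<in> mod_hom R M P)"

lemma tensor_rels_submodule:
  assumes "module R M" "module R N"
  shows "submodule (tensor_rels R M N) R (free_module R (carrier M \<times> carrier N))"
proof -
  interpret M: module R M by fact
  interpret N: module R N by fact
  let ?F = "free_module R (carrier M \<times> carrier N)"
  have F: "module R ?F" by (rule free_module_module[OF M.R.is_cring])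
  interpret F: module R ?F by fact
  note e = free_gen_closed[OF M.R.is_cring, of "carrier M \<times> carrier N"]
  show ?thesis unfolding tensor_rels_def Let_def
    by (rule submod_span_submodule[OF F]) 
      (auto intro!: F.M.minus_closed F.M.a_closed F.smult_closed e simp del: free_module_sel)
qed

lemma tensor_module:
  assumes "module R M" "module R N"
  shows "module R (tensor R M N)"
  unfolding tensor_def
  by (rule quot_module_module[OF free_module_module tensor_rels_submodule[OF assms]])
    (rule module.axioms(1)[OF assms(1)])

lemma pure_tensor_bilinear:
  assumes "module R M" "module R N"
  shows "bilinear_map R M N (tensor R M N) (pure_tensor R M N)"
proof -
  interpret M: module R M by fact
  interpret N: module R N by fact
  let ?I = "carrier M \<times> carrier N"
  let ?F = "free_module R ?I"
  let ?L = "tensor_rels R M N"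
  have F: "module R ?F" by (rule free_module_module[OF M.R.is_cring])
  interpret F: module R ?F by fact
  note e = free_gen_closed[OF M.R.is_cring, of ?I]
  note L = tensor_rels_submodule[OF assms]
  note ops = quot_module_ops[OF F L, symmetric]
  have rel: "pure_tensor R M N x y = ?L +>\<^bsub>?F\<^esub> f"
    if "f \<in> carrier ?F" "free_gen R ?I (x, y) \<ominus>\<^bsub>?F\<^esub> f \<in> ?L" for x y f
    unfolding pure_tensor_def using coset_eq_iff[OF F L e that(1)] that(2) by simp
  have gen: "v \<in> ?L" if "v \<in> {free_gen R ?I (x \<oplus>\<^bsub>M\<^esub> x', y) \<ominus>\<^bsub>?F\<^esub> (free_gen R ?I (x, y) \<oplus>\<^bsub>?F\<^esub> free_gen R ?I (x', y)) | x x' y.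
            x \<in> carrier M \<and> x' \<in> carrier M \<and> y \<in> carrier N} \<union>
        {free_gen R ?I (x, y \<oplus>\<^bsub>N\<^esub> y') \<ominus>\<^bsub>?F\<^esub> (free_gen R ?I (x, y) \<oplus>\<^bsub>?F\<^esub> free_gen R ?I (x, y')) | x y y'.
            x \<in> carrier M \<and> y \<in> carrier N \<and> y' \<in> carrier N} \<union>
        {free_gen R ?I (a \<odot>\<^bsub>M\<^esub> x, y) \<ominus>\<^bsub>?F\<^esub> a \<odot>\<^bsub>?F\<^esub> free_gen R ?I (x, y) | a x y.
            a \<in> carrier R \<and> x \<in> carrier M \<and> y \<in> carrier N} \<union>
        {free_gen R ?I (x, a \<odot>\<^bsub>N\<^esub> y) \<ominus>\<^bsub>?F\<^esub> a \<odot>\<^bsub>?F\<^esub> free_gen R ?I (x, y) | a x y.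
            a \<in> carrier R \<and> x \<in> carrier M \<and> y \<in> carrier N}" for v
    using that unfolding tensor_rels_def Let_def by (rule subsetD[OF submod_span_superset])
  have closed: "pure_tensor R M N x y \<in> carrier (tensor R M N)" for x y
    by (simp add: tensor_def pure_tensor_def quot_module_carrier e del: free_module_sel)
  show ?thesis unfolding bilinear_map_def
  proof (intro conjI ballI)
    fix x assume x: "x \<in> carrier M"
    show "pure_tensor R M N x \<in> mod_hom R N (tensor R M N)"
    proof (rule mod_homI[OF closed])
      fix y y' assume y: "y \<in> carrier N" "y' \<in> carrier N"
      show "pure_tensor R M N x (y \<oplus>\<^bsub>N\<^esub> y') = pure_tensor R M N x y \<oplus>\<^bsub>tensor R M N\<^esub> pure_tensor R M N x y'"
        unfolding tensor_def pure_tensor_def[of _ _ _ x y] pure_tensor_def[of _ _ _ x y'] ops(1)[OF e e]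
        by (rule rel[OF F.M.a_closed[OF e e]], rule gen) (use x y in blast)
    next
      fix a y assume y: "a \<in> carrier R" "y \<in> carrier N"
      show "pure_tensor R M N x (a \<odot>\<^bsub>N\<^esub> y) = a \<odot>\<^bsub>tensor R M N\<^esub> pure_tensor R M N x y"
        unfolding tensor_def pure_tensor_def[of _ _ _ x y] ops(2)[OF y(1) e]
        by (rule rel[OF F.smult_closed[OF y(1) e]], rule gen) (use x y in blast)
    qed
  next
    fix y assume y: "y \<in> carrier N"
    show "(\<lambda>x. pure_tensor R M N x y) \<in> mod_hom R M (tensor R M N)"
    proof (rule mod_homI[OF closed])
      fix x x' assume x: "x \<in> carrier M" "x' \<in> carrier M"
      show "pure_tensor R M N (x \<oplus>\<^bsub>M\<^esub> x') y = pure_tensor R M N x y \<oplus>\<^bsub>tensor R M N\<^esub> pure_tensor R M N x' y"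
        unfolding tensor_def pure_tensor_def[of _ _ _ x y] pure_tensor_def[of _ _ _ x' y] ops(1)[OF e e]
        by (rule rel[OF F.M.a_closed[OF e e]], rule gen) (use x y in blast)
    next
      fix a x assume x: "a \<in> carrier R" "x \<in> carrier M"
      show "pure_tensor R M N (a \<odot>\<^bsub>M\<^esub> x) y = a \<odot>\<^bsub>tensor R M N\<^esub> pure_tensor R M N x y"
        unfolding tensor_def pure_tensor_def[of _ _ _ x y] ops(2)[OF x(1) e]
        by (rule rel[OF F.smult_closed[OF x(1) e]], rule gen) (use x y in blast)
    qed
  qed
qed

lemmas pure_tensor_right_hom = pure_tensor_bilinear[unfolded bilinear_map_def, THEN conjunct1, rule_format]
lemmas pure_tensor_left_hom = pure_tensor_bilinear[unfolded bilinear_map_def, THEN conjunct2, rule_format]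

lemma pure_tensor_closed:
  assumes "module R M" "module R N" "x \<in> carrier M" "y \<in> carrier N"
  shows "pure_tensor R M N x y \<in> carrier (tensor R M N)"
  using mod_hom_closed[OF pure_tensor_right_hom[OF assms(1-3)] assms(4)] .

text \<open>
  The induction principle for tensor products: to prove a linear property for all tensors it
  suffices to prove it for pure ones.
\<close>

lemma tensor_generation:
  assumes "module R M" "module R N" "submodule H R (tensor R M N)"
    "\<And>x y. x \<in> carrier M \<Longrightarrow> y \<in> carrier N \<Longrightarrow> pure_tensor R M N x y \<in> H"
  shows "H = carrier (tensor R M N)"
proof
  interpret M: module R M by fact
  let ?I = "carrier M \<times> carrier N"
  let ?F = "free_module R ?I"
  let ?L = "tensor_rels R M N"
  have F: "module R ?F" by (rule free_module_module[OF M.R.is_cring])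
  note L = tensor_rels_submodule[OF assms(1,2)]
  have "{f \<in> carrier ?F. ?L +>\<^bsub>?F\<^esub> f \<in> H} = carrier ?F"
  proof (rule free_module_generation[OF M.R.is_cring])
    show "submodule {f \<in> carrier ?F. ?L +>\<^bsub>?F\<^esub> f \<in> H} R ?F"
      by (rule submodule_vimage[OF F tensor_module[OF assms(1,2)] _ assms(3)])
        (use quot_map_hom[OF F L] in \<open>simp add: tensor_def\<close>)
  next
    fix i assume "i \<in> ?I"
    then show "free_gen R ?I i \<in> {f \<in> carrier ?F. ?L +>\<^bsub>?F\<^esub> f \<in> H}"
      using assms(4) free_gen_closed[OF M.R.is_cring, of ?I] by (auto simp: pure_tensor_def)
  qed
  then show "carrier (tensor R M N) \<subseteq> H"
    by (auto simp: tensor_def quot_module_carrier)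
qed (rule submodule_subset[OF assms(3)])

lemma tensor_hom_eqI:
  assumes "module R M" "module R N" "module R P"
    "f \<in> mod_hom R (tensor R M N) P" "g \<in> mod_hom R (tensor R M N) P"
    "\<And>x y. x \<in> carrier M \<Longrightarrow> y \<in> carrier N \<Longrightarrow> f (pure_tensor R M N x y) = g (pure_tensor R M N x y)"
    "t \<in> carrier (tensor R M N)"
  shows "f t = g t"
proof -
  have "{x \<in> carrier (tensor R M N). f x = g x} = carrier (tensor R M N)"
    by (rule tensor_generation[OF assms(1,2)
          mod_hom_agree_submodule[OF tensor_module[OF assms(1,2)] assms(3-5)]])
      (auto simp: assms(1,2,6) pure_tensor_closed)
  then show ?thesis using assms(7) by blast
qed

text \<open>
  Half of the universal property. The linear extension of \<open>b\<close> to the free module on \<open>M \<times> N\<close> kills the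
  four families of generating relations, as these express precisely the bilinearity of \<open>b\<close>.
\<close>

lemma tensor_lift_exists:
  assumes "module R M" "module R N" "module R P" "bilinear_map R M N P b"
  obtains h where "h \<in> mod_hom R (tensor R M N) P"
    "\<And>x y. x \<in> carrier M \<Longrightarrow> y \<in> carrier N \<Longrightarrow> h (pure_tensor R M N x y) = b x y"
proof -
  interpret M: module R M by fact
  interpret N: module R N by fact
  interpret P: module R P by fact
  let ?I = "carrier M \<times> carrier N"
  let ?F = "free_module R ?I"
  let ?L = "tensor_rels R M N"
  have F: "module R ?F" by (rule free_module_module[OF M.R.is_cring])
  interpret F: module R ?F by fact
  note e = free_gen_closed[OF M.R.is_cring, of ?I]
  note L = tensor_rels_submodule[OF assms(1,2)]
  have b: "\<And>x. x \<in> carrier M \<Longrightarrow> b x \<in> mod_hom R N P" "\<And>y. y \<in> carrier N \<Longrightarrow> (\<lambda>x. b x y) \<in> mod_hom R M P"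
    using assms(4) by (auto simp: bilinear_map_def)
  have bc: "b x y \<in> carrier P" if "x \<in> carrier M" "y \<in> carrier N" for x y
    using mod_hom_closed[OF b(1)] that by blast
  obtain h where h: "h \<in> mod_hom R ?F P" "\<And>i. i \<in> ?I \<Longrightarrow> h (free_gen R ?I i) = (case i of (x, y) \<Rightarrow> b x y)"
    by (rule free_module_lift[OF assms(3), of ?I "\<lambda>(x, y). b x y"]) (auto simp: bc)
  note hh = mod_hom_facts[OF h(1)] mod_hom_minus[OF F assms(3) h(1)] h(2)
  note z = minus_eq_zero_iff[OF assms(3)]
  \<comment> \<open>Each generating relation maps to \<open>b\<close> of a sum minus the sum of the values, and likewise for multiples.\<close>
  have "?L \<subseteq> a_kernel ?F P h"
    unfolding tensor_rels_def Let_def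
  proof (rule submod_span_minimal[OF submodule_kernel[OF F assms(3) h(1)]], unfold a_kernel_eq, intro Un_least subsetI)
  qed (auto simp: hh e z bc mod_hom_facts[OF b(1)] mod_hom_facts[OF b(2)] simp del: free_module_sel
      intro!: F.M.minus_closed)
  then have ker: "h x = \<zero>\<^bsub>P\<^esub>" if "x \<in> ?L" for x using that by (auto simp: a_kernel_eq)
  obtain g where g: "g \<in> mod_hom R (quot_module ?F ?L) P" "\<And>x. x \<in> carrier ?F \<Longrightarrow> g (?L +>\<^bsub>?F\<^esub> x) = h x"
    using quot_module_lift[OF F L assms(3) h(1) ker] by blast
  show thesis
  proof (rule that)
    show "g \<in> mod_hom R (tensor R M N) P" using g(1) by (simp add: tensor_def)
    show "g (pure_tensor R M N x y) = b x y" if "x \<in> carrier M" "y \<in> carrier N" for x y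
      using g(2)[OF e] h(2)[of "(x, y)"] that by (simp add: pure_tensor_def)
  qed
qed

lemma hom_module_carrier_iff:
  "f \<in> carrier (hom_module R M N) \<longleftrightarrow> f \<in> mod_hom R M N \<and> f \<in> extensional (carrier M)"
  by (auto simp: hom_module_def)

text \<open>
  Uniqueness holds because pure tensors generate. Since the description operator ranges over
  extensional maps, the candidate is first restricted to the carrier.
\<close>

lemma tensor_lift_props:
  assumes "module R M" "module R N" "module R P" "bilinear_map R M N P b"
  shows tensor_lift_hom: "tensor_lift R M N P b \<in> mod_hom R (tensor R M N) P"
    and tensor_lift_pure: "\<And>x y. x \<in> carrier M \<Longrightarrow> y \<in> carrier N \<Longrightarrow>
      tensor_lift R M N P b (pure_tensor R M N x y) = b x y"
proof -
  obtain h where h: "h \<in> mod_hom R (tensor R M N) P"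
    "\<And>x y. x \<in> carrier M \<Longrightarrow> y \<in> carrier N \<Longrightarrow> h (pure_tensor R M N x y) = b x y"
    using tensor_lift_exists[OF assms] by blast
  let ?P = "\<lambda>h. h \<in> carrier (hom_module R (tensor R M N) P) \<and>
     (\<forall>x\<in>carrier M. \<forall>y\<in>carrier N. h (pure_tensor R M N x y) = b x y)"
  have "\<exists>!h. ?P h"
  proof (rule ex1I[of _ "restrict h (carrier (tensor R M N))"])
    show "?P (restrict h (carrier (tensor R M N)))"
      using h pure_tensor_closed[OF assms(1,2)] mod_hom_cong[OF tensor_module[OF assms(1,2)] h(1)]
      by (auto simp: hom_module_carrier_iff)
    fix k assume k: "?P k"
    show "k = restrict h (carrier (tensor R M N))"
    proof
      fix t
      show "k t = restrict h (carrier (tensor R M N)) t"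
        using k tensor_hom_eqI[OF assms(1-3), of k h t] h
        by (cases "t \<in> carrier (tensor R M N)") (auto simp: hom_module_carrier_iff extensional_def)
    qed
  qed
  from theI'[OF this] have "?P (tensor_lift R M N P b)" unfolding tensor_lift_def .
  then show "tensor_lift R M N P b \<in> mod_hom R (tensor R M N) P"
    and "\<And>x y. x \<in> carrier M \<Longrightarrow> y \<in> carrier N \<Longrightarrow>
      tensor_lift R M N P b (pure_tensor R M N x y) = b x y"
    by (auto simp: hom_module_carrier_iff)
qed

lemma tensor_map_left_bilinear:
  assumes "module R M" "module R M'" "module R N" "f \<in> mod_hom R M M'"
  shows "bilinear_map R M N (tensor R M' N) (\<lambda>x y. pure_tensor R M' N (f x) y)"
  unfolding bilinear_map_def
  using pure_tensor_right_hom[OF assms(2,3)] mod_hom_closed[OF assms(4)]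
    mod_hom_compose[OF assms(4) pure_tensor_left_hom[OF assms(2,3)]] by auto

lemmas tensor_map_left_hom =
  tensor_lift_hom[OF _ _ tensor_module tensor_map_left_bilinear, folded tensor_map_left_def]

lemmas tensor_map_left_pure =
  tensor_lift_pure[OF _ _ tensor_module tensor_map_left_bilinear, folded tensor_map_left_def]

lemma tensor_map_right:
  assumes "module R M" "module R N" "module R N'" "g \<in> mod_hom R N N'"
  obtains G where "G \<in> mod_hom R (tensor R M N) (tensor R M N')"
    "\<And>x y. x \<in> carrier M \<Longrightarrow> y \<in> carrier N \<Longrightarrow> G (pure_tensor R M N x y) = pure_tensor R M N' x (g y)"
proof -
  have "bilinear_map R M N (tensor R M N') (\<lambda>x y. pure_tensor R M N' x (g y))"
    unfolding bilinear_map_def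
    using pure_tensor_left_hom[OF assms(1,3)] mod_hom_closed[OF assms(4)]
      mod_hom_compose[OF assms(4) pure_tensor_right_hom[OF assms(1,3)]] by auto
  from tensor_lift_exists[OF assms(1,2) tensor_module[OF assms(1,3)] this] show thesis using that by blast
qed

text \<open>
  Functoriality applied to an isomorphism and to its inverse gives two maps whose composites fix
  all pure tensors.
\<close>

lemma tensor_iso_right:
  assumes "module R M" "module R N" "module R N'" "g \<in> mod_iso R N N'"
  obtains G where "G \<in> mod_iso R (tensor R M N) (tensor R M N')"
    "\<And>x y. x \<in> carrier M \<Longrightarrow> y \<in> carrier N \<Longrightarrow> G (pure_tensor R M N x y) = pure_tensor R M N' x (g y)"
proof -
  have g: "g \<in> mod_hom R N N'" using assms(4) by (simp add: mod_iso_def)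
  obtain k where k: "k \<in> mod_iso R N' N" "\<And>x. x \<in> carrier N \<Longrightarrow> k (g x) = x"
    "\<And>y. y \<in> carrier N' \<Longrightarrow> g (k y) = y"
    using mod_iso_inverse[OF assms(2,4)] by blast
  have k': "k \<in> mod_hom R N' N" using k(1) by (simp add: mod_iso_def)
  obtain G where G: "G \<in> mod_hom R (tensor R M N) (tensor R M N')"
    "\<And>x y. x \<in> carrier M \<Longrightarrow> y \<in> carrier N \<Longrightarrow> G (pure_tensor R M N x y) = pure_tensor R M N' x (g y)"
    using tensor_map_right[OF assms(1-3) g] by blast
  obtain K where K: "K \<in> mod_hom R (tensor R M N') (tensor R M N)"
    "\<And>x y. x \<in> carrier M \<Longrightarrow> y \<in> carrier N' \<Longrightarrow> K (pure_tensor R M N' x y) = pure_tensor R M N x (k y)"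
    using tensor_map_right[OF assms(1,3,2) k'] by blast
  have KG: "K (G t) = t" if "t \<in> carrier (tensor R M N)" for t
    by (rule tensor_hom_eqI[OF assms(1,2) tensor_module[OF assms(1,2)] mod_hom_compose[OF G(1) K(1)] mod_hom_id _ that])
      (simp add: G K k mod_hom_closed[OF g])
  have GK: "G (K t) = t" if "t \<in> carrier (tensor R M N')" for t
    by (rule tensor_hom_eqI[OF assms(1,3) tensor_module[OF assms(1,3)] mod_hom_compose[OF K(1) G(1)] mod_hom_id _ that])
      (simp add: G K k mod_hom_closed[OF k'])
  have "bij_betw G (carrier (tensor R M N)) (carrier (tensor R M N'))"
    by (rule bij_betw_byWitness[where f' = K]) (auto simp: KG GK mod_hom_closed[OF G(1)] mod_hom_closed[OF K(1)])
  then show thesis using G by (intro that[of G]) (auto simp: mod_iso_def)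
qed

section \<open>Modules of homomorphisms\<close>

lemma hom_module_sel [simp]:
  "\<zero>\<^bsub>hom_module R M N\<^esub> = (\<lambda>x\<in>carrier M. \<zero>\<^bsub>N\<^esub>)"
  "f \<oplus>\<^bsub>hom_module R M N\<^esub> g = (\<lambda>x\<in>carrier M. f x \<oplus>\<^bsub>N\<^esub> g x)"
  "a \<odot>\<^bsub>hom_module R M N\<^esub> f = (\<lambda>x\<in>carrier M. a \<odot>\<^bsub>N\<^esub> f x)"
  by (simp_all add: hom_module_def)

lemma hom_moduleI:
  assumes "module R M" "f \<in> mod_hom R M N"
  shows "restrict f (carrier M) \<in> carrier (hom_module R M N)"
  using mod_hom_cong[OF assms, of "restrict f (carrier M)"] by (simp add: hom_module_carrier_iff)

lemma hom_module_module:
  assumes "module R M" "module R N"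
  shows "module R (hom_module R M N)"
proof -
  interpret R: cring R by (rule module.axioms(1)[OF assms(1)])
  interpret M: module R M by fact
  interpret N: module R N by fact
  let ?H = "hom_module R M N"
  have hom: "f \<in> mod_hom R M N" if "f \<in> carrier ?H" for f
    using that by (simp add: hom_module_carrier_iff)
  note hf = mod_hom_facts[OF hom]
  have ext: "(\<lambda>i\<in>carrier M. f i) = f" if "f \<in> carrier ?H" for f
    using that by (simp add: hom_module_carrier_iff extensional_restrict)
  show ?thesis
  proof (rule moduleI)
    show "cring R" by (rule R.is_cring)
    show "abelian_group ?H"
    proof (rule abelian_groupI)
      fix f g assume fg: "f \<in> carrier ?H" "g \<in> carrier ?H"
      show "f \<oplus>\<^bsub>?H\<^esub> g \<in> carrier ?H" unfolding hom_module_sel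
        by (rule hom_moduleI[OF assms(1)], rule mod_homI)
          (auto simp: fg hf N.smult_r_distr N.M.a_ac)
      show "f \<oplus>\<^bsub>?H\<^esub> g = g \<oplus>\<^bsub>?H\<^esub> f"
        by (auto intro!: restrict_ext simp: fg hf N.M.a_comm)
      fix h assume "h \<in> carrier ?H"
      with fg show "f \<oplus>\<^bsub>?H\<^esub> g \<oplus>\<^bsub>?H\<^esub> h = f \<oplus>\<^bsub>?H\<^esub> (g \<oplus>\<^bsub>?H\<^esub> h)"
        by (auto intro!: restrict_ext simp: hf N.M.a_assoc)
    next
      show "\<zero>\<^bsub>?H\<^esub> \<in> carrier ?H" unfolding hom_module_sel
        by (rule hom_moduleI[OF assms(1)], rule mod_homI) auto
      fix f assume f: "f \<in> carrier ?H"
      have "\<zero>\<^bsub>?H\<^esub> \<oplus>\<^bsub>?H\<^esub> f = (\<lambda>i\<in>carrier M. f i)" by (auto intro!: restrict_ext simp: hf f)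
      then show "\<zero>\<^bsub>?H\<^esub> \<oplus>\<^bsub>?H\<^esub> f = f" using ext[OF f] by simp
      show "\<exists>g\<in>carrier ?H. g \<oplus>\<^bsub>?H\<^esub> f = \<zero>\<^bsub>?H\<^esub>"
      proof
        show "(\<lambda>i\<in>carrier M. \<ominus>\<^bsub>N\<^esub> f i) \<in> carrier ?H"
          by (rule hom_moduleI[OF assms(1)], rule mod_homI)
            (auto simp: f hf N.smult_r_minus N.M.minus_add)
        show "(\<lambda>i\<in>carrier M. \<ominus>\<^bsub>N\<^esub> f i) \<oplus>\<^bsub>?H\<^esub> f = \<zero>\<^bsub>?H\<^esub>"
          by (auto intro!: restrict_ext simp: f hf N.M.l_neg)
      qed
    qed
  next
    fix a f assume a: "a \<in> carrier R" and f: "f \<in> carrier ?H"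
    show "a \<odot>\<^bsub>?H\<^esub> f \<in> carrier ?H" unfolding hom_module_sel
      by (rule hom_moduleI[OF assms(1)], rule mod_homI)
        (auto simp: a f hf N.smult_r_distr N.smult_assoc1[symmetric] R.m_comm)
    fix b assume b: "b \<in> carrier R"
    show "(a \<oplus>\<^bsub>R\<^esub> b) \<odot>\<^bsub>?H\<^esub> f = a \<odot>\<^bsub>?H\<^esub> f \<oplus>\<^bsub>?H\<^esub> b \<odot>\<^bsub>?H\<^esub> f"
      by (auto intro!: restrict_ext simp: a b f hf N.smult_l_distr)
    show "(a \<otimes>\<^bsub>R\<^esub> b) \<odot>\<^bsub>?H\<^esub> f = a \<odot>\<^bsub>?H\<^esub> (b \<odot>\<^bsub>?H\<^esub> f)"
      by (auto intro!: restrict_ext simp: a b f hf N.smult_assoc1)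
  next
    fix a f g assume "a \<in> carrier R" "f \<in> carrier ?H" "g \<in> carrier ?H"
    then show "a \<odot>\<^bsub>?H\<^esub> (f \<oplus>\<^bsub>?H\<^esub> g) = a \<odot>\<^bsub>?H\<^esub> f \<oplus>\<^bsub>?H\<^esub> a \<odot>\<^bsub>?H\<^esub> g"
      by (auto intro!: restrict_ext simp: hf N.smult_r_distr)
  next
    fix f assume f: "f \<in> carrier ?H"
    have "\<one>\<^bsub>R\<^esub> \<odot>\<^bsub>?H\<^esub> f = (\<lambda>i\<in>carrier M. f i)" by (auto intro!: restrict_ext simp: hf f)
    then show "\<one>\<^bsub>R\<^esub> \<odot>\<^bsub>?H\<^esub> f = f" using ext[OF f] by simp
  qed
qed

lemma hom_module_eqI:
  assumes "f \<in> carrier (hom_module R M N)" "g \<in> carrier (hom_module R M N)"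
    "\<And>x. x \<in> carrier M \<Longrightarrow> f x = g x"
  shows "f = g"
  using assms extensionalityI[of f "carrier M" g] by (auto simp: hom_module_carrier_iff)

lemma evaluation_hom:
  assumes "x \<in> carrier M"
  shows "(\<lambda>f. f x) \<in> mod_hom R (hom_module R M N) N"
  by (rule mod_homI) (auto simp: assms hom_module_carrier_iff mod_hom_closed)

lemma postcompose_hom:
  assumes "module R M" "\<kappa> \<in> mod_hom R N N'"
  shows "(\<lambda>f. \<lambda>x\<in>carrier M. \<kappa> (f x)) \<in> mod_hom R (hom_module R M N) (hom_module R M N')"
proof -
  have cl: "f x \<in> carrier N" if "f \<in> carrier (hom_module R M N)" "x \<in> carrier M" for f x
    using that mod_hom_closed by (fastforce simp: hom_module_carrier_iff)
  show ?thesis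
  proof (rule mod_homI)
    fix f assume "f \<in> carrier (hom_module R M N)"
    then show "(\<lambda>x\<in>carrier M. \<kappa> (f x)) \<in> carrier (hom_module R M N')"
      by (intro hom_moduleI[OF assms(1)] mod_hom_compose[OF _ assms(2)]) (simp add: hom_module_carrier_iff)
  qed (auto intro!: restrict_ext simp: cl mod_hom_facts[OF assms(2)])
qed

lemma postcompose_iso:
  assumes "module R M" "module R N" "\<kappa> \<in> mod_iso R N N'"
  shows "(\<lambda>f. \<lambda>x\<in>carrier M. \<kappa> (f x)) \<in> mod_iso R (hom_module R M N) (hom_module R M N')"
proof -
  have k: "\<kappa> \<in> mod_hom R N N'" using assms(3) by (simp add: mod_iso_def)
  obtain l where l: "l \<in> mod_iso R N' N" "\<And>x. x \<in> carrier N \<Longrightarrow> l (\<kappa> x) = x"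
    "\<And>y. y \<in> carrier N' \<Longrightarrow> \<kappa> (l y) = y"
    using mod_iso_inverse[OF assms(2,3)] by blast
  have l': "l \<in> mod_hom R N' N" using l(1) by (simp add: mod_iso_def)
  note p = postcompose_hom[OF assms(1)]
  have cl: "f x \<in> carrier N" if "f \<in> carrier (hom_module R M N)" "x \<in> carrier M" for f x and N :: "('a, 'z) module"
    using that mod_hom_closed by (fastforce simp: hom_module_carrier_iff)
  have "bij_betw (\<lambda>f. \<lambda>x\<in>carrier M. \<kappa> (f x)) (carrier (hom_module R M N)) (carrier (hom_module R M N'))"
  proof (rule bij_betw_byWitness[where f' = "\<lambda>f. \<lambda>x\<in>carrier M. l (f x)"])
    show "\<forall>f\<in>carrier (hom_module R M N). (\<lambda>x\<in>carrier M. l ((\<lambda>x\<in>carrier M. \<kappa> (f x)) x)) = f"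
    proof
      fix f assume f: "f \<in> carrier (hom_module R M N)"
      show "(\<lambda>x\<in>carrier M. l ((\<lambda>x\<in>carrier M. \<kappa> (f x)) x)) = f"
        by (rule hom_module_eqI[OF mod_hom_closed[OF p[OF l'] mod_hom_closed[OF p[OF k] f]] f])
          (use l(2) mod_hom_closed f in \<open>fastforce simp: hom_module_carrier_iff\<close>)
    qed
    show "\<forall>f\<in>carrier (hom_module R M N'). (\<lambda>x\<in>carrier M. \<kappa> ((\<lambda>x\<in>carrier M. l (f x)) x)) = f"
    proof
      fix f assume f: "f \<in> carrier (hom_module R M N')"
      show "(\<lambda>x\<in>carrier M. \<kappa> ((\<lambda>x\<in>carrier M. l (f x)) x)) = f"
        by (rule hom_module_eqI[OF mod_hom_closed[OF p[OF k] mod_hom_closed[OF p[OF l'] f]] f])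
          (use l(3) mod_hom_closed f in \<open>fastforce simp: hom_module_carrier_iff\<close>)
    qed
  qed (use mod_hom_closed[OF p[OF k]] mod_hom_closed[OF p[OF l']] in auto)
  then show ?thesis using p[OF k] by (simp add: mod_iso_def)
qed

section \<open>Finite generation over noetherian rings\<close>

definition fin_gen_submodule :: "'a ring \<Rightarrow> ('a, 'm) module \<Rightarrow> 'm set \<Rightarrow> bool" where
  "fin_gen_submodule R M H \<longleftrightarrow> (\<exists>V. finite V \<and> V \<subseteq> carrier M \<and> submod_span R M V = H)"

definition noetherian_module :: "'a ring \<Rightarrow> ('a, 'm) module \<Rightarrow> bool" where
  "noetherian_module R M \<longleftrightarrow> module R M \<and> (\<forall>H. submodule H R M \<longrightarrow> fin_gen_submodule R M H)"

lemma fin_gen_iff: "fin_gen R M \<longleftrightarrow> module R M \<and> fin_gen_submodule R M (carrier M)"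
  by (simp add: fin_gen_def fin_gen_submodule_def)

lemma noetherian_module_fin_gen: "noetherian_module R M \<Longrightarrow> fin_gen R M"
  by (simp add: noetherian_module_def fin_gen_iff module.carrier_is_submodule)

lemma image_span:
  assumes "module R M" "module R N" "f \<in> mod_hom R M N" "V \<subseteq> carrier M"
  shows "f ` submod_span R M V = submod_span R N (f ` V)"
proof
  have fV: "f ` V \<subseteq> carrier N" using assms(4) mod_hom_closed[OF assms(3)] by auto
  have "submod_span R M V \<subseteq> {x \<in> carrier M. f x \<in> submod_span R N (f ` V)}"
    by (rule submod_span_minimal[OF submodule_vimage[OF assms(1-3) submod_span_submodule[OF assms(2) fV]]])
      (use assms(4) submod_span_superset in fastforce)
  then show "f ` submod_span R M V \<subseteq> submod_span R N (f ` V)" by auto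
  show "submod_span R N (f ` V) \<subseteq> f ` submod_span R M V"
    by (rule submod_span_minimal[OF submodule_image[OF assms(1-3) submod_span_submodule[OF assms(1,4)]]])
      (intro image_mono submod_span_superset)
qed

lemma fin_gen_submodule_image:
  assumes "module R M" "module R N" "f \<in> mod_hom R M N" "fin_gen_submodule R M H"
  shows "fin_gen_submodule R N (f ` H)"
proof -
  obtain V where "finite V" "V \<subseteq> carrier M" "submod_span R M V = H"
    using assms(4) by (auto simp: fin_gen_submodule_def)
  then show ?thesis using image_span[OF assms(1-3), of V] mod_hom_closed[OF assms(3)]
    unfolding fin_gen_submodule_def by (intro exI[of _ "f ` V"]) auto
qed

lemma fin_gen_image:
  assumes "fin_gen R M" "module R N" "f \<in> mod_hom R M N" "f ` carrier M = carrier N"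
  shows "fin_gen R N"
  using assms fin_gen_submodule_image[of R M N f "carrier M"] by (auto simp: fin_gen_iff)

lemma noetherian_module_image:
  assumes "noetherian_module R M" "module R N" "f \<in> mod_hom R M N" "f ` carrier M = carrier N"
  shows "noetherian_module R N"
  unfolding noetherian_module_def
proof (intro conjI allI impI)
  have M: "module R M" using assms(1) by (simp add: noetherian_module_def)
  fix H assume H: "submodule H R N"
  let ?P = "{x \<in> carrier M. f x \<in> H}"
  have "submodule ?P R M" by (rule submodule_vimage[OF M assms(2,3) H])
  then have "fin_gen_submodule R M ?P" using assms(1) by (simp add: noetherian_module_def)
  from fin_gen_submodule_image[OF M assms(2,3) this]
  have "fin_gen_submodule R N (f ` ?P)" .
  moreover have "f ` ?P = H" using submodule_subset[OF H] assms(4) by auto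
  ultimately show "fin_gen_submodule R N H" by simp
qed fact

text \<open>
  If image and kernel of \<open>f\<close> on \<open>H\<close> are finitely generated, then so is \<open>H\<close>: lifts of generators of the
  image together with generators of the kernel generate, because any \<open>h \<in> H\<close> agrees under \<open>f\<close> with a
  combination of the lifts.
\<close>

lemma fin_gen_submodule_extension:
  assumes "module R M" "module R N" "f \<in> mod_hom R M N" "submodule H R M"
    "fin_gen_submodule R N (f ` H)" "fin_gen_submodule R M {x \<in> H. f x = \<zero>\<^bsub>N\<^esub>}"
  shows "fin_gen_submodule R M H"
proof -
  interpret M: module R M by fact
  obtain V where V: "finite V" "V \<subseteq> carrier N" "submod_span R N V = f ` H"
    using assms(5) by (auto simp: fin_gen_submodule_def)
  define K where "K = {x \<in> H. f x = \<zero>\<^bsub>N\<^esub>}"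
  obtain Y where Y: "finite Y" "Y \<subseteq> carrier M" "submod_span R M Y = K"
    using assms(6) unfolding fin_gen_submodule_def K_def by blast
  have Hc: "H \<subseteq> carrier M" by (rule submodule_subset[OF assms(4)])
  have "V \<subseteq> f ` H" using submod_span_superset[of V R N] V by simp
  then obtain W where W: "W \<subseteq> H" "finite W" "V = f ` W" using V(1) finite_subset_image by metis
  have XH: "Y \<subseteq> H" using submod_span_superset[of Y R M] Y(3) by (auto simp: K_def)
  have WX: "W \<union> Y \<subseteq> carrier M" using W XH Hc by auto
  let ?S = "submod_span R M (W \<union> Y)"
  have S: "submodule ?S R M" by (rule submod_span_submodule[OF assms(1) WX])
  have "?S = H"
  proof
    show "?S \<subseteq> H" by (rule submod_span_minimal[OF assms(4)]) (use W XH in auto)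
    show "H \<subseteq> ?S"
    proof
      fix h assume h: "h \<in> H"
      have "submod_span R N V \<subseteq> f ` ?S"
        by (rule submod_span_minimal[OF submodule_image[OF assms(1-3) S]])
          (use W(3) submod_span_superset[of "W \<union> Y" R M] in auto)
      then obtain w where w: "w \<in> ?S" "f h = f w" using V(3) h by auto
      have wH: "w \<in> H" using w(1) \<open>?S \<subseteq> H\<close> by auto
      have "f (h \<ominus>\<^bsub>M\<^esub> w) = \<zero>\<^bsub>N\<^esub>"
        using h wH Hc w(2) mod_hom_minus[OF assms(1-3), of h w] minus_eq_zero_iff[OF assms(2), of "f h" "f w"]
          mod_hom_closed[OF assms(3)] by auto
      then have "h \<ominus>\<^bsub>M\<^esub> w \<in> submod_span R M Y"
        using Y(3) submodule_minus[OF assms(4) h wH] by (simp add: K_def)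
      also have "\<dots> \<subseteq> ?S" by (rule submod_span_minimal[OF S]) (use submod_span_superset[of "W \<union> Y" R M] in auto)
      finally have "(h \<ominus>\<^bsub>M\<^esub> w) \<oplus>\<^bsub>M\<^esub> w \<in> ?S" using w(1) by (rule submodule_add[OF S])
      moreover have "(h \<ominus>\<^bsub>M\<^esub> w) \<oplus>\<^bsub>M\<^esub> w = h"
        using h wH Hc by (simp add: a_minus_def M.M.a_assoc M.M.l_neg subset_iff)
      ultimately show "h \<in> ?S" by simp
    qed
  qed
  then show ?thesis unfolding fin_gen_submodule_def using W Y WX by (intro exI[of _ "W \<union> Y"]) auto
qed

lemma zero_submodule:
  assumes "module R M"
  shows "submodule {\<zero>\<^bsub>M\<^esub>} R M"
proof -
  interpret M: module R M by fact
  show ?thesis by (rule submodule_criterion[OF assms]) auto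
qed

lemma submod_span_empty:
  assumes "module R M"
  shows "submod_span R M {} = {\<zero>\<^bsub>M\<^esub>}"
  using submod_span_minimal[OF zero_submodule[OF assms], of "{}"]
    submodule_zero[OF submod_span_submodule[OF assms, of "{}"]] by auto

text \<open>
  Induction on the number of maps: one map is split off by
  \<open>fin_gen_submodule_extension\<close>, and on its kernel the remaining maps are still jointly
  injective. With coordinate projections this shows that finite free modules over a
  noetherian ring are noetherian; with evaluations at generators it shows that homomorphism modules
  are finitely generated.
\<close>

lemma jointly_injective_fin_gen:
  assumes "module R M" "noetherian_module R N" "finite J"
    "\<And>j. j \<in> J \<Longrightarrow> \<phi> j \<in> mod_hom R M N" "submodule H R M"
    "\<And>x. x \<in> H \<Longrightarrow> (\<And>j. j \<in> J \<Longrightarrow> \<phi> j x = \<zero>\<^bsub>N\<^esub>) \<Longrightarrow> x = \<zero>\<^bsub>M\<^esub>"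
  shows "fin_gen_submodule R M H"
  using assms(3-6)
proof (induction J arbitrary: H rule: finite_induct)
  case empty
  have "x = \<zero>\<^bsub>M\<^esub>" if "x \<in> H" for x using empty(3)[OF that] by simp
  then have "H = {\<zero>\<^bsub>M\<^esub>}" using submodule_zero[OF empty(2)] by blast
  then show ?case using submod_span_empty[OF assms(1)] unfolding fin_gen_submodule_def
    by (intro exI[of _ "{}"]) auto
next
  case (insert j J)
  have N: "module R N" using assms(2) by (simp add: noetherian_module_def)
  have j: "\<phi> j \<in> mod_hom R M N" using insert.prems by simp
  let ?K = "{x \<in> H. \<phi> j x = \<zero>\<^bsub>N\<^esub>}"
  show ?case
  proof (rule fin_gen_submodule_extension[OF assms(1) N j insert.prems(2)])
    show "fin_gen_submodule R N (\<phi> j ` H)"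
      using assms(2) submodule_image[OF assms(1) N j insert.prems(2)] by (simp add: noetherian_module_def)
    show "fin_gen_submodule R M ?K"
    proof (rule insert.IH)
      have Hc: "H \<subseteq> carrier M" by (rule submodule_subset[OF insert.prems(2)])
      show "submodule ?K R M"
        by (rule submodule_criterion[OF assms(1)])
          (use Hc submodule_facts[OF insert.prems(2)] mod_hom_facts[OF j] mod_hom_zero[OF assms(1) N j]
            submodule_facts[OF zero_submodule[OF N]] in \<open>auto simp: subset_iff\<close>)
    qed (use insert.prems in auto)
  qed
qed

lemma self_module_sel [simp]:
  "carrier (self_module R) = carrier R" "\<zero>\<^bsub>self_module R\<^esub> = \<zero>\<^bsub>R\<^esub>"
  "x \<oplus>\<^bsub>self_module R\<^esub> y = x \<oplus>\<^bsub>R\<^esub> y" "a \<odot>\<^bsub>self_module R\<^esub> x = a \<otimes>\<^bsub>R\<^esub> x"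
  by (simp_all add: self_module_def)

lemma self_module_module:
  assumes "cring R"
  shows "module R (self_module R)"
proof -
  interpret R: cring R by fact
  show ?thesis
  proof (rule moduleI)
    show "abelian_group (self_module R)"
      by (rule abelian_groupI) (auto simp: R.a_ac intro: R.l_neg bexI[of _ "\<ominus>\<^bsub>R\<^esub> _"])
  qed (auto simp: assms R.m_assoc R.l_distr R.r_distr)
qed

text \<open>
  The bridge from noetherian rings, which are defined by ideals, to noetherian modules.
\<close>

lemma submodule_self_module_iff:
  fixes R :: "'a ring"
  assumes "cring R"
  shows "submodule I R (self_module R) \<longleftrightarrow> ideal I R"
proof -
  interpret R: cring R by fact
  show ?thesis
  proof
    assume I: "submodule I R (self_module R)"
    show "ideal I R"
    proof (rule idealI)
      show "subgroup I (add_monoid R)"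
      proof (rule R.add.subgroupI)
        fix x assume x: "x \<in> I"
        have "(\<ominus>\<^bsub>R\<^esub> \<one>\<^bsub>R\<^esub>) \<otimes>\<^bsub>R\<^esub> x \<in> I"
          using submodule_smult[OF I, of "\<ominus>\<^bsub>R\<^esub> \<one>\<^bsub>R\<^esub>" x] x by simp
        then show "\<ominus>\<^bsub>R\<^esub> x \<in> I"
          using x submodule_subset[OF I] by (simp add: R.l_minus subset_iff)
      qed (use submodule_facts[OF I] in auto)
      fix a x assume "a \<in> I" "x \<in> carrier R"
      then show "x \<otimes>\<^bsub>R\<^esub> a \<in> I" "a \<otimes>\<^bsub>R\<^esub> x \<in> I"
        using submodule_smult[OF I, of x a] submodule_subset[OF I] by (auto simp: R.m_comm subset_iff)
    qed (rule R.ring_axioms)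
  next
    assume I: "ideal I R"
    interpret I: ideal I R by fact
    show "submodule I R (self_module R)"
      by (rule submodule_criterion[OF self_module_module[OF assms]])
        (auto simp: I.a_subset[THEN subsetD] I.I_l_closed)
  qed
qed

lemma self_module_noetherian:
  fixes R :: "'a ring"
  assumes "cring R" "noetherian_ring R"
  shows "noetherian_module R (self_module R)"
  unfolding noetherian_module_def
proof (intro conjI allI impI)
  interpret R: cring R by fact
  fix H assume "submodule H R (self_module R)"
  then have "ideal H R" by (simp add: submodule_self_module_iff[OF assms(1)])
  then obtain A where A: "A \<subseteq> carrier R" "finite A" "H = Idl\<^bsub>R\<^esub> A"
    using noetherian_ring.finetely_gen[OF assms(2)] by blast
  have "submod_span R (self_module R) A = Idl\<^bsub>R\<^esub> A"
    by (simp add: submod_span_def genideal_def submodule_self_module_iff[OF assms(1)])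
  then show "fin_gen_submodule R (self_module R) H"
    using A unfolding fin_gen_submodule_def by (intro exI[of _ A]) auto
qed (rule self_module_module[OF assms(1)])

lemma free_module_noetherian:
  fixes R :: "'a ring"
  assumes "cring R" "noetherian_ring R" "finite I"
  shows "noetherian_module R (free_module R I)"
  unfolding noetherian_module_def
proof (intro conjI allI impI)
  fix H assume H: "submodule H R (free_module R I)"
  show "fin_gen_submodule R (free_module R I) H"
  proof (rule jointly_injective_fin_gen[OF free_module_module[OF assms(1)] self_module_noetherian[OF assms(1,2)]
        assms(3) _ H, where \<phi> = "\<lambda>i f. f i"])
    fix i assume "i \<in> I"
    then show "(\<lambda>f. f i) \<in> mod_hom R (free_module R I) (self_module R)"
      by (intro mod_homI) (auto simp: free_module_carrier_iff)
  next
    fix f assume "f \<in> H" "\<And>i. i \<in> I \<Longrightarrow> f i = \<zero>\<^bsub>self_module R\<^esub>"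
    then show "f = \<zero>\<^bsub>free_module R I\<^esub>"
      using submodule_subset[OF H] by (auto simp: free_module_carrier_iff extensional_def fun_eq_iff)
  qed
qed (rule free_module_module[OF assms(1)])

lemma free_cover:
  assumes "module R M" "fin_gen_submodule R M H"
  obtains n :: nat and f where "f \<in> mod_hom R (free_module R {..<n}) M"
    "f ` carrier (free_module R {..<n}) = H"
proof -
  interpret M: module R M by fact
  obtain V where V: "finite V" "V \<subseteq> carrier M" "submod_span R M V = H"
    using assms(2) by (auto simp: fin_gen_submodule_def)
  obtain v and n :: nat where v: "V = v ` {..<n}" 
    using finite_imp_nat_seg_image_inj_on[OF V(1)] by (metis lessThan_def)
  let ?F = "free_module R {..<n}"
  have F: "module R ?F" by (rule free_module_module[OF M.R.is_cring])
  obtain f where f: "f \<in> mod_hom R ?F M" "\<And>i. i \<in> {..<n} \<Longrightarrow> f (free_gen R {..<n} i) = v i"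
    using free_module_lift[OF assms(1), of "{..<n}" v] V v by blast
  let ?E = "free_gen R {..<n} ` {..<n}"
  have E: "?E \<subseteq> carrier ?F" using free_gen_closed[OF M.R.is_cring, of "{..<n}"] by auto
  have "submod_span R ?F ?E = carrier ?F"
    by (rule free_module_generation[OF M.R.is_cring submod_span_submodule[OF F E]])
      (use submod_span_superset in fastforce)
  moreover have "f ` ?E = V" using f(2) v by (auto simp: image_image)
  ultimately have "f ` carrier ?F = H" using image_span[OF F assms(1) f(1) E] V(3) by simp
  then show thesis using f(1) that by blast
qed

lemma fin_gen_noetherian:
  fixes R :: "'a ring"
  assumes "noetherian_ring R" "fin_gen R M"
  shows "noetherian_module R M"
proof -
  have M: "module R M" using assms(2) by (simp add: fin_gen_iff)
  obtain n :: nat and f where "f \<in> mod_hom R (free_module R {..<n}) M"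
    "f ` carrier (free_module R {..<n}) = carrier M"
    using free_cover[OF M, of "carrier M"] assms(2) unfolding fin_gen_iff by metis
  then show ?thesis
    using noetherian_module_image[OF free_module_noetherian[OF module.axioms(1)[OF M] assms(1)] M] by blast
qed

text \<open>
  A linear map is determined by its values on a finite set \<open>U\<close> of generators, so the evaluations at
  the elements of \<open>U\<close> are jointly injective.
\<close>

lemma fin_gen_hom_module:
  fixes R :: "'a ring"
  assumes "noetherian_ring R" "fin_gen R M" "fin_gen R N"
  shows "fin_gen R (hom_module R M N)"
proof -
  have M: "module R M" and N: "module R N" using assms by (simp_all add: fin_gen_iff)
  obtain U where U: "finite U" "U \<subseteq> carrier M" "submod_span R M U = carrier M"
    using assms(2) by (auto simp: fin_gen_def)
  note H = hom_module_module[OF M N]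
  have "fin_gen_submodule R (hom_module R M N) (carrier (hom_module R M N))"
  proof (rule jointly_injective_fin_gen[OF H fin_gen_noetherian[OF assms(1,3)] U(1) _ module.carrier_is_submodule[OF H],
        where \<phi> = "\<lambda>u f. f u"])
    fix u assume "u \<in> U"
    then show "(\<lambda>f. f u) \<in> mod_hom R (hom_module R M N) N" using U(2) by (intro evaluation_hom) auto
  next
    fix f assume f: "f \<in> carrier (hom_module R M N)" "\<And>u. u \<in> U \<Longrightarrow> f u = \<zero>\<^bsub>N\<^esub>"
    have fh: "f \<in> mod_hom R M N" using f by (simp add: hom_module_carrier_iff)
    have "submod_span R M U \<subseteq> a_kernel M N f"
      by (rule submod_span_minimal[OF submodule_kernel[OF M N fh]]) (use U f in \<open>auto simp: a_kernel_eq\<close>)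
    then show "f = \<zero>\<^bsub>hom_module R M N\<^esub>"
      using U(3) f by (intro extensionalityI[of _ "carrier M"]) (auto simp: a_kernel_eq hom_module_carrier_iff)
  qed
  then show ?thesis using H by (simp add: fin_gen_iff)
qed

lemma fin_gen_tensor:
  assumes "fin_gen R M" "fin_gen R N"
  shows "fin_gen R (tensor R M N)"
proof -
  have M: "module R M" and N: "module R N" using assms by (simp_all add: fin_gen_iff)
  note T = tensor_module[OF M N]
  obtain U where U: "finite U" "U \<subseteq> carrier M" "submod_span R M U = carrier M"
    using assms(1) by (auto simp: fin_gen_def)
  obtain V where V: "finite V" "V \<subseteq> carrier N" "submod_span R N V = carrier N"
    using assms(2) by (auto simp: fin_gen_def)
  let ?W = "(\<lambda>(u, v). pure_tensor R M N u v) ` (U \<times> V)"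
  have W: "?W \<subseteq> carrier (tensor R M N)" using U V by (auto intro!: pure_tensor_closed[OF M N])
  let ?S = "submod_span R (tensor R M N) ?W"
  have S: "submodule ?S R (tensor R M N)" by (rule submod_span_submodule[OF T W])
  have 1: "pure_tensor R M N u y \<in> ?S" if u: "u \<in> U" and y: "y \<in> carrier N" for u y
  proof -
    have uc: "u \<in> carrier M" using u U by auto
    have "submod_span R N V \<subseteq> {y \<in> carrier N. pure_tensor R M N u y \<in> ?S}"
      by (rule submod_span_minimal[OF submodule_vimage[OF N T pure_tensor_right_hom[OF M N uc] S]])
        (use V u submod_span_superset[of ?W R "tensor R M N"] in auto)
    then show ?thesis using V y by auto
  qed
  have 2: "pure_tensor R M N x y \<in> ?S" if x: "x \<in> carrier M" and y: "y \<in> carrier N" for x y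
  proof -
    have "submod_span R M U \<subseteq> {x \<in> carrier M. pure_tensor R M N x y \<in> ?S}"
      by (rule submod_span_minimal[OF submodule_vimage[OF M T pure_tensor_left_hom[OF M N y] S]])
        (use U 1 y in auto)
    then show ?thesis using U x by auto
  qed
  have "?S = carrier (tensor R M N)" by (rule tensor_generation[OF M N S 2])
  then show ?thesis using U V W T unfolding fin_gen_def by (intro conjI exI[of _ ?W]) auto
qed

text \<open>
  By the first isomorphism theorem, \<open>M\<close> is a quotient of a free module on \<open>{..<n}\<close>. This moves tensor products
  and homomorphism modules back into the type in which finitely generated modules are sought.
\<close>

lemma coset_copy:
  fixes R :: "'a ring"
  assumes "fin_gen R M"
  obtains N :: "'a coset_module" and \<theta> where "module R N" "\<theta> \<in> mod_iso R M N"
proof -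
  have M: "module R M" using assms by (simp add: fin_gen_iff)
  have cr: "cring R" by (rule module.axioms(1)[OF M])
  obtain n :: nat and f where f: "f \<in> mod_hom R (free_module R {..<n}) M"
    "f ` carrier (free_module R {..<n}) = carrier M"
    using free_cover[OF M, of "carrier M"] assms unfolding fin_gen_iff by metis
  let ?F = "free_module R {..<n}"
  let ?K = "a_kernel ?F M f"
  note F = free_module_module[OF cr, of "{..<n}"]
  note K = submodule_kernel[OF F M f(1)]
  have kz: "f x = \<zero>\<^bsub>M\<^esub>" if "x \<in> ?K" for x using that by (simp add: a_kernel_eq)
  obtain g where g: "g \<in> mod_hom R (quot_module ?F ?K) M" "\<And>x. x \<in> carrier ?F \<Longrightarrow> g (?K +>\<^bsub>?F\<^esub> x) = f x"
    using quot_module_lift[OF F K M f(1) kz] by blast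
  note Q = quot_module_module[OF F K]
  have "inj_on g (carrier (quot_module ?F ?K))"
    by (subst inj_on_mod_hom_iff[OF Q M g(1)], unfold quot_module_carrier quot_module_zero)
      (use g(2) coset_eq_submodule_iff[OF F K] in \<open>simp add: a_kernel_eq\<close>)
  moreover have "g ` carrier (quot_module ?F ?K) = carrier M"
    using f(2) g(2) by (simp add: quot_module_carrier image_image cong: image_cong_simp)
  ultimately have iso: "g \<in> mod_iso R (quot_module ?F ?K) M" using g(1) by (simp add: mod_iso_def bij_betw_def)
  obtain h where "h \<in> mod_iso R M (quot_module ?F ?K)" by (rule mod_iso_inverse[OF Q iso])
  then show thesis by (rule that[OF Q])
qed

section \<open>Free resolutions\<close>

text \<open>
  The resolution is built by dependent choice. A state of the recursion consists of the ranks of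
  source and target of a differential and the differential itself; its kernel is finitely generated,
  hence covered by a finite free module, and this gives the next state.
\<close>

lemma free_resolution_exists:
  fixes R :: "'a ring"
  assumes "noetherian_ring R" "fin_gen R N"
  obtains b d \<epsilon> where "free_resolution R N b d \<epsilon>"
proof -
  have N: "module R N" using assms by (simp add: fin_gen_iff)
  have cr: "cring R" by (rule module.axioms(1)[OF N])
  define F where "F n = free_module R {..<n::nat}" for n
  have F: "module R (F n)" for n unfolding F_def by (rule free_module_module[OF cr])
  have noe: "noetherian_module R (F n)" for n unfolding F_def
    by (rule free_module_noetherian[OF cr assms(1)]) simp
  have cover: "\<exists>m h. h \<in> mod_hom R (F m) (F n) \<and> h ` carrier (F m) = K" if "submodule K R (F n)" for n K
    using noe[of n] that free_cover[OF F, of n K] unfolding noetherian_module_def F_def by metis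
  obtain n0 :: nat and \<epsilon> where e: "\<epsilon> \<in> mod_hom R (F n0) N" "\<epsilon> ` carrier (F n0) = carrier N"
    using free_cover[OF N] assms(2) unfolding F_def fin_gen_iff by metis
  \<comment> \<open>A state \<open>(n, m, h)\<close> is a differential \<open>h\<close> from rank \<open>m\<close> to rank \<open>n\<close>; stage \<open>0\<close> also covers the kernel of \<open>\<epsilon>\<close>.\<close>
  define P where "P = (\<lambda>(i::nat) (s :: nat \<times> nat \<times> ((nat \<Rightarrow> 'a) \<Rightarrow> nat \<Rightarrow> 'a)).
    case s of (n, m, h) \<Rightarrow> h \<in> mod_hom R (F m) (F n) \<and>
      (i = 0 \<longrightarrow> n = n0 \<and> h ` carrier (F m) = a_kernel (F n0) N \<epsilon>))"
  define Q where "Q = (\<lambda>(i::nat) (s :: nat \<times> nat \<times> ((nat \<Rightarrow> 'a) \<Rightarrow> nat \<Rightarrow> 'a)) (t :: nat \<times> nat \<times> ((nat \<Rightarrow> 'a) \<Rightarrow> nat \<Rightarrow> 'a)).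
    case s of (n, m, h) \<Rightarrow> case t of (n', m', h') \<Rightarrow> n' = m \<and> h' ` carrier (F m') = a_kernel (F m) (F n) h)"
  obtain s where s: "\<And>i. P i (s i)" "\<And>i. Q i (s i) (s (Suc i))"
  proof (rule dependent_nat_choice[of P Q, THEN exE])
    show "\<exists>x. P 0 x"
      using cover[OF submodule_kernel[OF F N e(1)]] unfolding P_def by auto
    fix x i assume "P i x"
    then obtain n m h where x: "x = (n, m, h)" "h \<in> mod_hom R (F m) (F n)"
      unfolding P_def by (cases x) auto
    from cover[OF submodule_kernel[OF F F x(2)]]
    show "\<exists>y. P (Suc i) y \<and> Q i x y" unfolding P_def Q_def x by auto
  qed (use that in blast)
  define b where "b i = fst (s i)" for i
  define d where "d i = snd (snd (s i))" for i
  have b1: "fst (snd (s i)) = b (Suc i)" for i using s(2)[of i] unfolding Q_def b_def by (auto split: prod.splits)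
  have d: "d i \<in> mod_hom R (F (b (Suc i))) (F (b i))" for i
    using s(1)[of i] unfolding P_def b1[symmetric] unfolding b_def d_def by (auto split: prod.splits)
  have 0: "b 0 = n0" "d 0 ` carrier (F (b (Suc 0))) = a_kernel (F n0) N \<epsilon>"
    using s(1)[of 0] unfolding P_def b1[symmetric] unfolding b_def d_def by (auto split: prod.splits)
  have ex: "d (Suc i) ` carrier (F (b (Suc (Suc i)))) = a_kernel (F (b (Suc i))) (F (b i)) (d i)" for i
    using s(2)[of i] unfolding Q_def b1[of "Suc i", symmetric] b1[of i, symmetric] unfolding b_def d_def
    by (auto split: prod.splits)
  have "free_resolution R N b d \<epsilon>"
    unfolding free_resolution_def Let_def F_def[symmetric] using e d 0 ex by auto
  then show thesis by (rule that)
qed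

lemma some_resolution_props:
  fixes R :: "'a ring"
  assumes "noetherian_ring R" "fin_gen R N"
  obtains b d \<epsilon> where "some_resolution R N = (b, d)" "free_resolution R N b d \<epsilon>"
proof -
  have "\<exists>p. case p of (b, d) \<Rightarrow> \<exists>\<epsilon>. free_resolution R N b d \<epsilon>"
    using free_resolution_exists[OF assms] by (metis case_prod_conv)
  from someI_ex[OF this] show thesis
    unfolding some_resolution_def[symmetric] using that by (auto split: prod.splits)
qed

section \<open>Invariance of Tor and Ext\<close>

text \<open>
  Turns the vanishing of homology into an inclusion of submodules, which a diagram chase can transfer.
\<close>

lemma subquotient_zero_iff:
  assumes "module R C" "submodule Z R C" "submodule B R C"
  shows "zero_module (quot_module (C\<lparr>carrier := Z\<rparr>) B) \<longleftrightarrow> Z \<subseteq> B"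
proof -
  have coset: "B +>\<^bsub>C\<lparr>carrier := Z\<rparr>\<^esub> z = B +>\<^bsub>C\<^esub> z" for z
    by (simp add: a_r_coset_def r_coset_def)
  have "zero_module (quot_module (C\<lparr>carrier := Z\<rparr>) B) \<longleftrightarrow> (\<forall>z\<in>Z. B +>\<^bsub>C\<^esub> z = B)"
    using submodule_zero[OF assms(2)]
    by (auto simp: zero_module_def quot_module_carrier quot_module_zero coset)
  also have "\<dots> \<longleftrightarrow> Z \<subseteq> B"
    using coset_eq_submodule_iff[OF assms(1,3)] submodule_subset[OF assms(2)] by auto
  finally show ?thesis .
qed

text \<open>
  A diagram chase in an isomorphism between two three-term sequences.
\<close>

lemma exactness_transfer:
  assumes "module R C" "module R C'" "module R B" "\<alpha> \<in> mod_iso R A A'" "\<beta> \<in> mod_iso R B B'" "\<gamma> \<in> mod_iso R C C'"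
    and f: "\<And>x. x \<in> carrier A \<Longrightarrow> f x \<in> carrier B" "\<And>x. x \<in> carrier A \<Longrightarrow> \<beta> (f x) = f' (\<alpha> x)"
    and g: "\<And>y. y \<in> carrier B \<Longrightarrow> g y \<in> carrier C" "\<And>y. y \<in> carrier B \<Longrightarrow> \<gamma> (g y) = g' (\<beta> y)"
    and exact: "a_kernel B C g \<subseteq> f ` carrier A"
  shows "a_kernel B' C' g' \<subseteq> f' ` carrier A'"
proof
  fix y' assume "y' \<in> a_kernel B' C' g'"
  then have y': "y' \<in> carrier B'" "g' y' = \<zero>\<^bsub>C'\<^esub>" by (auto simp: a_kernel_eq)
  have bij: "bij_betw \<alpha> (carrier A) (carrier A')" "bij_betw \<beta> (carrier B) (carrier B')"
    "bij_betw \<gamma> (carrier C) (carrier C')"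
    using assms(4-6) by (auto simp: mod_iso_def)
  obtain y where y: "y \<in> carrier B" "y' = \<beta> y" using bij(2) y'(1) by (auto simp: bij_betw_def)
  have C: "\<gamma> \<in> mod_hom R C C'" using assms(6) by (simp add: mod_iso_def)
  have "\<gamma> (g y) = \<zero>\<^bsub>C'\<^esub>" using y y' g by simp
  then have "g y = \<zero>\<^bsub>C\<^esub>"
    using bij(3) inj_on_mod_hom_iff[OF assms(1,2) C] g(1)[OF y(1)] by (auto simp: bij_betw_def)
  then obtain x where x: "x \<in> carrier A" "y = f x" using y exact by (auto simp: a_kernel_eq)
  then have "y' = f' (\<alpha> x)" using y f by simp
  moreover have "\<alpha> x \<in> carrier A'" using bij(1) x by (auto simp: bij_betw_def)
  ultimately show "y' \<in> f' ` carrier A'" by auto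
qed

lemma tor_Suc_zero_iff:
  assumes "module R M" "some_resolution R N = (b, d)"
    "\<And>i. d i \<in> mod_hom R (free_module R {..<b (Suc i)}) (free_module R {..<b i})"
  defines "C \<equiv> \<lambda>i. tensor R (free_module R {..<b i}) M"
  defines "D \<equiv> \<lambda>i. tensor_map_left R (free_module R {..<b (Suc i)}) (free_module R {..<b i}) M (d i)"
  shows "zero_module (tor R (Suc j) N M) \<longleftrightarrow>
    a_kernel (C (Suc j)) (C j) (D j) \<subseteq> D (Suc j) ` carrier (C (Suc (Suc j)))"
proof -
  note F = free_module_module[OF module.axioms(1)[OF assms(1)]]
  have C: "module R (C i)" for i unfolding C_def by (rule tensor_module[OF F assms(1)])
  have D: "D i \<in> mod_hom R (C (Suc i)) (C i)" for i
    unfolding C_def D_def by (rule tensor_map_left_hom[OF F assms(1) F assms(1) F F assms(1) assms(3)])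
  have "tor R (Suc j) N M = quot_module ((C (Suc j))\<lparr>carrier := a_kernel (C (Suc j)) (C j) (D j)\<rparr>)
      (D (Suc j) ` carrier (C (Suc (Suc j))))"
    by (simp add: tor_def assms(2) C_def D_def)
  then show ?thesis
    using subquotient_zero_iff[OF C submodule_kernel[OF C C D]
        submodule_image[OF C C D module.carrier_is_submodule[OF C]]] by simp
qed

text \<open>
  Tor is computed from one fixed resolution of \<open>N\<close>, so an isomorphism of the second argument
  induces an isomorphism between the two complexes.
\<close>

lemma tor_zero_cong:
  fixes R :: "'a ring"
  assumes "noetherian_ring R" "fin_gen R N" "module R M" "module R M'" "g \<in> mod_iso R M M'"
    "zero_module (tor R (Suc j) N M)"
  shows "zero_module (tor R (Suc j) N M')"
proof -
  obtain b d \<epsilon> where r: "some_resolution R N = (b, d)" "free_resolution R N b d \<epsilon>"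
    using some_resolution_props[OF assms(1,2)] by blast
  define F where "F i = free_module R {..<b i}" for i
  have d: "d i \<in> mod_hom R (F (Suc i)) (F i)" for i
    using r(2) by (simp add: free_resolution_def Let_def F_def)
  have F: "module R (F i)" for i unfolding F_def
    by (rule free_module_module[OF module.axioms(1)[OF assms(3)]])
  have gc: "g y \<in> carrier M'" if "y \<in> carrier M" for y
    using assms(5) that by (auto simp: mod_iso_def mod_hom_closed)
  define G where "G i = (SOME G. G \<in> mod_iso R (tensor R (F i) M) (tensor R (F i) M') \<and>
    (\<forall>x\<in>carrier (F i). \<forall>y\<in>carrier M. G (pure_tensor R (F i) M x y) = pure_tensor R (F i) M' x (g y)))" for i
  have "\<exists>G. G \<in> mod_iso R (tensor R (F i) M) (tensor R (F i) M') \<and>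
    (\<forall>x\<in>carrier (F i). \<forall>y\<in>carrier M. G (pure_tensor R (F i) M x y) = pure_tensor R (F i) M' x (g y))" for i
    by (rule tensor_iso_right[OF F[of i] assms(3-5)]) blast
  from someI_ex[OF this]
  have "G i \<in> mod_iso R (tensor R (F i) M) (tensor R (F i) M') \<and>
    (\<forall>x\<in>carrier (F i). \<forall>y\<in>carrier M. G i (pure_tensor R (F i) M x y) = pure_tensor R (F i) M' x (g y))" for i
    unfolding G_def .
  then have G: "G i \<in> mod_iso R (tensor R (F i) M) (tensor R (F i) M')"
    "\<And>x y. x \<in> carrier (F i) \<Longrightarrow> y \<in> carrier M \<Longrightarrow> G i (pure_tensor R (F i) M x y) = pure_tensor R (F i) M' x (g y)"
    for i by auto
  have Gh: "G i \<in> mod_hom R (tensor R (F i) M) (tensor R (F i) M')" for i using G(1) by (simp add: mod_iso_def)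
  let ?D = "\<lambda>i. tensor_map_left R (F (Suc i)) (F i) M (d i)"
  let ?D' = "\<lambda>i. tensor_map_left R (F (Suc i)) (F i) M' (d i)"
  have D: "?D i \<in> mod_hom R (tensor R (F (Suc i)) M) (tensor R (F i) M)" for i
    by (rule tensor_map_left_hom[OF F assms(3) F assms(3) F F assms(3) d])
  have D': "?D' i \<in> mod_hom R (tensor R (F (Suc i)) M') (tensor R (F i) M')" for i
    by (rule tensor_map_left_hom[OF F assms(4) F assms(4) F F assms(4) d])
  have comm: "G i (?D i t) = ?D' i (G (Suc i) t)" if "t \<in> carrier (tensor R (F (Suc i)) M)" for i t
    by (rule tensor_hom_eqI[OF F assms(3) tensor_module[OF F assms(4)]
          mod_hom_compose[OF D Gh] mod_hom_compose[OF Gh D'] _ that])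
      (simp add: G(2) gc mod_hom_closed[OF d]
        tensor_map_left_pure[OF F assms(3) F assms(3) F F assms(3) d]
        tensor_map_left_pure[OF F assms(4) F assms(4) F F assms(4) d])
  have "a_kernel (tensor R (F (Suc j)) M) (tensor R (F j) M) (?D j)
      \<subseteq> ?D (Suc j) ` carrier (tensor R (F (Suc (Suc j))) M)"
    using tor_Suc_zero_iff[OF assms(3) r(1) d[unfolded F_def], of j] assms(6) unfolding F_def by blast
  from exactness_transfer[OF tensor_module[OF F assms(3)] tensor_module[OF F assms(4)] tensor_module[OF F assms(3)]
      G(1) G(1) G(1) mod_hom_closed[OF D] comm mod_hom_closed[OF D] comm this]
  show ?thesis
    using tor_Suc_zero_iff[OF assms(4) r(1) d[unfolded F_def], of j] unfolding F_def by blast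
qed

lemma precompose_hom:
  assumes "module R L" "d \<in> mod_hom R L M"
  shows "(\<lambda>f. \<lambda>u\<in>carrier L. f (d u)) \<in> mod_hom R (hom_module R M N) (hom_module R L N)"
proof (rule mod_homI)
  fix f assume "f \<in> carrier (hom_module R M N)"
  then show "(\<lambda>u\<in>carrier L. f (d u)) \<in> carrier (hom_module R L N)"
    by (intro hom_moduleI[OF assms(1)] mod_hom_compose[OF assms(2)]) (simp add: hom_module_carrier_iff)
qed (auto intro!: restrict_ext simp: mod_hom_closed[OF assms(2)])

lemma ext_Suc_zero_iff:
  assumes "module R M" "some_resolution R N = (b, d)"
    "\<And>i. d i \<in> mod_hom R (free_module R {..<b (Suc i)}) (free_module R {..<b i})"
  defines "C \<equiv> \<lambda>i. hom_module R (free_module R {..<b i}) M"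
  defines "\<delta> \<equiv> \<lambda>i f. \<lambda>u\<in>carrier (free_module R {..<b (Suc i)}). f (d i u)"
  shows "zero_module (ext R (Suc j) N M) \<longleftrightarrow>
    a_kernel (C (Suc j)) (C (Suc (Suc j))) (\<delta> (Suc j)) \<subseteq> \<delta> j ` carrier (C j)"
proof -
  note F = free_module_module[OF module.axioms(1)[OF assms(1)]]
  have C: "module R (C i)" for i unfolding C_def by (rule hom_module_module[OF F assms(1)])
  have D: "\<delta> i \<in> mod_hom R (C i) (C (Suc i))" for i
    unfolding C_def \<delta>_def by (rule precompose_hom[OF F assms(3)])
  have "ext R (Suc j) N M =
      quot_module ((C (Suc j))\<lparr>carrier := a_kernel (C (Suc j)) (C (Suc (Suc j))) (\<delta> (Suc j))\<rparr>) (\<delta> j ` carrier (C j))"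
    by (simp add: ext_def assms(2) C_def \<delta>_def)
  then show ?thesis
    using subquotient_zero_iff[OF C submodule_kernel[OF C C D]
        submodule_image[OF C C D module.carrier_is_submodule[OF C]]] by simp
qed

text \<open>
  Composition with \<open>g\<close> commutes with the differentials, which act by composition on the other side.
\<close>

lemma ext_zero_cong:
  fixes R :: "'a ring"
  assumes "noetherian_ring R" "fin_gen R N" "module R M" "module R M'" "g \<in> mod_iso R M M'"
    "zero_module (ext R (Suc j) N M)"
  shows "zero_module (ext R (Suc j) N M')"
proof -
  obtain b d \<epsilon> where r: "some_resolution R N = (b, d)" "free_resolution R N b d \<epsilon>"
    using some_resolution_props[OF assms(1,2)] by blast
  define F where "F i = free_module R {..<b i}" for i
  have d: "d i \<in> mod_hom R (F (Suc i)) (F i)" for i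
    using r(2) by (simp add: free_resolution_def Let_def F_def)
  have F: "module R (F i)" for i unfolding F_def
    by (rule free_module_module[OF module.axioms(1)[OF assms(3)]])
  let ?\<delta> = "\<lambda>i f. \<lambda>u\<in>carrier (F (Suc i)). f (d i u)"
  have cl: "?\<delta> i f \<in> carrier (hom_module R (F (Suc i)) M)" if "f \<in> carrier (hom_module R (F i) M)" for i f
    by (rule mod_hom_closed[OF precompose_hom[OF F d] that])
  let ?G = "\<lambda>i f. \<lambda>x\<in>carrier (F i). g (f x)"
  have comm: "?G (Suc i) (?\<delta> i f) = ?\<delta> i (?G i f)" for i f
    by (auto intro!: restrict_ext simp: mod_hom_closed[OF d])
  note H = hom_module_module[OF F assms(3)] and H' = hom_module_module[OF F assms(4)]
  have "a_kernel (hom_module R (F (Suc j)) M) (hom_module R (F (Suc (Suc j))) M) (?\<delta> (Suc j))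
      \<subseteq> ?\<delta> j ` carrier (hom_module R (F j) M)"
    using ext_Suc_zero_iff[OF assms(3) r(1) d[unfolded F_def], of j] assms(6) unfolding F_def by blast
  from exactness_transfer[where f = "?\<delta> j" and g = "?\<delta> (Suc j)" and \<alpha> = "?G j" and \<beta> = "?G (Suc j)"
      and \<gamma> = "?G (Suc (Suc j))" and f' = "?\<delta> j" and g' = "?\<delta> (Suc j)",
      OF H H' H postcompose_iso[OF F assms(3,5)]
      postcompose_iso[OF F assms(3,5)] postcompose_iso[OF F assms(3,5)] cl comm cl comm this]
  show ?thesis
    using ext_Suc_zero_iff[OF assms(4) r(1) d[unfolded F_def], of j] unfolding F_def by blast
qed

section \<open>Annihilators\<close>

lemma ideal_smult_zero_iff:
  assumes "module R M" "I \<subseteq> carrier R"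
  shows "ideal_smult R I M = {\<zero>\<^bsub>M\<^esub>} \<longleftrightarrow> (\<forall>a\<in>I. \<forall>x\<in>carrier M. a \<odot>\<^bsub>M\<^esub> x = \<zero>\<^bsub>M\<^esub>)"
proof -
  interpret M: module R M by fact
  let ?U = "{a \<odot>\<^bsub>M\<^esub> x | a x. a \<in> I \<and> x \<in> carrier M}"
  have "submod_span R M ?U = {\<zero>\<^bsub>M\<^esub>} \<longleftrightarrow> ?U \<subseteq> {\<zero>\<^bsub>M\<^esub>}"
  proof
    assume "submod_span R M ?U = {\<zero>\<^bsub>M\<^esub>}"
    then show "?U \<subseteq> {\<zero>\<^bsub>M\<^esub>}" using submod_span_superset[of ?U R M] by (simp only:)
  next
    assume U: "?U \<subseteq> {\<zero>\<^bsub>M\<^esub>}"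
    have "?U \<subseteq> carrier M" using assms(2) by auto
    then show "submod_span R M ?U = {\<zero>\<^bsub>M\<^esub>}"
      using submod_span_minimal[OF zero_submodule[OF assms(1)] U]
        submodule_zero[OF submod_span_submodule[OF assms(1), of ?U]] by blast
  qed
  also have "\<dots> \<longleftrightarrow> (\<forall>a\<in>I. \<forall>x\<in>carrier M. a \<odot>\<^bsub>M\<^esub> x = \<zero>\<^bsub>M\<^esub>)"
    unfolding subset_iff mem_Collect_eq singleton_iff by metis
  finally show ?thesis unfolding ideal_smult_def .
qed

lemma annihilated_submodule:
  fixes R :: "'a ring" and M :: "('a, 'm) module"
  assumes "module R M" "a \<in> carrier R"
  shows "submodule {x \<in> carrier M. a \<odot>\<^bsub>M\<^esub> x = \<zero>\<^bsub>M\<^esub>} R M"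
proof -
  interpret M: module R M by fact
  have "(\<lambda>x. a \<odot>\<^bsub>M\<^esub> x) \<in> mod_hom R M M"
    by (rule mod_homI) (auto simp: assms(2) M.smult_r_distr M.smult_assoc1[symmetric] M.R.m_comm)
  from submodule_kernel[OF assms(1,1) this] show ?thesis by (simp add: a_kernel_eq)
qed

lemma annihilates_image:
  assumes "module R M" "module R N" "f \<in> mod_hom R M N" "f ` carrier M = carrier N" "a \<in> carrier R"
    "\<And>x. x \<in> carrier M \<Longrightarrow> a \<odot>\<^bsub>M\<^esub> x = \<zero>\<^bsub>M\<^esub>" "y \<in> carrier N"
  shows "a \<odot>\<^bsub>N\<^esub> y = \<zero>\<^bsub>N\<^esub>"
proof -
  obtain x where "x \<in> carrier M" "y = f x" using assms(4,7) by auto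
  then show ?thesis
    using mod_hom_smult[OF assms(3,5), of x] assms(6) mod_hom_zero[OF assms(1-3)] by simp
qed

lemma annihilates_tensor:
  assumes "module R M" "module R N" "a \<in> carrier R"
    "\<And>y. y \<in> carrier N \<Longrightarrow> a \<odot>\<^bsub>N\<^esub> y = \<zero>\<^bsub>N\<^esub>" "t \<in> carrier (tensor R M N)"
  shows "a \<odot>\<^bsub>tensor R M N\<^esub> t = \<zero>\<^bsub>tensor R M N\<^esub>"
proof -
  let ?T = "tensor R M N"
  note T = tensor_module[OF assms(1,2)]
  have "{t \<in> carrier ?T. a \<odot>\<^bsub>?T\<^esub> t = \<zero>\<^bsub>?T\<^esub>} = carrier ?T"
  proof (rule tensor_generation[OF assms(1,2) annihilated_submodule[OF T assms(3)]])
    fix x y assume xy: "x \<in> carrier M" "y \<in> carrier N"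
    have "a \<odot>\<^bsub>?T\<^esub> pure_tensor R M N x y = pure_tensor R M N x (a \<odot>\<^bsub>N\<^esub> y)"
      using mod_hom_smult[OF pure_tensor_right_hom[OF assms(1,2) xy(1)] assms(3) xy(2)] by simp
    also have "\<dots> = \<zero>\<^bsub>?T\<^esub>"
      using assms(4) xy mod_hom_zero[OF assms(2) T pure_tensor_right_hom[OF assms(1,2) xy(1)]] by simp
    finally show "pure_tensor R M N x y \<in> {t \<in> carrier ?T. a \<odot>\<^bsub>?T\<^esub> t = \<zero>\<^bsub>?T\<^esub>}"
      using pure_tensor_closed[OF assms(1,2) xy] by simp
  qed
  then show ?thesis using assms(5) by blast
qed

section \<open>Vector spaces over the residue field\<close>

lemma max_ideal_maximal:
  assumes "local_ring R"
  shows "maximalideal (max_ideal R) R"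
  using assms theI'[of "\<lambda>\<mm>. maximalideal \<mm> R"] unfolding local_ring_def max_ideal_def by blast

text \<open>
  Read in the residue field: a nonzero class has an inverse.
\<close>

lemma inverse_mod_maximal:
  assumes "cring R" "maximalideal \<mm> R" "a \<in> carrier R" "a \<notin> \<mm>"
  obtains u where "u \<in> carrier R" "u \<otimes>\<^bsub>R\<^esub> a \<ominus>\<^bsub>R\<^esub> \<one>\<^bsub>R\<^esub> \<in> \<mm>"
proof -
  interpret R: cring R by fact
  interpret m: maximalideal \<mm> R by fact
  interpret K: field "R Quot \<mm>" by (rule m.quotient_is_field[OF assms(1)])
  have ac: "\<mm> +>\<^bsub>R\<^esub> a \<in> carrier (R Quot \<mm>)"
    using assms(3) by (auto simp: FactRing_def A_RCOSETS_def RCOSETS_def a_r_coset_def)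
  have "\<mm> +>\<^bsub>R\<^esub> a \<noteq> \<zero>\<^bsub>R Quot \<mm>\<^esub>"
    using m.a_rcos_self[OF assms(3)] assms(4) by (auto simp: FactRing_def)
  then have "\<mm> +>\<^bsub>R\<^esub> a \<in> Units (R Quot \<mm>)" using ac K.field_Units by blast
  then obtain U where U: "U \<in> carrier (R Quot \<mm>)" "U \<otimes>\<^bsub>R Quot \<mm>\<^esub> (\<mm> +>\<^bsub>R\<^esub> a) = \<one>\<^bsub>R Quot \<mm>\<^esub>"
    using K.Units_l_inv_ex by blast
  obtain u where u: "u \<in> carrier R" "U = \<mm> +>\<^bsub>R\<^esub> u"
    using U(1) by (auto simp: FactRing_def A_RCOSETS_def RCOSETS_def a_r_coset_def)
  have "\<mm> +>\<^bsub>R\<^esub> (u \<otimes>\<^bsub>R\<^esub> a) = \<mm> +>\<^bsub>R\<^esub> \<one>\<^bsub>R\<^esub>"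
    using U(2) u assms(3) m.rcoset_mult_add[of u a] by (simp add: FactRing_def)
  then have "u \<otimes>\<^bsub>R\<^esub> a \<in> \<mm> +>\<^bsub>R\<^esub> \<one>\<^bsub>R\<^esub>" using m.a_rcos_self[of "u \<otimes>\<^bsub>R\<^esub> a"] u assms(3) by auto
  then have "u \<otimes>\<^bsub>R\<^esub> a \<ominus>\<^bsub>R\<^esub> \<one>\<^bsub>R\<^esub> \<in> \<mm>"
    using m.a_rcos_module[of "\<one>\<^bsub>R\<^esub>" "u \<otimes>\<^bsub>R\<^esub> a"] u assms(3) by (simp add: a_minus_def)
  then show thesis using u(1) that by blast
qed

lemma residue_space_smult:
  assumes "cring R" "maximalideal \<mm> R" "module R V"
    "\<And>a v. a \<in> \<mm> \<Longrightarrow> v \<in> carrier V \<Longrightarrow> a \<odot>\<^bsub>V\<^esub> v = \<zero>\<^bsub>V\<^esub>"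
    "a \<in> carrier R" "v \<in> carrier V"
  shows "(\<mm> +>\<^bsub>R\<^esub> a) \<odot>\<^bsub>residue_space R V\<^esub> v = a \<odot>\<^bsub>V\<^esub> v"
proof -
  interpret m: maximalideal \<mm> R by fact
  interpret V: module R V by fact
  have "a' \<odot>\<^bsub>V\<^esub> v = a \<odot>\<^bsub>V\<^esub> v" if a': "a' \<in> \<mm> +>\<^bsub>R\<^esub> a" for a'
  proof -
    obtain h where h: "h \<in> \<mm>" "a' = h \<oplus>\<^bsub>R\<^esub> a" using a' by (auto simp: a_r_coset_def')
    then show ?thesis using assms(4-6) by (simp add: V.smult_l_distr)
  qed
  moreover have "a \<in> \<mm> +>\<^bsub>R\<^esub> a" using m.a_rcos_self assms(5) by blast
  ultimately have "(THE w. \<exists>a'\<in>\<mm> +>\<^bsub>R\<^esub> a. w = a' \<odot>\<^bsub>V\<^esub> v) = a \<odot>\<^bsub>V\<^esub> v"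
    by (intro the_equality) blast+
  then show ?thesis by (simp add: residue_space_def)
qed

text \<open>
  The ring \<open>R\<close> and its residue field act on \<open>V\<close> through the same operators, so the two structures
  have the same submodules.
\<close>

lemma submod_span_residue_space:
  assumes "cring R" "maximalideal \<mm> R" "module R V"
    "\<And>a v. a \<in> \<mm> \<Longrightarrow> v \<in> carrier V \<Longrightarrow> a \<odot>\<^bsub>V\<^esub> v = \<zero>\<^bsub>V\<^esub>"
  shows "submod_span (R Quot \<mm>) (residue_space R V) U = submod_span R V U"
proof -
  let ?W = "residue_space R V"
  have sub: "subgroup H (add_monoid ?W) \<longleftrightarrow> subgroup H (add_monoid V)" for H
    by (simp add: subgroup_def m_inv_def residue_space_def)
  have "submodule H (R Quot \<mm>) ?W \<longleftrightarrow> submodule H R V" for H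
  proof -
    have "(\<forall>A\<in>carrier (R Quot \<mm>). \<forall>v\<in>H. A \<odot>\<^bsub>?W\<^esub> v \<in> H) \<longleftrightarrow> (\<forall>a\<in>carrier R. \<forall>v\<in>H. a \<odot>\<^bsub>V\<^esub> v \<in> H)"
      if "subgroup H (add_monoid V)"
    proof -
      have "H \<subseteq> carrier V" using subgroup.subset[OF that] by simp
      moreover have "carrier (R Quot \<mm>) = (\<lambda>a. \<mm> +>\<^bsub>R\<^esub> a) ` carrier R"
        by (auto simp: FactRing_def A_RCOSETS_def RCOSETS_def a_r_coset_def)
      ultimately show ?thesis using residue_space_smult[OF assms] by (auto simp: subset_iff)
    qed
    then show ?thesis unfolding submodule_def submodule_axioms_def sub by blast
  qed
  then show ?thesis by (simp add: submod_span_def)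
qed

text \<open>
  A generating set of least cardinality is a basis: in a nontrivial relation some coefficient is
  invertible, so one generator could be dropped. The argument runs over \<open>R\<close>, with inverses modulo
  the maximal ideal \<open>\<mm>\<close>, which suffice because \<open>\<mm>\<close> annihilates \<open>V\<close>.
\<close>

lemma residue_space_basis_exists:
  fixes R :: "'a ring"
  assumes "cring R" "maximalideal \<mm> R" "fin_gen R V"
    "\<And>a v. a \<in> \<mm> \<Longrightarrow> v \<in> carrier V \<Longrightarrow> a \<odot>\<^bsub>V\<^esub> v = \<zero>\<^bsub>V\<^esub>"
  shows "\<exists>B. finite_basis (R Quot \<mm>) (residue_space R V) B"
proof -
  let ?K = "R Quot \<mm>" and ?W = "residue_space R V"
  have V: "module R V" using assms(3) by (simp add: fin_gen_def)
  interpret m: maximalideal \<mm> R by fact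
  interpret V: module R V by fact
  define P where "P B \<longleftrightarrow> finite B \<and> B \<subseteq> carrier V \<and> submod_span R V B = carrier V" for B
  have "\<exists>B. P B" using assms(3) unfolding fin_gen_def P_def by blast
  then obtain B where B: "P B" "\<And>B'. P B' \<Longrightarrow> card B \<le> card B'"
    using exists_least_iff[of "\<lambda>n. \<exists>B. P B \<and> card B = n"] by (metis not_le)
  have fB: "finite B" "B \<subseteq> carrier V" "submod_span R V B = carrier V" using B(1) by (auto simp: P_def)
  have finsum: "finsum ?W f B = finsum V f B" for f :: "'b \<Rightarrow> 'b"
    by (simp add: finsum_def finprod_def residue_space_def)
  have "c v = \<zero>\<^bsub>?K\<^esub>" if c: "c \<in> B \<rightarrow> carrier ?K" "(\<Oplus>\<^bsub>?W\<^esub>v\<in>B. c v \<odot>\<^bsub>?W\<^esub> v) = \<zero>\<^bsub>?W\<^esub>" and v: "v \<in> B" for c v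
  proof (rule ccontr)
    assume nz: "c v \<noteq> \<zero>\<^bsub>?K\<^esub>"
    have "\<forall>w\<in>B. \<exists>a\<in>carrier R. c w = \<mm> +>\<^bsub>R\<^esub> a"
      using c(1) by (auto simp: Pi_iff FactRing_def A_RCOSETS_def RCOSETS_def a_r_coset_def)
    then obtain a where a: "\<And>w. w \<in> B \<Longrightarrow> a w \<in> carrier R" "\<And>w. w \<in> B \<Longrightarrow> c w = \<mm> +>\<^bsub>R\<^esub> a w"
      by metis
    have "a v \<notin> \<mm>" using nz a v m.a_rcos_const[of "a v"] by (auto simp: FactRing_def)
    then obtain u where u: "u \<in> carrier R" "u \<otimes>\<^bsub>R\<^esub> a v \<ominus>\<^bsub>R\<^esub> \<one>\<^bsub>R\<^esub> \<in> \<mm>"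
      using inverse_mod_maximal[OF assms(1,2) a(1)[OF v]] by metis
    let ?B = "B - {v}"
    have vc: "v \<in> carrier V" using v fB by auto
    have S: "submodule (submod_span R V ?B) R V" by (rule submod_span_submodule[OF V]) (use fB in auto)
    have sc: "c w \<odot>\<^bsub>?W\<^esub> w = a w \<odot>\<^bsub>V\<^esub> w" if "w \<in> B" for w
      using residue_space_smult[OF assms(1,2) V assms(4) a(1), of w w] a(2) that fB by auto
    have "\<zero>\<^bsub>V\<^esub> = finsum V (\<lambda>w. c w \<odot>\<^bsub>?W\<^esub> w) B"
      using c(2) unfolding finsum by (simp add: residue_space_def)
    also have "\<dots> = (\<Oplus>\<^bsub>V\<^esub>w\<in>B. a w \<odot>\<^bsub>V\<^esub> w)"
      using sc a fB by (intro V.M.finsum_cong') auto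
    also have "\<dots> = (\<Oplus>\<^bsub>V\<^esub>w\<in>insert v ?B. a w \<odot>\<^bsub>V\<^esub> w)" using v by (simp add: insert_absorb)
    also have "\<dots> = a v \<odot>\<^bsub>V\<^esub> v \<oplus>\<^bsub>V\<^esub> (\<Oplus>\<^bsub>V\<^esub>w\<in>?B. a w \<odot>\<^bsub>V\<^esub> w)"
      using a fB v by (intro V.M.finsum_insert) (auto simp: Pi_iff subset_iff)
    finally have sum: "a v \<odot>\<^bsub>V\<^esub> v \<oplus>\<^bsub>V\<^esub> (\<Oplus>\<^bsub>V\<^esub>w\<in>?B. a w \<odot>\<^bsub>V\<^esub> w) = \<zero>\<^bsub>V\<^esub>" by simp
    have s: "(\<Oplus>\<^bsub>V\<^esub>w\<in>?B. a w \<odot>\<^bsub>V\<^esub> w) \<in> submod_span R V ?B"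
      by (rule submodule_finsum[OF V S])
        (use fB a submod_span_superset[of ?B R V] in \<open>auto intro!: submodule_smult[OF S]\<close>)
    have "(\<Oplus>\<^bsub>V\<^esub>w\<in>?B. a w \<odot>\<^bsub>V\<^esub> w) \<in> carrier V" using s submodule_subset[OF S] by auto
    then have "a v \<odot>\<^bsub>V\<^esub> v = \<ominus>\<^bsub>V\<^esub> (\<Oplus>\<^bsub>V\<^esub>w\<in>?B. a w \<odot>\<^bsub>V\<^esub> w)"
      using sum V.M.minus_equality a(1)[OF v] vc by (metis V.smult_closed)
    then have "a v \<odot>\<^bsub>V\<^esub> v \<in> submod_span R V ?B"
      using V.submoduleE(3)[OF S s] by simp
    then have "u \<odot>\<^bsub>V\<^esub> (a v \<odot>\<^bsub>V\<^esub> v) \<in> submod_span R V ?B" by (rule submodule_smult[OF S u(1)])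
    moreover have "u \<odot>\<^bsub>V\<^esub> (a v \<odot>\<^bsub>V\<^esub> v) = v"
    proof -
      have "\<zero>\<^bsub>V\<^esub> = (u \<otimes>\<^bsub>R\<^esub> a v \<ominus>\<^bsub>R\<^esub> \<one>\<^bsub>R\<^esub>) \<odot>\<^bsub>V\<^esub> v" using assms(4)[OF u(2) vc] by simp
      also have "\<dots> = u \<odot>\<^bsub>V\<^esub> (a v \<odot>\<^bsub>V\<^esub> v) \<ominus>\<^bsub>V\<^esub> v"
        using u(1) a(1)[OF v] vc by (simp add: a_minus_def V.smult_l_distr V.smult_l_minus V.smult_assoc1)
      finally show ?thesis using minus_eq_zero_iff[OF V, of "u \<odot>\<^bsub>V\<^esub> (a v \<odot>\<^bsub>V\<^esub> v)" v] u(1) a(1)[OF v] vc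
        by simp
    qed
    ultimately have "v \<in> submod_span R V ?B" by simp
    then have "B \<subseteq> submod_span R V ?B" using submod_span_superset[of ?B R V] by blast
    then have "carrier V \<subseteq> submod_span R V ?B" using submod_span_minimal[OF S] fB(3) by metis
    then have "P ?B" using fB submodule_subset[OF S] unfolding P_def by auto
    then have "card B \<le> card ?B" by (rule B(2))
    then show False using card_Diff1_less[OF fB(1) v] by simp
  qed
  then show ?thesis
    using fB submod_span_residue_space[OF assms(1,2) V assms(4), of B]
    unfolding finite_basis_def by (intro exI[of _ B]) (auto simp: residue_space_def)
qed

text \<open>
  The dimension is the cardinality of a chosen basis, so the existence of a finite basis has to be
  known before anything can be said about it.
\<close>

lemma vs_dim_residue_space_pos:
  fixes R :: "'a ring"
  assumes "cring R" "maximalideal \<mm> R" "fin_gen R V"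
    "\<And>a v. a \<in> \<mm> \<Longrightarrow> v \<in> carrier V \<Longrightarrow> a \<odot>\<^bsub>V\<^esub> v = \<zero>\<^bsub>V\<^esub>" "\<not> zero_module V"
  shows "vs_dim (R Quot \<mm>) (residue_space R V) \<ge> 1"
proof -
  have V: "module R V" using assms(3) by (simp add: fin_gen_def)
  define B where "B = (SOME B. finite_basis (R Quot \<mm>) (residue_space R V) B)"
  have "finite_basis (R Quot \<mm>) (residue_space R V) B"
    unfolding B_def by (rule someI_ex[OF residue_space_basis_exists[OF assms(1-4)]])
  then have B: "finite B" "submod_span R V B = carrier V"
    using submod_span_residue_space[OF assms(1,2) V assms(4), of B]
    by (auto simp: finite_basis_def residue_space_def)
  have "B \<noteq> {}" using B(2) submod_span_empty[OF V] assms(5) by (auto simp: zero_module_def)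
  then show ?thesis using B(1) by (simp add: vs_dim_def B_def[symmetric] Suc_le_eq card_gt_0_iff)
qed

section \<open>Positivity of the zeroth Betti number\<close>

text \<open>
  The module \<open>Tor 0 (M, k)\<close> is the cokernel of \<open>F 1 \<otimes> k \<rightarrow> F 0 \<otimes> k\<close>. It is finitely generated and killed by
  the maximal ideal \<open>\<mm>\<close>, so the dimension is that of an honest vector space. It is nonzero because
  \<open>f \<otimes> (a + \<mm>) \<mapsto> a \<epsilon>(f) + \<mm>M\<close> maps it onto \<open>M/\<mm>M\<close>, which is nonzero.
\<close>

lemma betti_zero_pos:
  fixes R :: "'a ring"
  assumes "local_ring R" "fin_gen R M" "ideal_smult R (max_ideal R) M \<noteq> carrier M"
  shows "betti R 0 M \<ge> 1"
proof -
  let ?\<mm> = "max_ideal R" and ?k = "residue_field_module R"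
  have cr: "cring R" and noe: "noetherian_ring R" using assms(1) by (auto simp: local_ring_def)
  interpret R: cring R by fact
  have m: "maximalideal ?\<mm> R" by (rule max_ideal_maximal[OF assms(1)])
  interpret m: maximalideal ?\<mm> R by fact
  have mc: "?\<mm> \<subseteq> carrier R" by (rule m.a_subset)
  have M: "module R M" using assms(2) by (simp add: fin_gen_def)
  interpret M: module R M by fact
  note S = self_module_module[OF cr]
  have ms: "submodule ?\<mm> R (self_module R)"
    using submodule_self_module_iff[OF cr] m.is_ideal by blast
  have k: "module R ?k" unfolding residue_field_module_def by (rule quot_module_module[OF S ms])
  let ?q = "\<lambda>x. ?\<mm> +>\<^bsub>self_module R\<^esub> x"
  have q: "?q \<in> mod_hom R (self_module R) ?k" "?q ` carrier (self_module R) = carrier ?k"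
    unfolding residue_field_module_def
    using quot_map_hom[OF S ms] quot_module_carrier[of "self_module R" ?\<mm>] by auto
  have kfg: "fin_gen R ?k"
    using noetherian_module_fin_gen[OF self_module_noetherian[OF cr noe]] k q by (rule fin_gen_image)
  have kz: "a \<odot>\<^bsub>?k\<^esub> y = \<zero>\<^bsub>?k\<^esub>" if a: "a \<in> ?\<mm>" and y: "y \<in> carrier ?k" for a y
  proof -
    obtain x where x: "x \<in> carrier R" "y = ?q x" using y q(2) by auto
    have "a \<odot>\<^bsub>?k\<^esub> y = ?q (a \<otimes>\<^bsub>R\<^esub> x)" using mod_hom_smult[OF q(1), of a x] x a mc by auto
    also have "\<dots> = ?\<mm>" using coset_eq_submodule_iff[OF S ms, of "a \<otimes>\<^bsub>R\<^esub> x"] a x mc m.I_r_closed by auto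
    finally show ?thesis by (simp add: residue_field_module_def quot_module_zero)
  qed
  obtain b d \<epsilon> where r: "some_resolution R M = (b, d)" "free_resolution R M b d \<epsilon>"
    using some_resolution_props[OF noe assms(2)] by blast
  define F where "F i = free_module R {..<b i}" for i
  have d: "d i \<in> mod_hom R (F (Suc i)) (F i)" for i
    using r(2) by (simp add: free_resolution_def Let_def F_def)
  have e: "\<epsilon> \<in> mod_hom R (F 0) M" "\<epsilon> ` carrier (F 0) = carrier M"
    and d0: "d 0 ` carrier (F (Suc 0)) = a_kernel (F 0) M \<epsilon>"
    using r(2) by (simp_all add: free_resolution_def Let_def F_def)
  have F: "module R (F i)" for i unfolding F_def by (rule free_module_module[OF cr])
  have Ffg: "fin_gen R (F i)" for i unfolding F_def
    by (intro noetherian_module_fin_gen free_module_noetherian[OF cr noe]) simp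
  let ?C = "\<lambda>i. tensor R (F i) ?k"
  let ?D = "tensor_map_left R (F (Suc 0)) (F 0) ?k (d 0)"
  let ?B = "?D ` carrier (?C (Suc 0))"
  note C = tensor_module[OF F k]
  note dp = tensor_map_left_pure[OF F k F k F F k d]
  have D: "?D \<in> mod_hom R (?C (Suc 0)) (?C 0)"
    by (rule tensor_map_left_hom[OF F k F k F F k d])
  have B: "submodule ?B R (?C 0)" by (rule submodule_image[OF C C D module.carrier_is_submodule[OF C]])
  have tor: "tor R 0 M ?k = quot_module (?C 0) ?B"
    by (simp add: tor_def r(1) F_def)
  note T = quot_module_module[OF C B]
  have \<pi>: "(\<lambda>x. ?B +>\<^bsub>?C 0\<^esub> x) ` carrier (?C 0) = carrier (quot_module (?C 0) ?B)"
    by (simp add: quot_module_carrier)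
  have fg: "fin_gen R (quot_module (?C 0) ?B)"
    by (rule fin_gen_image[OF fin_gen_tensor[OF Ffg kfg] T quot_map_hom[OF C B] \<pi>])
  have ann: "a \<odot>\<^bsub>quot_module (?C 0) ?B\<^esub> y = \<zero>\<^bsub>quot_module (?C 0) ?B\<^esub>"
    if a: "a \<in> ?\<mm>" and y: "y \<in> carrier (quot_module (?C 0) ?B)" for a y
  proof -
    have ac: "a \<in> carrier R" using a mc by auto
    show ?thesis
      by (rule annihilates_image[OF C T quot_map_hom[OF C B] \<pi> ac _ y])
        (rule annihilates_tensor[OF F k ac kz[OF a]])
  qed
  have "?B \<noteq> carrier (?C 0)"
  proof
    assume eq: "?B = carrier (?C 0)"
    let ?U = "{a \<odot>\<^bsub>M\<^esub> x | a x. a \<in> ?\<mm> \<and> x \<in> carrier M}"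
    let ?I = "ideal_smult R ?\<mm> M"
    have U: "?U \<subseteq> carrier M" using mc by auto
    have I: "submodule ?I R M" unfolding ideal_smult_def by (rule submod_span_submodule[OF M U])
    let ?Q = "quot_module M ?I"
    note Q = quot_module_module[OF M I]
    note p = quot_map_hom[OF M I]
    interpret Q: module R ?Q by (rule Q)
    \<comment> \<open>Multiplication of \<open>x\<close> by residue classes is well defined modulo \<open>\<mm>M\<close>.\<close>
    have "\<exists>g. g \<in> mod_hom R ?k ?Q \<and> (\<forall>a\<in>carrier R. g (?q a) = ?I +>\<^bsub>M\<^esub> (a \<odot>\<^bsub>M\<^esub> x))"
      if x: "x \<in> carrier M" for x
    proof -
      have h: "(\<lambda>a. ?I +>\<^bsub>M\<^esub> (a \<odot>\<^bsub>M\<^esub> x)) \<in> mod_hom R (self_module R) ?Q"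
        by (rule mod_hom_compose[OF _ p], rule mod_homI)
          (auto simp: x M.smult_l_distr M.smult_assoc1)
      have z: "?I +>\<^bsub>M\<^esub> (a \<odot>\<^bsub>M\<^esub> x) = \<zero>\<^bsub>?Q\<^esub>" if "a \<in> ?\<mm>" for a
      proof -
        have "a \<odot>\<^bsub>M\<^esub> x \<in> ?I" unfolding ideal_smult_def using that x by (intro subsetD[OF submod_span_superset]) auto
        then show ?thesis
          using coset_eq_submodule_iff[OF M I, of "a \<odot>\<^bsub>M\<^esub> x"] that x mc by (auto simp: quot_module_zero)
      qed
      show ?thesis
        using quot_module_lift[OF S ms Q h z] unfolding residue_field_module_def self_module_sel by metis
    qed
    then obtain g where g: "\<And>x. x \<in> carrier M \<Longrightarrow> g x \<in> mod_hom R ?k ?Q"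
      "\<And>x a. x \<in> carrier M \<Longrightarrow> a \<in> carrier R \<Longrightarrow> g x (?q a) = ?I +>\<^bsub>M\<^esub> (a \<odot>\<^bsub>M\<^esub> x)"
      by metis
    have kE: "\<exists>a\<in>carrier R. y = ?q a" if "y \<in> carrier ?k" for y using that q(2) by auto
    have bil: "bilinear_map R (F 0) ?k ?Q (\<lambda>f. g (\<epsilon> f))"
      unfolding bilinear_map_def
    proof (intro conjI ballI)
      fix y assume "y \<in> carrier ?k"
      then obtain a where a: "a \<in> carrier R" "y = ?q a" using kE by blast
      have "(\<lambda>x. g x y) \<in> mod_hom R M ?Q"
        by (rule mod_homI)
          (simp_all add: a g(2) mod_hom_closed[OF p] M.smult_r_distr M.smult_assoc1[symmetric] R.m_comm[of a]
            mod_hom_add[OF p, symmetric] mod_hom_smult[OF p, symmetric])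
      from mod_hom_compose[OF e(1) this] show "(\<lambda>f. g (\<epsilon> f) y) \<in> mod_hom R (F 0) ?Q" .
    qed (auto intro: g(1) mod_hom_closed[OF e(1)])
    obtain h where h: "h \<in> mod_hom R (?C 0) ?Q"
      "\<And>x y. x \<in> carrier (F 0) \<Longrightarrow> y \<in> carrier ?k \<Longrightarrow> h (pure_tensor R (F 0) ?k x y) = g (\<epsilon> x) y"
      using tensor_lift_exists[OF F k Q bil] by blast
    have zh: "(\<lambda>t. \<zero>\<^bsub>?Q\<^esub>) \<in> mod_hom R (?C (Suc 0)) ?Q" by (rule mod_homI) auto
    have hD: "h (?D t) = \<zero>\<^bsub>?Q\<^esub>" if t: "t \<in> carrier (?C (Suc 0))" for t
    proof (rule tensor_hom_eqI[OF F k Q mod_hom_compose[OF D h(1)] zh _ t])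
      fix x y assume xy: "x \<in> carrier (F (Suc 0))" "y \<in> carrier ?k"
      have dx: "d 0 x \<in> carrier (F 0)" "\<epsilon> (d 0 x) = \<zero>\<^bsub>M\<^esub>" using d0 xy by (auto simp: a_kernel_eq)
      obtain a where a: "a \<in> carrier R" "y = ?q a" using kE xy by blast
      have "h (?D (pure_tensor R (F (Suc 0)) ?k x y)) = g \<zero>\<^bsub>M\<^esub> y"
        using xy dx by (simp add: dp h(2))
      also have "\<dots> = ?I +>\<^bsub>M\<^esub> \<zero>\<^bsub>M\<^esub>" using a g(2) by simp
      also have "\<dots> = \<zero>\<^bsub>?Q\<^esub>" using mod_hom_zero[OF M Q p] .
      finally show "h (?D (pure_tensor R (F (Suc 0)) ?k x y)) = \<zero>\<^bsub>?Q\<^esub>" .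
    qed
    have "x \<in> ?I" if x: "x \<in> carrier M" for x
    proof -
      obtain f where f: "f \<in> carrier (F 0)" "x = \<epsilon> f" using e(2) x by auto
      have q1: "?q \<one>\<^bsub>R\<^esub> \<in> carrier ?k" using q(2) by auto
      have "pure_tensor R (F 0) ?k f (?q \<one>\<^bsub>R\<^esub>) \<in> ?B"
        unfolding eq by (rule pure_tensor_closed[OF F k f(1) q1])
      then have "g x (?q \<one>\<^bsub>R\<^esub>) = \<zero>\<^bsub>?Q\<^esub>" using hD h(2)[OF f(1) q1] f(2) by auto
      then have "?I +>\<^bsub>M\<^esub> x = ?I" using g(2)[OF x R.one_closed] x by (simp add: quot_module_zero)
      then show ?thesis using coset_eq_submodule_iff[OF M I x] by simp
    qed
    then have "?I = carrier M" using submodule_subset[OF I] by auto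
    then show False using assms(3) by simp
  qed
  then have "\<not> zero_module (quot_module (?C 0) ?B)" using quot_module_zero_iff[OF C B] by simp
  then show ?thesis
    unfolding betti_def tor using vs_dim_residue_space_pos[OF cr m fg ann] by simp
qed

section \<open>Foxby equivalence\<close>

text \<open>
  Cancellation turns a triangle identity into bijectivity of evaluation; the next lemma does the same
  for the natural map of the Auslander class.
\<close>

lemma mod_iso_cancel_right:
  assumes "g \<in> mod_iso R M N" "h \<in> mod_iso R M P" "k \<in> mod_hom R N P"
    "\<And>x. x \<in> carrier M \<Longrightarrow> k (g x) = h x"
  shows "k \<in> mod_iso R N P"
proof -
  have "bij_betw (k \<circ> g) (carrier M) (carrier P)"
    using assms(2,4) by (subst bij_betw_cong[of _ _ h]) (auto simp: mod_iso_def)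
  then have "bij_betw k (carrier N) (carrier P)"
    using assms(1) bij_betw_comp_iff[of g "carrier M" "carrier N" k "carrier P"] by (simp add: mod_iso_def)
  then show ?thesis using assms(3) by (simp add: mod_iso_def)
qed

lemma mod_iso_cancel_left:
  assumes "k \<in> mod_iso R N P" "h \<in> mod_iso R M P" "g \<in> mod_hom R M N"
    "\<And>x. x \<in> carrier M \<Longrightarrow> k (g x) = h x"
  shows "g \<in> mod_iso R M N"
proof -
  have "bij_betw (k \<circ> g) (carrier M) (carrier P)"
    using assms(2,4) by (subst bij_betw_cong[of _ _ h]) (auto simp: mod_iso_def)
  moreover have "g ` carrier M \<subseteq> carrier N" using mod_hom_closed[OF assms(3)] by auto
  ultimately have "bij_betw g (carrier M) (carrier N)"
    using assms(1) bij_betw_comp_iff2[of k "carrier N" "carrier P" g "carrier M"] by (simp add: mod_iso_def)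
  then show ?thesis using assms(3) by (simp add: mod_iso_def)
qed

lemma unit_map_hom:
  assumes "module R W" "module R M"
  shows "(\<lambda>x. \<lambda>w\<in>carrier W. pure_tensor R W M w x) \<in> mod_hom R M (hom_module R W (tensor R W M))"
  by (rule mod_homI)
    (auto intro!: hom_moduleI[OF assms(1)] pure_tensor_left_hom[OF assms] restrict_ext
      simp: mod_hom_facts[OF pure_tensor_right_hom[OF assms]])

lemma evaluation_bilinear:
  assumes "module R W" "module R N"
  shows "bilinear_map R W (hom_module R W N) N (\<lambda>x \<psi>. \<psi> x)"
  unfolding bilinear_map_def
  using evaluation_hom[where R = R and M = W and N = N] by (auto simp: hom_module_carrier_iff)

text \<open>
  Let \<open>\<mu>\<close> be the isomorphism from \<open>M\<close> to \<open>Hom(\<omega>, \<omega> \<otimes> M)\<close>. Followed by \<open>Hom(\<omega>, \<theta>)\<close> it becomes an isomorphism \<open>\<nu>\<close> from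
  \<open>M\<close> to \<open>Hom(\<omega>, N)\<close>. The evaluation map composed with \<open>\<omega> \<otimes> \<nu>\<close> sends \<open>w \<otimes> x\<close> to \<open>\<nu> x w = \<theta>(w \<otimes> x)\<close>, so it is \<open>\<theta>\<close>;
  hence evaluation is an isomorphism. The vanishing conditions for \<open>N\<close> are those for \<open>M\<close>, read through
  \<open>\<theta>\<close> and \<open>\<nu>\<close>.
\<close>

lemma bass_class_of_auslander_class:
  fixes S :: "'a ring"
  assumes "auslander_class S \<omega> M" "module S N" "\<theta> \<in> mod_iso S (tensor S \<omega> M) N"
  shows "bass_class S \<omega> N"
proof -
  let ?T = "tensor S \<omega> M" and ?H = "hom_module S \<omega> N"
  let ?\<mu> = "\<lambda>x. \<lambda>w\<in>carrier \<omega>. pure_tensor S \<omega> M w x"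
  let ?\<nu> = "\<lambda>x. \<lambda>w\<in>carrier \<omega>. \<theta> (?\<mu> x w)"
  have cm: "cohen_macaulay S" and can: "canonical_module S \<omega>" and M: "module S M"
    and \<mu>: "?\<mu> \<in> mod_iso S M (hom_module S \<omega> ?T)"
    and tor: "\<And>i. i \<ge> 1 \<Longrightarrow> zero_module (tor S i \<omega> M)"
    and ext: "\<And>i. i \<ge> 1 \<Longrightarrow> zero_module (ext S i \<omega> ?T)"
    using assms(1) by (auto simp: auslander_class_def)
  have noe: "noetherian_ring S" and fg: "fin_gen S \<omega>"
    using can by (auto simp: canonical_module_def local_ring_def)
  have \<omega>: "module S \<omega>" using fg by (simp add: fin_gen_def)
  note T = tensor_module[OF \<omega> M] and H = hom_module_module[OF \<omega> assms(2)]
  have \<nu>: "?\<nu> \<in> mod_iso S M ?H"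
    by (rule mod_iso_compose[OF \<mu> postcompose_iso[OF \<omega> T assms(3)]])
  have \<nu>c: "?\<nu> x \<in> carrier ?H" if "x \<in> carrier M" for x
    using \<nu> that mod_hom_closed[of ?\<nu> S M ?H x] by (simp add: mod_iso_def)
  note ev = tensor_lift_props[OF \<omega> H assms(2) evaluation_bilinear[OF \<omega> assms(2)]]
  let ?ev = "tensor_lift S \<omega> ?H N (\<lambda>x \<psi>. \<psi> x)"
  obtain G where G: "G \<in> mod_iso S ?T (tensor S \<omega> ?H)"
    "\<And>w x. w \<in> carrier \<omega> \<Longrightarrow> x \<in> carrier M \<Longrightarrow> G (pure_tensor S \<omega> M w x) = pure_tensor S \<omega> ?H w (?\<nu> x)"
    using tensor_iso_right[OF \<omega> M H \<nu>] by blast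
  have Gh: "G \<in> mod_hom S ?T (tensor S \<omega> ?H)" and \<theta>h: "\<theta> \<in> mod_hom S ?T N"
    using G(1) assms(3) by (simp_all add: mod_iso_def)
  have evG: "?ev (G t) = \<theta> t" if t: "t \<in> carrier ?T" for t
  proof (rule tensor_hom_eqI[OF \<omega> M assms(2) mod_hom_compose[OF Gh ev(1)] \<theta>h _ t])
    fix w x assume w: "w \<in> carrier \<omega>" and x: "x \<in> carrier M"
    show "?ev (G (pure_tensor S \<omega> M w x)) = \<theta> (pure_tensor S \<omega> M w x)"
      unfolding G(2)[OF w x] ev(2)[OF w \<nu>c[OF x]] using w by simp
  qed
  have "?ev \<in> mod_iso S (tensor S \<omega> ?H) N"
    by (rule mod_iso_cancel_right[OF G(1) assms(3) ev(1) evG])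
  moreover have "zero_module (ext S i \<omega> N) \<and> zero_module (tor S i \<omega> ?H)" if i: "i \<ge> 1" for i
  proof -
    obtain j where j: "i = Suc j" using i by (cases i) auto
    show ?thesis
      using ext_zero_cong[OF noe fg T assms(2,3), of j] ext[OF i]
        tor_zero_cong[OF noe fg M H \<nu>, of j] tor[OF i] unfolding j by blast
  qed
  ultimately show ?thesis using cm can assms(2) by (simp add: bass_class_def)
qed

text \<open>
  Let \<open>\<psi>\<close> be the inverse of \<open>\<theta>\<close>. The composite \<open>\<kappa>\<close> of \<open>\<omega> \<otimes> \<psi>\<close> with evaluation is an isomorphism from \<open>\<omega> \<otimes> M\<close> to
  \<open>N\<close>, and \<open>\<kappa>(w \<otimes> x) = \<psi> x w\<close>. So \<open>Hom(\<omega>, \<kappa>)\<close> composed with the natural map is \<open>\<psi>\<close>, and the natural map is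
  an isomorphism. The vanishing conditions for \<open>M\<close> are those for \<open>N\<close>, read through \<open>\<kappa>\<close> and \<open>\<theta>\<close>.
\<close>

lemma auslander_class_of_bass_class:
  fixes S :: "'a ring"
  assumes "bass_class S \<omega> N" "module S M" "\<theta> \<in> mod_iso S (hom_module S \<omega> N) M"
  shows "auslander_class S \<omega> M"
proof -
  let ?T = "tensor S \<omega> M" and ?H = "hom_module S \<omega> N"
  let ?\<mu> = "\<lambda>x. \<lambda>w\<in>carrier \<omega>. pure_tensor S \<omega> M w x"
  let ?ev = "tensor_lift S \<omega> ?H N (\<lambda>x \<psi>. \<psi> x)"
  have cm: "cohen_macaulay S" and can: "canonical_module S \<omega>" and N: "module S N"
    and ev: "?ev \<in> mod_iso S (tensor S \<omega> ?H) N"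
    and ext: "\<And>i. i \<ge> 1 \<Longrightarrow> zero_module (ext S i \<omega> N)"
    and tor: "\<And>i. i \<ge> 1 \<Longrightarrow> zero_module (tor S i \<omega> ?H)"
    using assms(1) by (auto simp: bass_class_def)
  have noe: "noetherian_ring S" and fg: "fin_gen S \<omega>"
    using can by (auto simp: canonical_module_def local_ring_def)
  have \<omega>: "module S \<omega>" using fg by (simp add: fin_gen_def)
  note T = tensor_module[OF \<omega> assms(2)] and H = hom_module_module[OF \<omega> N]
  note evp = tensor_lift_pure[OF \<omega> H N evaluation_bilinear[OF \<omega> N]]
  obtain \<psi> where \<psi>: "\<psi> \<in> mod_iso S M ?H" by (rule mod_iso_inverse[OF H assms(3)])
  have \<psi>c: "\<psi> x \<in> carrier ?H" if "x \<in> carrier M" for x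
    using \<psi> that mod_hom_closed[of \<psi> S M ?H x] by (simp add: mod_iso_def)
  obtain G where G: "G \<in> mod_iso S ?T (tensor S \<omega> ?H)"
    "\<And>w x. w \<in> carrier \<omega> \<Longrightarrow> x \<in> carrier M \<Longrightarrow> G (pure_tensor S \<omega> M w x) = pure_tensor S \<omega> ?H w (\<psi> x)"
    using tensor_iso_right[OF \<omega> assms(2) H \<psi>] by blast
  have \<kappa>: "(\<lambda>t. ?ev (G t)) \<in> mod_iso S ?T N" by (rule mod_iso_compose[OF G(1) ev])
  have \<kappa>\<mu>: "(\<lambda>w\<in>carrier \<omega>. ?ev (G (?\<mu> x w))) = \<psi> x" if x: "x \<in> carrier M" for x
  proof (rule extensionalityI[of _ "carrier \<omega>"])
    show "\<psi> x \<in> extensional (carrier \<omega>)" using \<psi>c[OF x] by (simp add: hom_module_carrier_iff)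
    show "(\<lambda>w\<in>carrier \<omega>. ?ev (G (?\<mu> x w))) w = \<psi> x w" if w: "w \<in> carrier \<omega>" for w
      using w G(2)[OF w x] evp[OF w \<psi>c[OF x]] by simp
  qed simp
  have "?\<mu> \<in> mod_iso S M (hom_module S \<omega> ?T)"
    by (rule mod_iso_cancel_left[OF postcompose_iso[OF \<omega> T \<kappa>] \<psi> unit_map_hom[OF \<omega> assms(2)]])
      (rule \<kappa>\<mu>)
  moreover have "zero_module (tor S i \<omega> M) \<and> zero_module (ext S i \<omega> ?T)" if i: "i \<ge> 1" for i
  proof -
    obtain j where j: "i = Suc j" using i by (cases i) auto
    obtain \<kappa>' where \<kappa>': "\<kappa>' \<in> mod_iso S N ?T" by (rule mod_iso_inverse[OF T \<kappa>])
    show ?thesis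
      using ext_zero_cong[OF noe fg N T \<kappa>', of j] ext[OF i]
        tor_zero_cong[OF noe fg H assms(2,3), of j] tor[OF i] unfolding j by blast
  qed
  ultimately show ?thesis using cm can assms(2) by (simp add: auslander_class_def)
qed

section \<open>Nonvanishing and annihilation\<close>

lemma zero_module_image:
  assumes "module R M" "module R N" "f \<in> mod_hom R M N" "f ` carrier M = carrier N" "zero_module M"
  shows "zero_module N"
  using assms(4,5) mod_hom_zero[OF assms(1-3)] by (auto simp: zero_module_def)

lemma zero_tensor_right:
  assumes "module R M" "module R N" "zero_module N"
  shows "zero_module (tensor R M N)"
proof -
  note T = tensor_module[OF assms(1,2)]
  have "{\<zero>\<^bsub>tensor R M N\<^esub>} = carrier (tensor R M N)"
    by (rule tensor_generation[OF assms(1,2) zero_submodule[OF T]])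
      (use assms(3) mod_hom_zero[OF assms(2) T pure_tensor_right_hom[OF assms(1,2)]] in \<open>auto simp: zero_module_def\<close>)
  then show ?thesis by (simp add: zero_module_def)
qed

lemma zero_hom_module:
  assumes "module R M" "module R N" "zero_module N"
  shows "zero_module (hom_module R M N)"
proof -
  have "f = \<zero>\<^bsub>hom_module R M N\<^esub>" if f: "f \<in> carrier (hom_module R M N)" for f
    using f assms(3) mod_hom_closed[of f R M N]
    by (intro extensionalityI[of _ "carrier M"]) (auto simp: hom_module_carrier_iff zero_module_def)
  moreover have "\<zero>\<^bsub>hom_module R M N\<^esub> \<in> carrier (hom_module R M N)"
    using abelian_monoid.zero_closed[OF abelian_group.axioms(1)[OF module.axioms(2)[OF hom_module_module[OF assms(1,2)]]]] .
  ultimately show ?thesis unfolding zero_module_def by blast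
qed

lemma mod_isoD: "f \<in> mod_iso R M N \<Longrightarrow> f \<in> mod_hom R M N \<and> f ` carrier M = carrier N"
  by (auto simp: mod_iso_def bij_betw_def)

lemma max_ideal_square_subset:
  assumes "local_ring R"
  shows "max_ideal_square R \<subseteq> carrier R"
proof -
  have "ideal (max_ideal R) R" "ring R"
    using max_ideal_maximal[OF assms] assms by (auto simp: maximalideal_def local_ring_def cring_def)
  then show ?thesis using ring.ideal_prod_in_carrier by blast
qed

text \<open>
  Nakayama's lemma is immediate here: \<open>\<mm>M = M\<close> would give \<open>M = \<mm>(\<mm>M) = \<mm>\<^sup>2M = 0\<close>.
\<close>

lemma ideal_smult_proper:
  fixes R :: "'a ring"
  assumes "local_ring R" "module R M" "\<not> zero_module M"
    "ideal_smult R (max_ideal_square R) M = {\<zero>\<^bsub>M\<^esub>}"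
  shows "ideal_smult R (max_ideal R) M \<noteq> carrier M"
proof
  let ?m = "max_ideal R"
  assume eq: "ideal_smult R ?m M = carrier M"
  interpret M: module R M by fact
  interpret m: maximalideal ?m R by (rule max_ideal_maximal[OF assms(1)])
  have mc: "?m \<subseteq> carrier R" by (rule m.a_subset)
  have sq: "a \<odot>\<^bsub>M\<^esub> x = \<zero>\<^bsub>M\<^esub>" if "a \<in> max_ideal_square R" "x \<in> carrier M" for a x
    using assms(4) that ideal_smult_zero_iff[OF assms(2) max_ideal_square_subset[OF assms(1)]] by blast
  have ann: "a \<odot>\<^bsub>M\<^esub> x = \<zero>\<^bsub>M\<^esub>" if a: "a \<in> ?m" and x: "x \<in> carrier M" for a x
  proof -
    have ac: "a \<in> carrier R" using a mc by auto
    \<comment> \<open>The annihilator of \<open>a\<close> contains \<open>\<mm>M\<close>, as \<open>a b\<close> lies in the square of \<open>\<mm>\<close> for \<open>b \<in> \<mm>\<close>.\<close>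
    have "ideal_smult R ?m M \<subseteq> {x \<in> carrier M. a \<odot>\<^bsub>M\<^esub> x = \<zero>\<^bsub>M\<^esub>}"
      unfolding ideal_smult_def
    proof (rule submod_span_minimal[OF annihilated_submodule[OF assms(2) ac]], intro subsetI)
      fix z assume "z \<in> {b \<odot>\<^bsub>M\<^esub> y | b y. b \<in> ?m \<and> y \<in> carrier M}"
      then obtain b y where z: "z = b \<odot>\<^bsub>M\<^esub> y" "b \<in> ?m" "y \<in> carrier M" by blast
      have bc: "b \<in> carrier R" using z mc by auto
      have "a \<odot>\<^bsub>M\<^esub> z = (a \<otimes>\<^bsub>R\<^esub> b) \<odot>\<^bsub>M\<^esub> y" using z ac bc by (simp add: M.smult_assoc1)
      also have "\<dots> = \<zero>\<^bsub>M\<^esub>" by (rule sq[OF ideal_prod.prod[OF a z(2)] z(3)])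
      finally show "z \<in> {x \<in> carrier M. a \<odot>\<^bsub>M\<^esub> x = \<zero>\<^bsub>M\<^esub>}" using z bc by simp
    qed
    then show ?thesis using eq x by auto
  qed
  then have "ideal_smult R ?m M = {\<zero>\<^bsub>M\<^esub>}" using ideal_smult_zero_iff[OF assms(2) mc] by blast
  then show False using eq assms(3) by (simp add: zero_module_def)
qed

lemma annihilates_hom_module:
  assumes "module R M" "module R N" "a \<in> carrier R"
    "\<And>y. y \<in> carrier N \<Longrightarrow> a \<odot>\<^bsub>N\<^esub> y = \<zero>\<^bsub>N\<^esub>" "f \<in> carrier (hom_module R M N)"
  shows "a \<odot>\<^bsub>hom_module R M N\<^esub> f = \<zero>\<^bsub>hom_module R M N\<^esub>"
  using assms(4,5) mod_hom_closed[of f R M N] by (auto intro!: restrict_ext simp: hom_module_carrier_iff)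

section \<open>Strong homological minimal multiplicity through the Bass class\<close>

theorem proposition4p12:
  fixes R :: "'r ring"
  assumes "local_ring R"
  shows "strongly_hom_min_mult TYPE('s) R \<longleftrightarrow>
    (\<exists>(S :: 's ring) \<phi> (\<omega> :: 's coset_module) (N :: 's coset_module).
       local_ring_hom R S \<phi> \<and>
       fin_gen S N \<and> \<not> zero_module N \<and>
       canonical_module S \<omega> \<and>
       flat_hom R S \<phi> \<and> gorenstein (closed_fibre R S \<phi>) \<and>
       bass_class S \<omega> N \<and>
       ideal_smult S (max_ideal_square S) N = {\<zero>\<^bsub>N\<^esub>})"
proof
  assume "strongly_hom_min_mult TYPE('s) R"
  then obtain S :: "'s ring" and \<phi> and \<omega> M :: "'s coset_module" where
    S: "local_ring_hom R S \<phi>" "canonical_module S \<omega>" "flat_hom R S \<phi>" "gorenstein (closed_fibre R S \<phi>)"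
    and M: "fin_gen S M" "\<not> zero_module M" "auslander_class S \<omega> M"
      "ideal_smult S (max_ideal_square S) M = {\<zero>\<^bsub>M\<^esub>}"
    unfolding strongly_hom_min_mult_def strongly_hom_min_mult_of_type_def by blast
  have loc: "local_ring S" using S(1) by (simp add: local_ring_hom_def)
  have fg: "fin_gen S \<omega>" using S(2) by (simp add: canonical_module_def)
  have \<omega>: "module S \<omega>" and Mm: "module S M" using fg M(1) by (simp_all add: fin_gen_def)
  note T = tensor_module[OF \<omega> Mm]
  obtain N :: "'s coset_module" and \<theta> where N: "module S N" "\<theta> \<in> mod_iso S (tensor S \<omega> M) N"
    by (rule coset_copy[OF fin_gen_tensor[OF fg M(1)]])
  have \<theta>: "\<theta> \<in> mod_hom S (tensor S \<omega> M) N" "\<theta> ` carrier (tensor S \<omega> M) = carrier N"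
    using mod_isoD[OF N(2)] by auto
  have bass: "bass_class S \<omega> N" by (rule bass_class_of_auslander_class[OF M(3) N])
  have fgN: "fin_gen S N" by (rule fin_gen_image[OF fin_gen_tensor[OF fg M(1)] N(1) \<theta>])
  have nz: "\<not> zero_module N"
  proof
    assume z: "zero_module N"
    obtain \<theta>' where "\<theta>' \<in> mod_iso S N (tensor S \<omega> M)" by (rule mod_iso_inverse[OF T N(2)])
    then have zT: "zero_module (tensor S \<omega> M)" using zero_module_image[OF N(1) T _ _ z] mod_isoD by blast
    have "(\<lambda>x. \<lambda>w\<in>carrier \<omega>. pure_tensor S \<omega> M w x) \<in> mod_iso S M (hom_module S \<omega> (tensor S \<omega> M))"
      using M(3) by (simp add: auslander_class_def)
    then obtain \<mu>' where "\<mu>' \<in> mod_iso S (hom_module S \<omega> (tensor S \<omega> M)) M"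
      by (rule mod_iso_inverse[OF Mm])
    then have "zero_module M"
      using zero_module_image[OF hom_module_module[OF \<omega> T] Mm _ _ zero_hom_module[OF \<omega> T zT]] mod_isoD by blast
    then show False using M(2) by simp
  qed
  have "a \<odot>\<^bsub>N\<^esub> y = \<zero>\<^bsub>N\<^esub>" if a: "a \<in> max_ideal_square S" and y: "y \<in> carrier N" for a y
  proof -
    have ac: "a \<in> carrier S" using max_ideal_square_subset[OF loc] a by blast
    have "a \<odot>\<^bsub>M\<^esub> x = \<zero>\<^bsub>M\<^esub>" if "x \<in> carrier M" for x
      using M(4) ideal_smult_zero_iff[OF Mm max_ideal_square_subset[OF loc]] a that by blast
    from annihilates_image[OF T N(1) \<theta> ac annihilates_tensor[OF \<omega> Mm ac this] y] show ?thesis by simp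
  qed
  then have "ideal_smult S (max_ideal_square S) N = {\<zero>\<^bsub>N\<^esub>}"
    using ideal_smult_zero_iff[OF N(1) max_ideal_square_subset[OF loc]] by blast
  with S fgN nz bass show "\<exists>(S :: 's ring) \<phi> (\<omega> :: 's coset_module) (N :: 's coset_module).
       local_ring_hom R S \<phi> \<and>
       fin_gen S N \<and> \<not> zero_module N \<and>
       canonical_module S \<omega> \<and>
       flat_hom R S \<phi> \<and> gorenstein (closed_fibre R S \<phi>) \<and>
       bass_class S \<omega> N \<and>
       ideal_smult S (max_ideal_square S) N = {\<zero>\<^bsub>N\<^esub>}" by blast
next
  assume "\<exists>(S :: 's ring) \<phi> (\<omega> :: 's coset_module) (N :: 's coset_module).
       local_ring_hom R S \<phi> \<and>
       fin_gen S N \<and> \<not> zero_module N \<and>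
       canonical_module S \<omega> \<and>
       flat_hom R S \<phi> \<and> gorenstein (closed_fibre R S \<phi>) \<and>
       bass_class S \<omega> N \<and>
       ideal_smult S (max_ideal_square S) N = {\<zero>\<^bsub>N\<^esub>}"
  then obtain S :: "'s ring" and \<phi> and \<omega> N :: "'s coset_module" where
    S: "local_ring_hom R S \<phi>" "canonical_module S \<omega>" "flat_hom R S \<phi>" "gorenstein (closed_fibre R S \<phi>)"
    and N: "fin_gen S N" "\<not> zero_module N" "bass_class S \<omega> N"
      "ideal_smult S (max_ideal_square S) N = {\<zero>\<^bsub>N\<^esub>}"
    by blast
  have loc: "local_ring S" using S(1) by (simp add: local_ring_hom_def)
  have noe: "noetherian_ring S" using loc by (simp add: local_ring_def)
  have fg: "fin_gen S \<omega>" using S(2) by (simp add: canonical_module_def)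
  have \<omega>: "module S \<omega>" and Nm: "module S N" using fg N(1) by (simp_all add: fin_gen_def)
  let ?H = "hom_module S \<omega> N"
  note H = hom_module_module[OF \<omega> Nm]
  obtain M :: "'s coset_module" and \<theta> where M: "module S M" "\<theta> \<in> mod_iso S ?H M"
    by (rule coset_copy[OF fin_gen_hom_module[OF noe fg N(1)]])
  have \<theta>: "\<theta> \<in> mod_hom S ?H M" "\<theta> ` carrier ?H = carrier M"
    using mod_isoD[OF M(2)] by auto
  have ausl: "auslander_class S \<omega> M" by (rule auslander_class_of_bass_class[OF N(3) M])
  have fgM: "fin_gen S M" by (rule fin_gen_image[OF fin_gen_hom_module[OF noe fg N(1)] M(1) \<theta>])
  have nz: "\<not> zero_module M"
  proof
    assume z: "zero_module M"
    obtain \<theta>' where "\<theta>' \<in> mod_iso S M ?H" by (rule mod_iso_inverse[OF H M(2)])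
    then have zH: "zero_module ?H" using zero_module_image[OF M(1) H _ _ z] mod_isoD by blast
    have "tensor_lift S \<omega> ?H N (\<lambda>x \<psi>. \<psi> x) \<in> mod_iso S (tensor S \<omega> ?H) N"
      using N(3) by (simp add: bass_class_def)
    then have "zero_module N"
      using zero_module_image[OF tensor_module[OF \<omega> H] Nm _ _ zero_tensor_right[OF \<omega> H zH]] mod_isoD by blast
    then show False using N(2) by simp
  qed
  have "a \<odot>\<^bsub>M\<^esub> y = \<zero>\<^bsub>M\<^esub>" if a: "a \<in> max_ideal_square S" and y: "y \<in> carrier M" for a y
  proof -
    have ac: "a \<in> carrier S" using max_ideal_square_subset[OF loc] a by blast
    have "a \<odot>\<^bsub>N\<^esub> x = \<zero>\<^bsub>N\<^esub>" if "x \<in> carrier N" for x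
      using N(4) ideal_smult_zero_iff[OF Nm max_ideal_square_subset[OF loc]] a that by blast
    from annihilates_image[OF H M(1) \<theta> ac annihilates_hom_module[OF \<omega> Nm ac this] y] show ?thesis by simp
  qed
  then have sq: "ideal_smult S (max_ideal_square S) M = {\<zero>\<^bsub>M\<^esub>}"
    using ideal_smult_zero_iff[OF M(1) max_ideal_square_subset[OF loc]] by blast
  have "betti S 0 M \<ge> 1"
    by (rule betti_zero_pos[OF loc fgM ideal_smult_proper[OF loc M(1) nz sq]])
  with S fgM nz ausl sq show "strongly_hom_min_mult TYPE('s) R"
    unfolding strongly_hom_min_mult_def strongly_hom_min_mult_of_type_def by blast
qed

end
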